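(* Let $G\in\{\mathrm{GO}_{2n},\mathrm{O}_{2n}\}$ over $\mathbb F_q$. Fix a character $\chi\colon P\to\mathbb C^\times$, written as $\chi=(\alpha\circ m)(\beta\circ\chi_{\det})$ with characters $\alpha,\beta\colon\mathbb F_q^\times\to\mathbb C^\times$. Suppose either that $\beta=1$, or that $\beta^2=1$ and $G=\mathrm{O}_{2n}$ (so that $\chi=\chi^J$). (a) If $n=2m$ is even, then the intertwining operator $I$ on $\operatorname{Ind}_P^G\chi$ is diagonalizable and has eigenvalue multiset given by $$\left\{(-1)^{m-\lfloor i/2\rfloor}q^{m(m-1)+\lfloor i/2\rfloor^2}:1\le i\le n+1\right\},$$ where multiplicities are those of the restriction of $I$ to the subspace $(\operatorname{Ind}_P^G\chi)^\chi$, and the set of eigenvalues of $I$ on all of $\operatorname{Ind}_P^G\chi$ is the underlying set of this multiset. (b) If $n=2m+1$ is odd, then the intertwining operator $I$ on $\operatorname{Ind}_P^G\chi$ is diagonalizable and has eigenvalues given by $$\left\{\pm q^{m^2+i(i+1)}:0\le i\le m\right\}.$$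
   Context: $q$ is an odd prime power with $3\nmid q$, and $n\ge1$. $J=\begin{bmatrix}0&1_n\\1_n&0\end{bmatrix}$. $\mathrm{GO}_{2n}$ consists of $g\in\mathrm{GL}_{2n}(\mathbb F_q)$ with $g^\intercal Jg=\lambda J$ for some $\lambda\in\mathbb F_q^\times$; $\mathrm{O}_{2n}$ is the subgroup with $\lambda=1$. $P=\left\{\begin{bmatrix}A&B\\0&D\end{bmatrix}\in G\right\}$ with $n\times n$ blocks, and $U=\left\{\begin{bmatrix}1_n&B\\0&1_n\end{bmatrix}\in G\right\}$. $\chi_{\det}\colon P\to\mathbb F_q^\times$ is $\begin{bmatrix}A&B\\0&D\end{bmatrix}\mapsto(\det D)^{-1}$. $m\colon P\to\mathbb F_q^\times$ is $\begin{bmatrix}\lambda A&B\\0&A^{-\intercal}\end{bmatrix}\mapsto\lambda$ (trivial for $\mathrm{O}_{2n}$). (Every character of $P$ has the form $(\alpha\circ m)(\beta\circ\chi_{\det})$; the map $m$ should not be confused with the integer $m$ in (a), (b).) The character $\chi^J$ is $\chi^J\left(\begin{bmatrix}A&B\\0&D\end{bmatrix}\right)=\chi\left(\begin{bmatrix}D&0\\0&A\end{bmatrix}\right)$. $\operatorname{Ind}_P^G\chi$ is the space of functions $f\colon G\to\mathbb C$ with $f(pg)=\chi(p)f(g)$ for $p\in P$, $g\in G$, with $G$ acting by right translation; $(\operatorname{Ind}_P^G\chi)^\chi$ is the subspace of $f$ with $f(gp)=\chi(p)f(g)$ for all $p\in P$, $g\in G$. The operator $I\colon\operatorname{Ind}_P^G\chi\to\operatorname{Ind}_P^G\chi^J$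 is $(If)(g)=\sum_{u\in U}f(J^{-1}ug)$; it is $G$-equivariant. *)

theory Defs
  imports
    "Jordan_Normal_Form.Determinant"
    "HOL-Library.Function_Algebras"
    "HOL-Library.Multiset"
    "HOL-Library.Cardinality"
    Complex_Main
begin

section \<open>Siegel parabolic subgroups of split orthogonal groups\<close>

definition Jmat :: "nat \<Rightarrow> 'a::field mat" where
  "Jmat n = four_block_mat (0\<^sub>m n n) (1\<^sub>m n) (1\<^sub>m n) (0\<^sub>m n n)"

lemma Jmat_involution: "Jmat n * Jmat n = (1\<^sub>m (n + n) :: 'a::field mat)"
  unfolding Jmat_def
  by (subst mult_four_block_mat[where ?nr1.0 = n and ?n1.0 = n and ?n2.0 = n and ?nr2.0 = n
        and ?nc1.0 = n and ?nc2.0 = n])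
     (auto simp: four_block_one_mat)

definition GO :: "nat \<Rightarrow> 'a::field mat set" where
  "GO n = {g \<in> carrier_mat (2 * n) (2 * n). invertible_mat g \<and>
     (\<exists>l. l \<noteq> 0 \<and> transpose_mat g * Jmat n * g = l \<cdot>\<^sub>m Jmat n)}"

definition Orth :: "nat \<Rightarrow> 'a::field mat set" where
  "Orth n = {g \<in> carrier_mat (2 * n) (2 * n). invertible_mat g \<and>
     transpose_mat g * Jmat n * g = Jmat n}"

definition Siegel :: "'a::field mat set \<Rightarrow> nat \<Rightarrow> 'a mat set" where
  "Siegel G n = {g \<in> G. \<exists>A B D. A \<in> carrier_mat n n \<and> B \<in> carrier_mat n n \<and> D \<in> carrier_mat n n \<and>
     g = four_block_mat A B (0\<^sub>m n n) D}"

definition unip_rad :: "'a::field mat set \<Rightarrow> nat \<Rightarrow> 'a mat set" where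
  "unip_rad G n = {g \<in> G. \<exists>B. B \<in> carrier_mat n n \<and>
     g = four_block_mat (1\<^sub>m n) B (0\<^sub>m n n) (1\<^sub>m n)}"

section \<open>Characters\<close>

text \<open>
  A homomorphism from the group with underlying set \<open>S\<close> and product \<open>*\<close> to the
  multiplicative group of \<open>\<complex>\<close>; the values outside \<open>S\<close> are irrelevant. It is used for
  \<open>S\<close> the nonzero elements of a field and for \<open>S\<close> a group of matrices.
\<close>
definition mult_char :: "'b::times set \<Rightarrow> ('b \<Rightarrow> complex) \<Rightarrow> bool" where
  "mult_char S \<phi> \<longleftrightarrow> (\<forall>x\<in>S. \<phi> x \<noteq> 0) \<and> (\<forall>x\<in>S. \<forall>y\<in>S. \<phi> (x * y) = \<phi> x * \<phi> y)"

definition chi_det :: "nat \<Rightarrow> 'a::field mat \<Rightarrow> 'a" where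
  "chi_det n p = (case split_block p n n of (A, B, C, D) \<Rightarrow> inverse (det D))"

text \<open>The scalar \<open>l\<close> in \<open>p = [[l A, B], [0, inverse transpose of A]]\<close>; here \<open>A'\<close> is the inverse of \<open>A\<close>.
  For \<open>n \<ge> 1\<close> every element of the Siegel parabolic subgroup determines \<open>l\<close> uniquely.\<close>
definition multiplier :: "nat \<Rightarrow> 'a::field mat \<Rightarrow> 'a" where
  "multiplier n p = (THE l. l \<noteq> 0 \<and> (\<exists>A A' B.
     A \<in> carrier_mat n n \<and> A' \<in> carrier_mat n n \<and> B \<in> carrier_mat n n \<and>
     A * A' = 1\<^sub>m n \<and> A' * A = 1\<^sub>m n \<and>
     p = four_block_mat (l \<cdot>\<^sub>m A) B (0\<^sub>m n n) (transpose_mat A')))"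

definition char_J :: "nat \<Rightarrow> ('a::field mat \<Rightarrow> complex) \<Rightarrow> 'a mat \<Rightarrow> complex" where
  "char_J n \<chi> p = (case split_block p n n of (A, B, C, D) \<Rightarrow>
     \<chi> (four_block_mat D (0\<^sub>m n n) (0\<^sub>m n n) A))"

section \<open>Linear algebra on complex-valued functions\<close>

definition fscale :: "complex \<Rightarrow> ('b \<Rightarrow> complex) \<Rightarrow> 'b \<Rightarrow> complex" where
  "fscale c f = (\<lambda>x. c * f x)"

global_interpretation cfun: vector_space "fscale :: complex \<Rightarrow> ('b \<Rightarrow> complex) \<Rightarrow> 'b \<Rightarrow> complex"
  by standard (auto simp: fscale_def fun_eq_iff algebra_simps)

definition eigenvalues_on ::
    "(('b \<Rightarrow> complex) \<Rightarrow> ('b \<Rightarrow> complex)) \<Rightarrow> ('b \<Rightarrow> complex) set \<Rightarrow> complex set" where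
  "eigenvalues_on T V = {c. \<exists>f\<in>V. f \<noteq> 0 \<and> T f = fscale c f}"

definition diagonalizable_on ::
    "(('b \<Rightarrow> complex) \<Rightarrow> ('b \<Rightarrow> complex)) \<Rightarrow> ('b \<Rightarrow> complex) set \<Rightarrow> bool" where
  "diagonalizable_on T V \<longleftrightarrow> T ` V \<subseteq> V \<and>
     (\<exists>B. B \<subseteq> V \<and> cfun.independent B \<and> cfun.span B = V \<and> (\<forall>b\<in>B. \<exists>c. T b = fscale c b))"

text \<open>
  \<open>V\<close> is stable under \<open>T\<close>, and \<open>M\<close> lists the eigenvalues of the restriction of \<open>T\<close> to \<open>V\<close> with
  the dimensions of their eigenspaces as multiplicities. It is used only for finite-dimensional
  \<open>V\<close> contained in a space on which \<open>T\<close> is diagonalizable, where geometric and algebraic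
  multiplicities agree.
\<close>
definition has_eigenvalue_mset_on ::
    "(('b \<Rightarrow> complex) \<Rightarrow> ('b \<Rightarrow> complex)) \<Rightarrow> ('b \<Rightarrow> complex) set \<Rightarrow> complex multiset \<Rightarrow> bool" where
  "has_eigenvalue_mset_on T V M \<longleftrightarrow> T ` V \<subseteq> V \<and>
     (\<forall>c. cfun.dim {f \<in> V. T f = fscale c f} = count M c)"

section \<open>The induced representation and the intertwining operator\<close>

text \<open>Functions on \<open>G\<close> are represented by functions on all matrices that vanish outside \<open>G\<close>.\<close>
definition Ind ::
    "'a::field mat set \<Rightarrow> nat \<Rightarrow> ('a mat \<Rightarrow> complex) \<Rightarrow> ('a mat \<Rightarrow> complex) set" where
  "Ind G n \<chi> = {f. (\<forall>g. g \<notin> G \<longrightarrow> f g = 0) \<and>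
     (\<forall>p \<in> Siegel G n. \<forall>g\<in>G. f (p * g) = \<chi> p * f g)}"

definition Ind_eqv ::
    "'a::field mat set \<Rightarrow> nat \<Rightarrow> ('a mat \<Rightarrow> complex) \<Rightarrow> ('a mat \<Rightarrow> complex) set" where
  "Ind_eqv G n \<chi> = {f \<in> Ind G n \<chi>. \<forall>p \<in> Siegel G n. \<forall>g\<in>G. f (g * p) = \<chi> p * f g}"

text \<open>The inverse of \<open>Jmat n\<close> is \<open>Jmat n\<close> itself, by lemma \<open>Jmat_involution\<close>.\<close>
definition intertwiner ::
    "'a::field mat set \<Rightarrow> nat \<Rightarrow> ('a mat \<Rightarrow> complex) \<Rightarrow> 'a mat \<Rightarrow> complex" where
  "intertwiner G n f g = (if g \<in> G then \<Sum>u\<in>unip_rad G n. f (Jmat n * u * g) else 0)"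

end

theory Submission
  imports Defs "HOL-Computational_Algebra.Polynomial"
begin

text \<open>
  A coset \<open>P g\<close> is a maximal isotropic subspace \<open>L\<close> of the \<open>2 n\<close>-dimensional quadratic space, and for the
  trivial character the operator sums a function of \<open>L\<close> over all maximal isotropic subspaces
  complementary to \<open>L\<close>. The proof computes this operator in one step on the indicator functions
  \<open>incid vs\<close> of the condition that \<open>L\<close> contain a given \<open>k\<close>-dimensional isotropic subspace \<open>W\<close>. The complements
  of \<open>L\<close> containing \<open>W\<close> exist only if \<open>L \<inter> W = 0\<close>, and then there are \<open>q ^ ((n - k) choose 2)\<close> of them, since they
  correspond to skew matrices with \<open>k\<close> prescribed columns (\<open>card_skews_prescribed\<close>, \<open>T_incid\<close>). Expanding
  the condition \<open>L \<inter> W = 0\<close> over the subspaces of \<open>W\<close> contained in \<open>L\<close>, the coefficient of \<open>W\<close> itself is the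
  Moebius number \<open>(- 1) ^ k * q ^ (k choose 2)\<close> (\<open>transv_leading_term\<close>). So the operator is triangular for the
  filtration by \<open>k\<close>, with eigenvalues \<open>(- 1) ^ k * q ^ ((k choose 2) + ((n - k) choose 2))\<close>, \<open>0 \<le> k \<le> n\<close>
  (\<open>Filt_triangular\<close>). It is also self-adjoint (\<open>inn_T_sym\<close>), hence diagonalizable with these eigenvalues
  although some of them coincide (\<open>triangular_splitting\<close>).

  For the multiplicities on bi-invariant functions, put \<open>K = card (L \<inter> L\<^sub>0)\<close> with \<open>L\<^sub>0\<close> the standard isotropic
  subspace. Elimination shows that \<open>K\<close>, which takes the \<open>n + 1\<close> values \<open>q ^ j\<close>, determines the double coset
  (\<open>double_coset_rep\<close>), so bi-invariant functions are the polynomials in \<open>K\<close> of degree at most \<open>n\<close>. The operator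
  sends \<open>\<Prod>i<k. K - q ^ i\<close>, which counts independent \<open>k\<close>-tuples in \<open>L \<inter> L\<^sub>0\<close>, to \<open>q ^ ((n - k) choose 2)\<close> times
  \<open>\<Prod>i<k. q ^ n - q ^ i * K\<close>, which counts \<open>k\<close>-tuples of \<open>L\<^sub>0\<close> independent modulo \<open>L\<close> (\<open>T_Phi_product\<close>). It
  is thus triangular with each of the \<open>n + 1\<close> eigenvalues occurring once (\<open>Eqv_eigenbasis\<close>).

  A general \<open>\<chi>\<close> is reduced to the trivial one by extending it to a character \<open>\<theta>\<close> of \<open>G\<close>, which multiplies the
  operator by \<open>\<theta> (Jmat n)\<close> (\<open>twisted_spectrum\<close>). If \<open>\<beta> = 1\<close>, the similitude factor provides \<open>\<theta>\<close>. If \<open>\<beta>\<close> is the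
  quadratic character, \<open>\<theta>\<close> is the spinor norm, constructed by a Gauss-lemma count of sign changes on
  the vectors of norm \<open>1\<close> (\<open>spin\<close>). Its values on the parabolic subgroup follow because \<open>GL\<^sub>n\<close> is generated by
  dilations and squares (\<open>spin_Siegel\<close>). For even \<open>n\<close> it is \<open>1\<close> at \<open>Jmat n\<close> (\<open>spin_Jmat\<close>), and for odd \<open>n\<close> the list of
  eigenvalues is symmetric under sign change.
\<close>

section \<open>Independent tuples over a finite field\<close>

definition fvs :: "'a::field \<Rightarrow> (nat \<Rightarrow> 'a) \<Rightarrow> nat \<Rightarrow> 'a" where
  "fvs a v = (\<lambda>i. a * v i)"

global_interpretation fv: vector_space "fvs :: 'a::field \<Rightarrow> (nat \<Rightarrow> 'a) \<Rightarrow> nat \<Rightarrow> 'a"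
  by standard (auto simp: fvs_def fun_eq_iff algebra_simps)

abbreviation fv_linear :: "((nat \<Rightarrow> 'a::field) \<Rightarrow> nat \<Rightarrow> 'a) \<Rightarrow> bool" where
  "fv_linear \<equiv> Vector_Spaces.linear fvs fvs"

lemma fv_linearI:
  fixes y :: "(nat \<Rightarrow> 'a::field) \<Rightarrow> nat \<Rightarrow> 'a"
  assumes "\<And>v w. y (v + w) = y v + y w" and "\<And>a v. y (fvs a v) = fvs a (y v)"
  shows "fv_linear y"
  using assms by (intro Vector_Spaces.linear.intro module_hom.intro module_hom_axioms.intro
      fv.module_axioms fv.vector_space_axioms)

lemma fv_linear_ops:
  assumes "fv_linear y"
  shows "y (v + w) = y v + y w" "y (fvs a v) = fvs a (y v)" "y 0 = 0" "y (v - w) = y v - y w"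
    and "fv.span (y ` S) = y ` fv.span S"
proof -
  interpret l: Vector_Spaces.linear fvs fvs y by fact
  show "y (v + w) = y v + y w" "y (fvs a v) = fvs a (y v)" "y 0 = 0" "y (v - w) = y v - y w"
    "fv.span (y ` S) = y ` fv.span S"
    by (simp_all add: l.add l.scale l.diff l.zero l.span_image)
qed

text \<open>Vectors of length \<open>N\<close> are functions supported below \<open>N\<close>: sums and multiples then need no
  carrier conditions, and the standard isotropic subspace \<open>Vn n\<close> is literally a subspace
  of \<open>Vn (2 * n)\<close>.\<close>
definition Vn :: "nat \<Rightarrow> (nat \<Rightarrow> 'a::zero) set" where
  "Vn N = {v. \<forall>i\<ge>N. v i = 0}"

lemma subspace_Vn: "fv.subspace (Vn N)"
  by (auto simp: fv.subspace_def Vn_def fvs_def)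

lemma Vn_mono: "M \<le> N \<Longrightarrow> Vn M \<subseteq> Vn N"
  by (auto simp: Vn_def)

lemma bij_betw_Vn: "bij_betw (\<lambda>f i. if i < N then f i else 0) ({..<N} \<rightarrow>\<^sub>E UNIV) (Vn N)"
  by (rule bij_betw_byWitness[where f' = "\<lambda>v. restrict v {..<N}"])
     (auto simp: Vn_def fun_eq_iff PiE_def extensional_def restrict_def)

lemma card_Vn: "card (Vn N :: (nat \<Rightarrow> 'a::{finite,zero}) set) = CARD('a) ^ N"
  using bij_betw_same_card[OF bij_betw_Vn[of N, where 'a = 'a]] by (simp add: card_PiE)

lemma finite_Vn: "finite (Vn N :: (nat \<Rightarrow> 'a::{finite,zero}) set)"
  using bij_betw_finite[OF bij_betw_Vn[of N, where 'a = 'a]] by (simp add: finite_PiE)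

text \<open>Tuples are lists, and vectors are added at the front. The recursive definition is the one along
  which both the counting of tuples and the Moebius-type induction for \<open>transv_leading_term\<close> proceed.\<close>
fun lind :: "(nat \<Rightarrow> 'a::field) list \<Rightarrow> bool" where
  "lind [] = True"
| "lind (v # vs) = (v \<notin> fv.span (set vs) \<and> lind vs)"

lemma span_finite_card:
  fixes vs :: "(nat \<Rightarrow> 'a::{finite,field}) list"
  assumes "lind vs"
  shows "finite (fv.span (set vs)) \<and> card (fv.span (set vs)) = CARD('a) ^ length vs"
  using assms
proof (induction vs)
  case Nil
  then show ?case by simp
next
  case (Cons v vs)
  let ?h = "\<lambda>(a, w). fvs a v + w"
  have im: "fv.span (set (v # vs)) = ?h ` (UNIV \<times> fv.span (set vs))"
  proof (intro equalityI subsetI)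
    fix x assume "x \<in> fv.span (set (v # vs))"
    then obtain a where "x - fvs a v \<in> fv.span (set vs)"
      by (auto simp: fv.span_breakdown_eq)
    then show "x \<in> ?h ` (UNIV \<times> fv.span (set vs))"
      by (intro image_eqI[where x = "(a, x - fvs a v)"]) auto
  next
    fix x assume "x \<in> ?h ` (UNIV \<times> fv.span (set vs))"
    then obtain a w where "w \<in> fv.span (set vs)" "x = fvs a v + w" by auto
    then have "x - fvs a v \<in> fv.span (set vs)" by simp
    then show "x \<in> fv.span (set (v # vs))" by (auto simp: fv.span_breakdown_eq)
  qed
  have "inj_on ?h (UNIV \<times> fv.span (set vs))"
  proof (clarsimp simp: inj_on_def)
    fix a b w w' assume w: "w \<in> fv.span (set vs)" "w' \<in> fv.span (set vs)"
      and eq: "fvs a v + w = fvs b v + w'"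
    have "a = b"
    proof (rule ccontr)
      assume "a \<noteq> b"
      have "fvs (a - b) v = w' - w"
        using eq by (simp add: fv.scale_left_diff_distrib algebra_simps)
      then have "fvs (a - b) v \<in> fv.span (set vs)"
        using w by (simp add: fv.span_diff)
      then have "fvs (inverse (a - b)) (fvs (a - b) v) \<in> fv.span (set vs)"
        by (rule fv.span_scale)
      then show False using Cons.prems \<open>a \<noteq> b\<close> by simp
    qed
    then show "a = b \<and> w = w'" using eq by simp
  qed
  then show ?case
    using Cons unfolding im by (simp add: card_image card_cartesian_product)
qed

lemma span_subset_Vn: "set vs \<subseteq> Vn N \<Longrightarrow> fv.span (set vs) \<subseteq> Vn N"
  by (rule fv.span_minimal[OF _ subspace_Vn])

lemma card_field_gt_1: "CARD('a::{finite,field}) > 1"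
proof -
  have "card {0, 1 :: 'a} \<le> CARD('a)" by (rule card_mono) auto
  then show ?thesis by simp
qed

lemma lind_length_le:
  fixes vs :: "(nat \<Rightarrow> 'a::{finite,field}) list"
  assumes "lind vs" "set vs \<subseteq> Vn N"
  shows "length vs \<le> N"
proof -
  have "CARD('a) ^ length vs \<le> CARD('a) ^ N"
    using card_mono[OF finite_Vn span_subset_Vn[OF assms(2)]] span_finite_card[OF assms(1)]
    by (simp add: card_Vn)
  then show ?thesis using card_field_gt_1[where 'a = 'a] by simp
qed

text \<open>A proper subspace cannot contain all of \<open>Vn N\<close>, by comparing powers of the order of the field.\<close>
lemma lind_extend:
  fixes vs :: "(nat \<Rightarrow> 'a::{finite,field}) list"
  assumes "lind vs" "set vs \<subseteq> Vn N"
  shows "\<exists>us. lind (us @ vs) \<and> set us \<subseteq> Vn N \<and> length (us @ vs) = N"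
  using assms
proof (induction "N - length vs" arbitrary: vs)
  case 0
  then show ?case using lind_length_le[of vs N] by (intro exI[of _ "[]"]) auto
next
  case (Suc d)
  have "card (fv.span (set vs)) < card (Vn N :: (nat \<Rightarrow> 'a) set)"
    using span_finite_card[OF Suc.prems(1)] Suc.hyps(2) card_field_gt_1[where 'a = 'a]
    by (simp add: card_Vn)
  then obtain v where v: "v \<in> Vn N" "v \<notin> fv.span (set vs)"
    using span_subset_Vn[OF Suc.prems(2)] by (metis less_irrefl subsetI subset_antisym)
  have d: "d = N - length (v # vs)" using Suc.hyps(2) by simp
  obtain us where us: "lind (us @ (v # vs))" "set us \<subseteq> Vn N" "length (us @ v # vs) = N"
    using Suc.hyps(1)[OF d] Suc.prems v by auto
  then show ?case using v by (intro exI[of _ "us @ [v]"]) auto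
qed

lemma lind_reduce:
  fixes vs :: "(nat \<Rightarrow> 'a::field) list"
  shows "\<exists>us. lind us \<and> set us \<subseteq> set vs \<and> fv.span (set us) = fv.span (set vs)
    \<and> length us \<le> length vs"
proof (induction vs)
  case (Cons v vs)
  then obtain us where us: "lind us" "set us \<subseteq> set vs" "fv.span (set us) = fv.span (set vs)"
    "length us \<le> length vs" by blast
  show ?case
  proof (cases "v \<in> fv.span (set vs)")
    case True
    then have "fv.span (set us) = fv.span (set (v # vs))"
      using us(3) by (simp add: fv.span_redundant)
    then show ?thesis using us by (intro exI[of _ us]) auto
  next
    case False
    have "fv.span (set (v # us)) = fv.span (set (v # vs))"
      using us(3) by (auto simp: fv.span_breakdown_eq)
    then show ?thesis using us False by (intro exI[of _ "v # us"]) auto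
  qed
qed (auto intro: exI[of _ "[]"])

lemma lind_map_imp_lind:
  assumes "fv_linear y" "lind (map y vs)"
  shows "lind vs"
  using assms(2)
  by (induction vs) (auto simp: fv_linear_ops(5)[OF assms(1)])

lemma lind_map_inj:
  assumes "fv_linear y" "lind (map y vs)" "w \<in> fv.span (set vs)" "y w = 0"
  shows "w = 0"
  using assms(2-4)
proof (induction vs arbitrary: w)
  case (Cons v vs)
  obtain a where a: "w - fvs a v \<in> fv.span (set vs)"
    using Cons.prems(2) by (auto simp: fv.span_breakdown_eq)
  have "a = 0"
  proof (rule ccontr)
    assume "a \<noteq> 0"
    have "fvs (- inverse a) (w - fvs a v) \<in> fv.span (set vs)"
      using a by (rule fv.span_scale)
    moreover have "y (fvs (- inverse a) (w - fvs a v)) = fvs (- inverse a) (0 - fvs a (y v))"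
      using Cons.prems(3) by (simp only: fv_linear_ops[OF assms(1)])
    then have "y (fvs (- inverse a) (w - fvs a v)) = y v"
      using \<open>a \<noteq> 0\<close> by (simp add: fvs_def fun_eq_iff)
    ultimately have "y v \<in> y ` fv.span (set vs)" by (metis imageI)
    then show False using Cons.prems(1) by (simp add: fv_linear_ops(5)[OF assms(1)])
  qed
  then show ?case using a Cons by auto
qed simp

text \<open>A further vector of \<open>W\<close> spoils independence of the images exactly when it lies in the sum of
  the kernel of \<open>y\<close> on \<open>W\<close> and the span of the vectors already chosen. That sum is direct.
  The count is taken in the complex numbers because a factor can be zero with later ones negative.\<close>
lemma card_lind_tuples:
  fixes W :: "(nat \<Rightarrow> 'a::{finite,field}) set"
  assumes y: "fv_linear y" and W: "fv.subspace W" "finite W"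
  shows "of_nat (card {vs. set vs \<subseteq> W \<and> length vs = k \<and> lind (map y vs)}) =
    (\<Prod>i<k. of_nat (card W) - of_nat (card {w \<in> W. y w = 0}) * of_nat CARD('a) ^ i :: complex)"
proof (induction k)
  case 0
  have "{vs. set vs \<subseteq> W \<and> length vs = 0 \<and> lind (map y vs)} = {[]}" by auto
  then show ?case by simp
next
  case (Suc k)
  let ?S = "\<lambda>k. {vs. set vs \<subseteq> W \<and> length vs = k \<and> lind (map y vs)}"
  let ?Z = "{w \<in> W. y w = 0}"
  let ?X = "\<lambda>ws. {v \<in> W. y v \<notin> fv.span (set (map y ws))}"
  have fin: "finite (?S k)"
    by (rule finite_subset[OF _ finite_lists_length_eq[OF W(2), of k]]) auto
  have X: "of_nat (card (?X ws)) = (of_nat (card W) - of_nat (card ?Z) * of_nat CARD('a) ^ k :: complex)"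
    if ws: "ws \<in> ?S k" for ws
  proof -
    let ?B = "{v \<in> W. y v \<in> fv.span (set (map y ws))}"
    have sW: "fv.span (set ws) \<subseteq> W"
      using ws W by (intro fv.span_minimal) auto
    have "bij_betw (\<lambda>(z, w). z + w) (?Z \<times> fv.span (set ws)) ?B"
    proof (rule bij_betwI')
      fix p p' assume p: "p \<in> ?Z \<times> fv.span (set ws)" "p' \<in> ?Z \<times> fv.span (set ws)"
      show "((case p of (z, w) \<Rightarrow> z + w) = (case p' of (z, w) \<Rightarrow> z + w)) = (p = p')"
      proof
        assume eq: "(case p of (z, w) \<Rightarrow> z + w) = (case p' of (z, w) \<Rightarrow> z + w)"
        obtain z w z' w' where pp: "p = (z, w)" "p' = (z', w')" by (cases p, cases p')
        have "w - w' = z' - z" using eq pp by (simp add: algebra_simps)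
        then have "y (w - w') = y (z' - z)" by simp
        also have "\<dots> = 0" using p pp by (auto simp: fv_linear_ops[OF y])
        finally have "y (w - w') = 0" .
        moreover have "w - w' \<in> fv.span (set ws)" using p pp by (intro fv.span_diff) auto
        moreover have "lind (map y ws)" using ws by simp
        ultimately have "w - w' = 0" by (metis lind_map_inj[OF y])
        then show "p = p'" using eq pp by simp
      qed auto
    next
      fix p assume "p \<in> ?Z \<times> fv.span (set ws)"
      then show "(case p of (z, w) \<Rightarrow> z + w) \<in> ?B"
        using sW fv.subspace_add[OF W(1)] by (auto simp: fv_linear_ops[OF y])
    next
      fix v assume v: "v \<in> ?B"
      then obtain w where w: "w \<in> fv.span (set ws)" "y v = y w"
        by (auto simp: fv_linear_ops(5)[OF y])
      then have "v - w \<in> ?Z" using v sW fv.subspace_diff[OF W(1)] by (auto simp: fv_linear_ops[OF y])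
      then show "\<exists>p\<in>?Z \<times> fv.span (set ws). v = (case p of (z, w) \<Rightarrow> z + w)"
        using w by (intro bexI[of _ "(v - w, w)"]) auto
    qed
    from bij_betw_same_card[OF this] have "card ?B = card ?Z * CARD('a) ^ k"
      using span_finite_card[OF lind_map_imp_lind[OF y], of ws] ws
      by (simp add: card_cartesian_product)
    moreover have "card W = card ?B + card (?X ws)"
      using W(2) by (subst card_Un_disjoint[symmetric]) (auto intro: arg_cong[of _ _ card])
    ultimately show ?thesis by (simp add: algebra_simps)
  qed
  have eq: "?S (Suc k) = (\<lambda>(ws, v). v # ws) ` (SIGMA ws:?S k. ?X ws)"
  proof (intro equalityI subsetI)
    fix vs assume "vs \<in> ?S (Suc k)"
    then show "vs \<in> (\<lambda>(ws, v). v # ws) ` (SIGMA ws:?S k. ?X ws)"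
      by (cases vs) (auto simp: image_iff)
  qed auto
  have "card (?S (Suc k)) = (\<Sum>ws\<in>?S k. card (?X ws))"
    unfolding eq using fin W(2)
    by (subst card_image) (auto simp: inj_on_def card_SigmaI)
  then have "of_nat (card (?S (Suc k))) = (\<Sum>ws\<in>?S k. of_nat (card (?X ws)) :: complex)" by simp
  also have "\<dots> = (\<Sum>ws\<in>?S k. of_nat (card W) - of_nat (card ?Z) * of_nat CARD('a) ^ k)"
    using X by (intro sum.cong) auto
  also have "\<dots> = of_nat (card (?S k)) * (of_nat (card W) - of_nat (card ?Z) * of_nat CARD('a) ^ k)"
    by simp
  finally show ?case by (simp only: Suc.IH prod.lessThan_Suc)
qed

section \<open>Matrices acting on vectors, and the orthogonal groups\<close>

lemma square_mult_carrier [simp]: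
  "A \<in> carrier_mat N N \<Longrightarrow> B \<in> carrier_mat N N \<Longrightarrow> A * B \<in> carrier_mat N N"
  by (rule mult_carrier_mat)

definition act :: "'a::field mat \<Rightarrow> (nat \<Rightarrow> 'a) \<Rightarrow> nat \<Rightarrow> 'a" where
  "act g v = (\<lambda>i. if i < dim_row g then \<Sum>j<dim_col g. g $$ (i, j) * v j else 0)"

definition dot :: "nat \<Rightarrow> (nat \<Rightarrow> 'a::field) \<Rightarrow> (nat \<Rightarrow> 'a) \<Rightarrow> 'a" where
  "dot k v w = (\<Sum>i<k. v i * w i)"

lemma act_add: "act g (v + w) = act g v + act g w"
  by (auto simp: act_def fun_eq_iff algebra_simps sum.distrib)

lemma act_fvs: "act g (fvs a v) = fvs a (act g v)"
  by (auto simp: act_def fvs_def fun_eq_iff sum_distrib_left ac_simps intro!: sum.cong)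

lemma act_linear: "fv_linear (act g)"
  by (rule fv_linearI) (simp_all add: act_add act_fvs)

lemmas act_ops = fv_linear_ops[OF act_linear]

lemma act_in_Vn: "g \<in> carrier_mat N M \<Longrightarrow> act g v \<in> Vn N"
  by (auto simp: act_def Vn_def)

lemma act_mult:
  assumes "g \<in> carrier_mat N M" "h \<in> carrier_mat M L"
  shows "act (g * h) v = act g (act h v)"
proof
  fix i
  show "act (g * h) v i = act g (act h v) i"
  proof (cases "i < N")
    case True
    have "act (g * h) v i = (\<Sum>j<L. \<Sum>k<M. g $$ (i, k) * h $$ (k, j) * v j)"
      using assms True by (simp add: act_def scalar_prod_def sum_distrib_right atLeast0LessThan)
    also have "\<dots> = (\<Sum>k<M. \<Sum>j<L. g $$ (i, k) * h $$ (k, j) * v j)" by (rule sum.swap)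
    also have "\<dots> = act g (act h v) i"
      using assms True by (simp add: act_def sum_distrib_left ac_simps)
    finally show ?thesis .
  qed (use assms in \<open>auto simp: act_def\<close>)
qed

lemma act_one: "v \<in> Vn N \<Longrightarrow> act (1\<^sub>m N) v = v"
  by (auto simp: act_def Vn_def fun_eq_iff if_distrib[of "\<lambda>x. x * _"] sum.delta cong: if_cong)

lemma act_mat_smult: "act (a \<cdot>\<^sub>m g) v = fvs a (act g v)"
  by (auto simp: act_def fvs_def fun_eq_iff sum_distrib_left ac_simps intro!: sum.cong)

lemma act_zero: "act (0\<^sub>m N M) v = 0"
  by (auto simp: act_def fun_eq_iff)

lemma dot_transpose:
  assumes "g \<in> carrier_mat N M"
  shows "dot N (act g v) w = dot M v (act (transpose_mat g) w)"
proof -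
  have "dot N (act g v) w = (\<Sum>i<N. \<Sum>j<M. g $$ (i, j) * v j * w i)"
    using assms by (simp add: dot_def act_def sum_distrib_right)
  also have "\<dots> = (\<Sum>j<M. \<Sum>i<N. g $$ (i, j) * v j * w i)" by (rule sum.swap)
  also have "\<dots> = dot M v (act (transpose_mat g) w)"
    using assms by (simp add: dot_def act_def sum_distrib_left ac_simps)
  finally show ?thesis .
qed

lemma dot_commute: "dot k v w = dot k w v"
  by (simp add: dot_def ac_simps)

lemma dot_fvs: "dot k v (fvs a w) = a * dot k v w" "dot k (fvs a w) v = a * dot k w v"
  by (simp_all add: dot_def fvs_def sum_distrib_left ac_simps)

lemma dot_minus: "dot k v (- w) = - dot k v w" "dot k (- w) v = - dot k w v"
  by (simp_all add: dot_def sum_negf)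

lemma dot_zero: "dot k v 0 = 0" "dot k 0 v = 0"
  by (simp_all add: dot_def)

lemma mat_eq_iff_act:
  assumes "g \<in> carrier_mat N M" "h \<in> carrier_mat N M" "\<And>v. v \<in> Vn M \<Longrightarrow> act g v = act h v"
  shows "g = h"
proof (rule eq_matI)
  fix i j assume ij: "i < dim_row h" "j < dim_col h"
  define v :: "nat \<Rightarrow> 'a" where "v = (\<lambda>k. if k = j then 1 else 0)"
  have "v \<in> Vn M" using ij assms by (auto simp: v_def Vn_def)
  then have "act g v i = act h v i" using assms by simp
  then show "g $$ (i, j) = h $$ (i, j)"
    using ij assms by (simp add: act_def v_def if_distrib[of "\<lambda>x. _ * x"] sum.delta cong: if_cong)
qed (use assms in auto)

definition lo :: "nat \<Rightarrow> (nat \<Rightarrow> 'a::field) \<Rightarrow> nat \<Rightarrow> 'a" where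
  "lo n v = (\<lambda>i. if i < n then v i else 0)"

definition hi :: "nat \<Rightarrow> (nat \<Rightarrow> 'a::field) \<Rightarrow> nat \<Rightarrow> 'a" where
  "hi n v = (\<lambda>i. if i < n then v (n + i) else 0)"

lemma lo_hi_add: "lo n (v + w) = lo n v + lo n w" "hi n (v + w) = hi n v + hi n w"
  and lo_hi_fvs: "lo n (fvs a v) = fvs a (lo n v)" "hi n (fvs a v) = fvs a (hi n v)"
  and lo_hi_in_Vn: "lo n v \<in> Vn n" "hi n v \<in> Vn n"
  by (auto simp: lo_def hi_def fvs_def fun_eq_iff Vn_def)

lemma lo_hi_eqI:
  assumes "v \<in> Vn (2 * n)" "w \<in> Vn (2 * n)" "lo n v = lo n w" "hi n v = hi n w"
  shows "v = w"
proof
  fix i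
  consider "i < n" | "n \<le> i" "i < 2 * n" | "2 * n \<le> i" by linarith
  then show "v i = w i"
  proof cases
    case 1 then show ?thesis using fun_cong[OF assms(3), of i] by (simp add: lo_def)
  next
    case 2 then show ?thesis using fun_cong[OF assms(4), of "i - n"] by (simp add: hi_def split: if_splits)
  qed (use assms in \<open>auto simp: Vn_def\<close>)
qed

lemma sum_lessThan_double: "(\<Sum>i<2 * n. f i) = (\<Sum>i<n. f i) + (\<Sum>i<n. f (n + i :: nat))"
  for f :: "nat \<Rightarrow> 'a::comm_monoid_add"
proof -
  have "(\<Sum>i<2 * n. f i) = (\<Sum>i<n. f i) + (\<Sum>i=n..<n + n. f i)"
    by (simp add: lessThan_atLeast0 sum.atLeastLessThan_concat mult_2)
  also have "(\<Sum>i=n..<n + n. f i) = (\<Sum>i<n. f (n + i))"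
    using sum.shift_bounds_nat_ivl[of f 0 n n] by (simp add: lessThan_atLeast0 add.commute)
  finally show ?thesis .
qed

lemma act_four_block:
  assumes "A \<in> carrier_mat n n" "B \<in> carrier_mat n n" "C \<in> carrier_mat n n" "D \<in> carrier_mat n n"
  shows "lo n (act (four_block_mat A B C D) v) = act A (lo n v) + act B (hi n v)"
    and "hi n (act (four_block_mat A B C D) v) = act C (lo n v) + act D (hi n v)"
  using assms
  by (auto simp: fun_eq_iff lo_def hi_def act_def mult_2[symmetric] sum_lessThan_double)

abbreviation blocks :: "nat \<Rightarrow> 'a mat \<Rightarrow> 'a mat \<Rightarrow> 'a mat \<Rightarrow> 'a mat \<Rightarrow> bool" where
  "blocks n A B C D \<equiv> A \<in> carrier_mat n n \<and> B \<in> carrier_mat n n \<and> C \<in> carrier_mat n n \<and> D \<in> carrier_mat n n"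

lemma four_block_carrier: "blocks n A B C D \<Longrightarrow> four_block_mat A B C D \<in> carrier_mat (2 * n) (2 * n)"
  by (auto simp: mult_2)

lemma four_block_eqD:
  assumes "blocks n A B C D" "blocks n A' B' C' D'"
    and "four_block_mat A B C D = four_block_mat A' B' C' D'"
  shows "A = A'" "B = B'" "C = C'" "D = D'"
proof -
  have e: "four_block_mat A B C D $$ (i, j) = four_block_mat A' B' C' D' $$ (i, j)" for i j
    using assms(3) by simp
  show "A = A'" by (rule eq_matI, use assms(1,2) e in \<open>auto simp: index_mat_four_block\<close>)
      (metis (no_types, lifting) assms(1,2) carrier_matD e index_mat_four_block(1) trans_less_add1)
  show "B = B'"
  proof (rule eq_matI)
    fix i j assume "i < dim_row B'" "j < dim_col B'"
    then show "B $$ (i, j) = B' $$ (i, j)" using e[of i "n + j"] assms(1,2) by auto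
  qed (use assms(1,2) in auto)
  show "C = C'"
  proof (rule eq_matI)
    fix i j assume "i < dim_row C'" "j < dim_col C'"
    then show "C $$ (i, j) = C' $$ (i, j)" using e[of "n + i" j] assms(1,2) by auto
  qed (use assms(1,2) in auto)
  show "D = D'"
  proof (rule eq_matI)
    fix i j assume "i < dim_row D'" "j < dim_col D'"
    then show "D $$ (i, j) = D' $$ (i, j)" using e[of "n + i" "n + j"] assms(1,2) by auto
  qed (use assms(1,2) in auto)
qed

lemma four_block_exists:
  assumes "g \<in> carrier_mat (2 * n) (2 * n)"
  obtains A B C D where "blocks n A B C D" "g = four_block_mat A B C D"
proof -
  obtain A B C D where s: "split_block g n n = (A, B, C, D)" by (cases "split_block g n n") auto
  show ?thesis
    using split_block[OF s, of n n] assms by (intro that[of A B C D]) auto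
qed

lemma split_block_four_block:
  assumes "blocks n A B C D"
  shows "split_block (four_block_mat A B C D) n n = (A, B, C, D)"
proof -
  let ?g = "four_block_mat A B C D"
  obtain A' B' C' D' where s: "split_block ?g n n = (A', B', C', D')"
    by (cases "split_block ?g n n") auto
  have "blocks n A' B' C' D'" "?g = four_block_mat A' B' C' D'"
    using split_block[OF s, of n n] assms by auto
  then show ?thesis using four_block_eqD[OF assms, where A' = A' and B' = B' and C' = C' and D' = D'] s by auto
qed

lemma mult_blocks:
  assumes "blocks n A B C D" "blocks n A' B' C' D'"
  shows "four_block_mat A B C D * four_block_mat A' B' C' D' =
    four_block_mat (A * A' + B * C') (A * B' + B * D') (C * A' + D * C') (C * B' + D * D')"
  using assms by (intro mult_four_block_mat) auto

lemma transpose_blocks: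
  assumes "blocks n A B C D"
  shows "transpose_mat (four_block_mat A B C D) =
    four_block_mat (transpose_mat A) (transpose_mat C) (transpose_mat B) (transpose_mat D)"
  using assms by (intro transpose_four_block_mat) auto

lemma Jmat_carrier [simp]: "Jmat n \<in> carrier_mat (2 * n) (2 * n)"
  by (auto simp: Jmat_def mult_2)

lemma Jmat_transpose [simp]: "transpose_mat (Jmat n) = Jmat n"
  unfolding Jmat_def by (subst transpose_blocks[where n = n]) auto

lemma Jmat_sq: "Jmat n * Jmat n = (1\<^sub>m (2 * n) :: 'a::field mat)"
  using Jmat_involution[of n] by (simp add: mult_2)

lemma Jmat_mult_blocks:
  assumes "blocks n A B C D"
  shows "Jmat n * four_block_mat A B C D = four_block_mat C D A B"
    and "four_block_mat A B C D * Jmat n = four_block_mat B A D C"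
proof -
  show "Jmat n * four_block_mat A B C D = four_block_mat C D A B"
    unfolding Jmat_def by (subst mult_blocks[where n = n]) (use assms in auto)
  show "four_block_mat A B C D * Jmat n = four_block_mat B A D C"
    unfolding Jmat_def by (subst mult_blocks[where n = n]) (use assms in auto)
qed

lemma smult_Jmat: "l \<cdot>\<^sub>m Jmat n = four_block_mat (0\<^sub>m n n) (l \<cdot>\<^sub>m 1\<^sub>m n) (l \<cdot>\<^sub>m 1\<^sub>m n) (0\<^sub>m n n)"
  unfolding Jmat_def by (rule eq_matI) auto

lemma act_Jmat: "lo n (act (Jmat n) v) = hi n v" "hi n (act (Jmat n) v) = lo n v"
  unfolding Jmat_def
  by (simp_all add: act_four_block act_zero act_one lo_hi_in_Vn)

lemma gram_blocks:
  assumes "blocks n A B C D"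
  shows "transpose_mat (four_block_mat A B C D) * Jmat n * four_block_mat A B C D =
    four_block_mat (transpose_mat A * C + transpose_mat C * A) (transpose_mat A * D + transpose_mat C * B)
      (transpose_mat B * C + transpose_mat D * A) (transpose_mat B * D + transpose_mat D * B)"
proof -
  let ?g = "four_block_mat A B C D"
  have "transpose_mat ?g * Jmat n * ?g = transpose_mat ?g * (Jmat n * ?g)"
    using four_block_carrier[OF assms] by (intro assoc_mult_mat) auto
  also have "\<dots> = transpose_mat ?g * four_block_mat C D A B"
    using Jmat_mult_blocks[OF assms] by simp
  also have "\<dots> = four_block_mat (transpose_mat A * C + transpose_mat C * A)
      (transpose_mat A * D + transpose_mat C * B)
      (transpose_mat B * C + transpose_mat D * A) (transpose_mat B * D + transpose_mat D * B)"
    unfolding transpose_blocks[OF assms] by (subst mult_blocks[where n = n]) (use assms in auto)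
  finally show ?thesis .
qed

definition bform :: "nat \<Rightarrow> (nat \<Rightarrow> 'a::field) \<Rightarrow> (nat \<Rightarrow> 'a) \<Rightarrow> 'a" where
  "bform n v w = dot n (lo n v) (hi n w) + dot n (hi n v) (lo n w)"

lemma bform_dot: "bform n v w = dot (2 * n) v (act (Jmat n) w)"
proof -
  have "dot (2 * n) v (act (Jmat n) w)
      = (\<Sum>i<n. v i * lo n (act (Jmat n) w) i) + (\<Sum>i<n. v (n + i) * hi n (act (Jmat n) w) i)"
    unfolding dot_def sum_lessThan_double
    by (intro arg_cong2[where f = "(+)"] sum.cong) (auto simp: lo_def hi_def)
  also have "\<dots> = bform n v w"
    unfolding act_Jmat bform_def dot_def
    by (intro arg_cong2[where f = "(+)"] sum.cong) (auto simp: lo_def hi_def)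
  finally show ?thesis ..
qed

lemma bform_act:
  assumes g: "g \<in> carrier_mat (2 * n) (2 * n)" and l: "transpose_mat g * Jmat n * g = l \<cdot>\<^sub>m Jmat n"
  shows "bform n (act g v) (act g w) = l * bform n v w"
proof -
  have "bform n (act g v) (act g w) = dot (2 * n) v (act (transpose_mat g) (act (Jmat n) (act g w)))"
    unfolding bform_dot by (rule dot_transpose[OF g])
  also have "act (transpose_mat g) (act (Jmat n) (act g w)) = act (transpose_mat g * Jmat n * g) w"
    using g by (simp add: act_mult[of _ "2 * n" "2 * n" _ "2 * n"])
  finally show ?thesis by (simp add: l act_mat_smult dot_fvs bform_dot)
qed

lemma smult_smult_times: "a \<cdot>\<^sub>m (b \<cdot>\<^sub>m A) = (a * b :: 'a::field) \<cdot>\<^sub>m A"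
  by (rule eq_matI) (auto simp: mult.assoc)

lemma smult_one: "(1 :: 'a::field) \<cdot>\<^sub>m A = A"
  by (rule eq_matI) auto

locale siegel =
  fixes n :: nat and M :: "'a::{finite,field} set"
  assumes n_pos: "n \<ge> 1" and q_odd: "odd CARD('a)"
    and M: "M = UNIV - {0} \<or> M = {1}"
begin

text \<open>Both groups at once: \<open>M\<close> is the group of admissible similitude factors.\<close>
definition G :: "'a mat set" where
  "G = {g \<in> carrier_mat (2 * n) (2 * n). \<exists>l\<in>M. transpose_mat g * Jmat n * g = l \<cdot>\<^sub>m Jmat n}"

definition sim :: "'a mat \<Rightarrow> 'a" where
  "sim g = (THE l. transpose_mat g * Jmat n * g = l \<cdot>\<^sub>m Jmat n)"

lemma M_props: "1 \<in> M" "l \<in> M \<Longrightarrow> l \<noteq> 0" "l \<in> M \<Longrightarrow> inverse l \<in> M" "l \<in> M \<Longrightarrow> k \<in> M \<Longrightarrow> l * k \<in> M"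
  using M by auto

lemma G_carrier: "g \<in> G \<Longrightarrow> g \<in> carrier_mat (2 * n) (2 * n)"
  by (simp add: G_def)

lemma finite_G: "finite G"
proof -
  have "G \<subseteq> (\<lambda>f. mat (2 * n) (2 * n) f) ` ({..<2 * n} \<times> {..<2 * n} \<rightarrow>\<^sub>E UNIV)"
  proof
    fix g assume "g \<in> G"
    then have c: "g \<in> carrier_mat (2 * n) (2 * n)" by (rule G_carrier)
    have "g = mat (2 * n) (2 * n) (restrict (\<lambda>ij. g $$ ij) ({..<2 * n} \<times> {..<2 * n}))"
      by (rule eq_matI) (use c in \<open>simp_all add: restrict_def\<close>)
    then show "g \<in> (\<lambda>f. mat (2 * n) (2 * n) f) ` ({..<2 * n} \<times> {..<2 * n} \<rightarrow>\<^sub>E UNIV)"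
      by (rule image_eqI[where f = "mat (2 * n) (2 * n)"]) simp
  qed
  then show ?thesis by (rule finite_subset) (intro finite_imageI finite_PiE, simp_all)
qed

lemma sim_unique: "l \<cdot>\<^sub>m Jmat n = k \<cdot>\<^sub>m Jmat n \<Longrightarrow> l = (k :: 'a)"
  unfolding smult_Jmat using n_pos four_block_eqD(2)[where n = n and A = "0\<^sub>m n n" and B = "l \<cdot>\<^sub>m 1\<^sub>m n" and C = "l \<cdot>\<^sub>m 1\<^sub>m n"
      and D = "0\<^sub>m n n" and A' = "0\<^sub>m n n" and B' = "k \<cdot>\<^sub>m 1\<^sub>m n" and C' = "k \<cdot>\<^sub>m 1\<^sub>m n" and D' = "0\<^sub>m n n"]
  by (auto dest!: arg_cong[where f = "\<lambda>m. m $$ (0, 0)"])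

lemma sim_eqI: "transpose_mat g * Jmat n * g = l \<cdot>\<^sub>m Jmat n \<Longrightarrow> sim g = l"
  unfolding sim_def using sim_unique by auto

lemma gram_G:
  assumes "g \<in> G"
  shows "transpose_mat g * Jmat n * g = sim g \<cdot>\<^sub>m Jmat n" "sim g \<in> M" "sim g \<noteq> 0"
  using assms sim_eqI M_props(2) unfolding G_def by auto

lemma G_I: "g \<in> carrier_mat (2 * n) (2 * n) \<Longrightarrow> l \<in> M \<Longrightarrow> transpose_mat g * Jmat n * g = l \<cdot>\<^sub>m Jmat n \<Longrightarrow> g \<in> G"
  unfolding G_def by blast

lemma one_G: "1\<^sub>m (2 * n) \<in> G"
  by (rule G_I[OF _ M_props(1)]) (auto simp: left_mult_one_mat[of _ "2 * n" "2 * n"] right_mult_one_mat[of _ "2 * n" "2 * n"])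

lemma mult_gram:
  assumes "g \<in> G" "h \<in> G"
  shows "transpose_mat (g * h) * Jmat n * (g * h) = (sim g * sim h) \<cdot>\<^sub>m Jmat n"
proof -
  note c = G_carrier[OF assms(1)] G_carrier[OF assms(2)]
  have "transpose_mat (g * h) * Jmat n * (g * h)
      = transpose_mat h * (transpose_mat g * Jmat n * g) * h"
    using c by (simp add: transpose_mult[of _ "2 * n" "2 * n" _ "2 * n"]
        assoc_mult_mat[of _ "2 * n" "2 * n" _ "2 * n" _ "2 * n"])
  also have "\<dots> = sim g \<cdot>\<^sub>m (transpose_mat h * Jmat n * h)"
    using c by (simp add: gram_G[OF assms(1)] mult_smult_distrib[of _ "2 * n" "2 * n" _ "2 * n"]
        mult_smult_assoc_mat[of _ "2 * n" "2 * n" _ "2 * n"])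
  finally show ?thesis by (simp add: gram_G[OF assms(2)] smult_smult_times smult_one)
qed

lemma mult_G: "g \<in> G \<Longrightarrow> h \<in> G \<Longrightarrow> g * h \<in> G"
  by (rule G_I[OF _ M_props(4) mult_gram]) (simp_all add: gram_G G_carrier)

lemma sim_mult: "g \<in> G \<Longrightarrow> h \<in> G \<Longrightarrow> sim (g * h) = sim g * sim h"
  by (rule sim_eqI) (rule mult_gram)

text \<open>The inverse, read off from the equation \<open>transpose_mat g * Jmat n * g = l \<cdot>\<^sub>m Jmat n\<close>.\<close>
definition ginv :: "'a mat \<Rightarrow> 'a mat" where
  "ginv g = inverse (sim g) \<cdot>\<^sub>m (Jmat n * transpose_mat g * Jmat n)"

lemma ginv_carrier: "g \<in> G \<Longrightarrow> ginv g \<in> carrier_mat (2 * n) (2 * n)"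
  by (auto simp: ginv_def dest!: G_carrier)

lemma ginv_left: "g \<in> G \<Longrightarrow> ginv g * g = 1\<^sub>m (2 * n)"
proof -
  assume g: "g \<in> G"
  note c = G_carrier[OF g]
  have "ginv g * g = inverse (sim g) \<cdot>\<^sub>m (Jmat n * (transpose_mat g * Jmat n * g))"
    using c by (simp add: ginv_def mult_smult_assoc_mat[of _ "2 * n" "2 * n" _ "2 * n"]
        assoc_mult_mat[of _ "2 * n" "2 * n" _ "2 * n" _ "2 * n"])
  also have "\<dots> = 1\<^sub>m (2 * n)"
    using gram_G[OF g]
    by (simp add: mult_smult_distrib[of _ "2 * n" "2 * n" _ "2 * n"] Jmat_sq smult_smult_times smult_one)
  finally show ?thesis .
qed

lemma ginv_right: "g \<in> G \<Longrightarrow> g * ginv g = 1\<^sub>m (2 * n)"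
  using mat_mult_left_right_inverse[OF ginv_carrier G_carrier ginv_left] by blast

lemma ginv_G: assumes g: "g \<in> G" shows "ginv g \<in> G"
proof -
  note c = G_carrier[OF g] ginv_carrier[OF g]
  have t: "transpose_mat (ginv g) * transpose_mat g = 1\<^sub>m (2 * n)"
    using c by (simp add: transpose_mult[of _ "2 * n" "2 * n" _ "2 * n", symmetric] ginv_right[OF g])
  have "sim g \<cdot>\<^sub>m (transpose_mat (ginv g) * Jmat n * ginv g)
      = transpose_mat (ginv g) * (transpose_mat g * Jmat n * g) * ginv g"
    using c by (simp add: gram_G[OF g] mult_smult_distrib[of _ "2 * n" "2 * n" _ "2 * n"]
        mult_smult_assoc_mat[of _ "2 * n" "2 * n" _ "2 * n"])
  also have "\<dots> = (transpose_mat (ginv g) * transpose_mat g) * Jmat n * (g * ginv g)"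
    using c by (simp add: assoc_mult_mat[of _ "2 * n" "2 * n" _ "2 * n" _ "2 * n"])
  also have "\<dots> = Jmat n"
    by (simp add: t ginv_right[OF g] left_mult_one_mat[of _ "2 * n" "2 * n"] right_mult_one_mat[of _ "2 * n" "2 * n"])
  finally have "inverse (sim g) \<cdot>\<^sub>m (sim g \<cdot>\<^sub>m (transpose_mat (ginv g) * Jmat n * ginv g)) = inverse (sim g) \<cdot>\<^sub>m Jmat n"
    by simp
  then have "transpose_mat (ginv g) * Jmat n * ginv g = inverse (sim g) \<cdot>\<^sub>m Jmat n"
    using gram_G[OF g] by (simp add: smult_smult_times smult_one)
  then show ?thesis by (rule G_I[OF c(2) M_props(3)[OF gram_G(2)[OF g]]])
qed

lemma ginv_cancel:
  assumes "g \<in> G" "h \<in> carrier_mat (2 * n) (2 * n)"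
  shows "ginv g * (g * h) = h" "g * (ginv g * h) = h" "h * g * ginv g = h" "h * ginv g * g = h"
proof -
  note c = G_carrier[OF assms(1)] ginv_carrier[OF assms(1)] assms(2)
  show "ginv g * (g * h) = h"
    using c ginv_left[OF assms(1)] by (simp add: assoc_mult_mat[of _ "2 * n" "2 * n" _ "2 * n" _ "2 * n", symmetric])
  show "g * (ginv g * h) = h"
    using c ginv_right[OF assms(1)] by (simp add: assoc_mult_mat[of _ "2 * n" "2 * n" _ "2 * n" _ "2 * n", symmetric])
  show "h * g * ginv g = h"
    using c ginv_right[OF assms(1)] by (simp add: assoc_mult_mat[of _ "2 * n" "2 * n" _ "2 * n" _ "2 * n"])
  show "h * ginv g * g = h"
    using c ginv_left[OF assms(1)] by (simp add: assoc_mult_mat[of _ "2 * n" "2 * n" _ "2 * n" _ "2 * n"])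
qed

lemma mult_assoc: "g \<in> carrier_mat (2 * n) (2 * n) \<Longrightarrow> h \<in> carrier_mat (2 * n) (2 * n) \<Longrightarrow>
    k \<in> carrier_mat (2 * n) (2 * n) \<Longrightarrow> g * h * k = g * (h * k)"
  by (rule assoc_mult_mat)

lemma bij_left_mult: "h \<in> G \<Longrightarrow> bij_betw (\<lambda>g. h * g) G G"
  by (rule bij_betw_byWitness[where f' = "\<lambda>g. ginv h * g"])
     (auto simp: ginv_cancel mult_G ginv_G dest: G_carrier)

lemma block_G:
  assumes "blocks n A B C D" "l \<in> M"
    and "transpose_mat A * C + transpose_mat C * A = 0\<^sub>m n n"
    and "transpose_mat A * D + transpose_mat C * B = l \<cdot>\<^sub>m 1\<^sub>m n"
    and "transpose_mat B * D + transpose_mat D * B = 0\<^sub>m n n"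
  shows "four_block_mat A B C D \<in> G"
proof (rule G_I[OF four_block_carrier[OF assms(1)] assms(2)])
  have "transpose_mat B * C + transpose_mat D * A
      = transpose_mat (transpose_mat A * D + transpose_mat C * B)"
    using assms(1) by (simp add: transpose_add[of _ n n] transpose_mult[of _ n n _ n] comm_add_mat[of _ n n])
  also have "\<dots> = l \<cdot>\<^sub>m 1\<^sub>m n"
    unfolding assms(4) by (rule eq_matI) auto
  finally show "transpose_mat (four_block_mat A B C D) * Jmat n * four_block_mat A B C D = l \<cdot>\<^sub>m Jmat n"
    unfolding gram_blocks[OF assms(1)] smult_Jmat using assms by simp
qed

lemma G_blocks:
  assumes "four_block_mat A B C D \<in> G" "blocks n A B C D"
  shows "transpose_mat A * C + transpose_mat C * A = 0\<^sub>m n n"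
    and "transpose_mat A * D + transpose_mat C * B = sim (four_block_mat A B C D) \<cdot>\<^sub>m 1\<^sub>m n"
    and "transpose_mat B * D + transpose_mat D * B = 0\<^sub>m n n"
proof -
  let ?l = "sim (four_block_mat A B C D)"
  have e: "four_block_mat (transpose_mat A * C + transpose_mat C * A) (transpose_mat A * D + transpose_mat C * B)
      (transpose_mat B * C + transpose_mat D * A) (transpose_mat B * D + transpose_mat D * B)
    = four_block_mat (0\<^sub>m n n) (?l \<cdot>\<^sub>m 1\<^sub>m n) (?l \<cdot>\<^sub>m 1\<^sub>m n) (0\<^sub>m n n)"
    using gram_G(1)[OF assms(1)] unfolding gram_blocks[OF assms(2)] smult_Jmat .
  note d = four_block_eqD[OF _ _ e, where n = n]
  show "transpose_mat A * C + transpose_mat C * A = 0\<^sub>m n n"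
    "transpose_mat A * D + transpose_mat C * B = ?l \<cdot>\<^sub>m 1\<^sub>m n"
    "transpose_mat B * D + transpose_mat D * B = 0\<^sub>m n n"
    using d assms(2) by auto
qed

lemma Jmat_G: "Jmat n \<in> G"
  unfolding Jmat_def by (rule block_G[OF _ M_props(1)]) auto

definition skews :: "'a mat set" where
  "skews = {B \<in> carrier_mat n n. transpose_mat B = - B}"

definition unip :: "'a mat \<Rightarrow> 'a mat" where
  "unip B = four_block_mat (1\<^sub>m n) B (0\<^sub>m n n) (1\<^sub>m n)"

lemma skews_carrier: "B \<in> skews \<Longrightarrow> B \<in> carrier_mat n n"
  by (simp add: skews_def)

lemma skew_iff: "B \<in> carrier_mat n n \<Longrightarrow> transpose_mat B + B = 0\<^sub>m n n \<longleftrightarrow> B \<in> skews"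
proof
  assume B: "B \<in> carrier_mat n n" and "transpose_mat B + B = 0\<^sub>m n n"
  then have "(transpose_mat B + B) $$ (i, j) = 0" if "i < n" "j < n" for i j using that by simp
  then show "B \<in> skews" using B unfolding skews_def
    by (auto intro!: eq_matI simp: eq_neg_iff_add_eq_0)
next
  assume "B \<in> carrier_mat n n" "B \<in> skews"
  then show "transpose_mat B + B = 0\<^sub>m n n" by (auto simp: skews_def)
qed

lemma unip_G: "B \<in> skews \<Longrightarrow> unip B \<in> G"
proof -
  assume B: "B \<in> skews"
  then have c: "B \<in> carrier_mat n n" by (rule skews_carrier)
  show ?thesis
    unfolding unip_def
    by (rule block_G[OF _ M_props(1)]) (use c skew_iff[OF c] B in \<open>simp_all add: smult_one\<close>)
qed

lemma unip_rad_eq: "unip_rad G n = unip ` skews"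
proof (intro equalityI subsetI)
  fix g assume "g \<in> unip_rad G n"
  then obtain B where B: "B \<in> carrier_mat n n" "g = unip B" "g \<in> G"
    unfolding unip_rad_def unip_def by auto
  then have "B \<in> skews"
    using G_blocks(3)[of "1\<^sub>m n" B "0\<^sub>m n n" "1\<^sub>m n"] by (simp add: unip_def skew_iff)
  then show "g \<in> unip ` skews" using B by simp
next
  fix g assume "g \<in> unip ` skews"
  then show "g \<in> unip_rad G n" using unip_G skews_carrier unfolding unip_rad_def unip_def by auto
qed

lemma inj_unip: "inj_on unip skews"
  unfolding unip_def
  by (rule inj_onI) (rule four_block_eqD(2)[where n = n], auto simp: skews_carrier)

lemma finite_skews: "finite skews"
  using finite_imageD[OF _ inj_unip] finite_subset[OF _ finite_G, of "unip ` skews"] unip_G by auto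

lemma sim_block_upper:
  assumes "four_block_mat A B (0\<^sub>m n n) D \<in> G" "A \<in> carrier_mat n n" "B \<in> carrier_mat n n" "D \<in> carrier_mat n n"
  shows "transpose_mat A * D = sim (four_block_mat A B (0\<^sub>m n n) D) \<cdot>\<^sub>m 1\<^sub>m n"
  using G_blocks(2)[OF assms(1)] assms by simp

abbreviation P :: "'a mat set" where "P \<equiv> Siegel G n"

text \<open>The Siegel parabolic subgroup is the stabilizer of the standard maximal isotropic subspace \<open>Vn n\<close>.
  Hence a coset \<open>P g\<close> is the same as the maximal isotropic subspace of the \<open>v\<close> with \<open>g v\<close> in \<open>Vn n\<close>.\<close>
lemma P_iff:
  assumes "g \<in> G"
  shows "g \<in> P \<longleftrightarrow> (\<forall>v\<in>Vn n. hi n (act g v) = 0)"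
proof -
  obtain A B C D where b: "blocks n A B C D" "g = four_block_mat A B C D"
    using four_block_exists[OF G_carrier[OF assms]] .
  have l: "lo n v = v" "hi n v = 0" if "v \<in> Vn n" for v :: "nat \<Rightarrow> 'a"
    using that by (auto simp: lo_def hi_def Vn_def fun_eq_iff)
  have "(\<forall>v\<in>Vn n. hi n (act g v) = 0) \<longleftrightarrow> (\<forall>v\<in>Vn n. act C v = 0)"
    using b l by (simp add: act_four_block act_ops)
  also have "\<dots> \<longleftrightarrow> C = 0\<^sub>m n n"
    using b mat_eq_iff_act[of C n n "0\<^sub>m n n"] by (auto simp: act_zero)
  also have "\<dots> \<longleftrightarrow> g \<in> P"
  proof
    assume "C = 0\<^sub>m n n" then show "g \<in> P" using b assms unfolding Siegel_def by blast
  next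
    assume "g \<in> P"
    then obtain A' B' D' where "A' \<in> carrier_mat n n" "B' \<in> carrier_mat n n" "D' \<in> carrier_mat n n"
      "g = four_block_mat A' B' (0\<^sub>m n n) D'" unfolding Siegel_def by auto
    then show "C = 0\<^sub>m n n" using b four_block_eqD(3)[where n = n and A = A and B = B and C = C and D = D
        and A' = A' and B' = B' and C' = "0\<^sub>m n n" and D' = D'] by auto
  qed
  finally show ?thesis ..
qed

lemma P_G: "p \<in> P \<Longrightarrow> p \<in> G" by (simp add: Siegel_def)

lemma in_Vn_hi: "v \<in> Vn (2 * n) \<Longrightarrow> hi n v = 0 \<Longrightarrow> v \<in> Vn n"
proof -
  assume v: "v \<in> Vn (2 * n)" and h: "hi n v = 0"
  have "v i = 0" if "i \<ge> n" for i
  proof (cases "i < 2 * n")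
    case True
    have "hi n v (i - n) = v i" using True that by (simp add: hi_def)
    then show ?thesis using h by simp
  qed (use v in \<open>simp add: Vn_def\<close>)
  then show ?thesis by (simp add: Vn_def)
qed

lemma P_act_Vn: "p \<in> P \<Longrightarrow> v \<in> Vn n \<Longrightarrow> act p v \<in> Vn n"
  using P_iff[OF P_G] by (intro in_Vn_hi) (auto intro: act_in_Vn G_carrier P_G)

lemma act_ginv: "g \<in> G \<Longrightarrow> v \<in> Vn (2 * n) \<Longrightarrow> act (ginv g) (act g v) = v"
  "g \<in> G \<Longrightarrow> v \<in> Vn (2 * n) \<Longrightarrow> act g (act (ginv g) v) = v"
  by (simp_all add: act_mult[of _ "2 * n" "2 * n" _ "2 * n", symmetric] G_carrier ginv_carrier ginv_left ginv_right act_one)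

lemma act_P_Vn_eq: assumes "p \<in> P" shows "act p ` Vn n = Vn n" "inj_on (act p) (Vn n)"
proof -
  have s: "Vn n \<subseteq> (Vn (2 * n) :: (nat \<Rightarrow> 'a) set)" by (rule Vn_mono) simp
  show inj: "inj_on (act p) (Vn n)"
    using act_ginv(1)[OF P_G[OF assms]] s by (intro inj_on_inverseI[where g = "act (ginv p)"]) auto
  show "act p ` Vn n = Vn n"
    using P_act_Vn[OF assms] inj by (intro endo_inj_surj finite_Vn) auto
qed

lemma ginv_P: assumes "p \<in> P" shows "ginv p \<in> P"
proof -
  have "hi n (act (ginv p) v) = 0" if v: "v \<in> Vn n" for v
  proof -
    obtain w where w: "w \<in> Vn n" "v = act p w" using act_P_Vn_eq(1)[OF assms] v by auto
    then have "act (ginv p) v = w"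
      using act_ginv(1)[OF P_G[OF assms]] Vn_mono[of n "2 * n"] by auto
    then have "act (ginv p) v \<in> Vn n" using w by simp
    then show ?thesis by (auto simp: hi_def Vn_def fun_eq_iff)
  qed
  then show ?thesis using P_iff[OF ginv_G[OF P_G[OF assms]]] by auto
qed

lemma mult_P: "p \<in> P \<Longrightarrow> p' \<in> P \<Longrightarrow> p * p' \<in> P"
  using P_iff[of "p * p'"] P_act_Vn P_iff[of p]
  by (auto simp: act_mult[of _ "2 * n" "2 * n" _ "2 * n"] G_carrier P_G mult_G)

lemma unip_P: "B \<in> skews \<Longrightarrow> unip B \<in> P"
  using unip_G[of B] skews_carrier[of B] unfolding Siegel_def unip_def
  by (simp, intro exI[of _ "1\<^sub>m n"] exI[of _ B] conjI) auto

lemma hi_act_P: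
  assumes "p \<in> P" "g \<in> G"
  shows "hi n (act (p * g) v) = 0 \<longleftrightarrow> hi n (act g v) = 0"
proof -
  have c: "p \<in> carrier_mat (2 * n) (2 * n)" "g \<in> carrier_mat (2 * n) (2 * n)"
    using assms by (auto intro: G_carrier P_G)
  have 1: "hi n (act (p * g) v) = 0" if "hi n (act g v) = 0" "p \<in> P" "g \<in> G" for p g
  proof -
    have "act p (act g v) \<in> Vn n"
      by (rule P_act_Vn[OF that(2) in_Vn_hi[OF act_in_Vn[OF G_carrier[OF that(3)]] that(1)]])
    then have "hi n (act p (act g v)) = 0" by (simp add: hi_def Vn_def fun_eq_iff)
    then show ?thesis
      using that by (simp add: act_mult[of _ "2 * n" "2 * n" _ "2 * n"] G_carrier P_G)
  qed
  show ?thesis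
    using 1[OF _ assms] 1[OF _ ginv_P[OF assms(1)] mult_G[OF P_G[OF assms(1)] assms(2)]]
    by (auto simp: ginv_cancel P_G assms c)
qed

text \<open>This turns the sum over the unipotent radical into a count of matrices: the translated element
  carries \<open>v\<close> into the standard isotropic subspace exactly when \<open>B\<close> maps the lower half of \<open>g v\<close> to
  the negative of its upper half.\<close>
lemma hi_act_opposite:
  assumes "g \<in> G" "B \<in> skews"
  shows "hi n (act (Jmat n * unip B * g) v) = lo n (act g v) + act B (hi n (act g v))"
proof -
  have "act (Jmat n * unip B * g) v = act (Jmat n) (act (unip B) (act g v))"
    using assms by (simp add: act_mult[of _ "2 * n" "2 * n" _ "2 * n"] G_carrier unip_G)
  then show ?thesis
    using assms by (simp add: act_Jmat unip_def act_four_block skews_carrier act_one lo_hi_in_Vn)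
qed

end

lemma GO_eq: "n \<ge> 1 \<Longrightarrow> odd CARD('a) \<Longrightarrow> GO n = siegel.G n (UNIV - {0 :: 'a::{finite,field}})"
  and Orth_eq: "n \<ge> 1 \<Longrightarrow> odd CARD('a) \<Longrightarrow> Orth n = siegel.G n {1 :: 'a::{finite,field}}"
proof -
  assume n: "n \<ge> 1" "odd CARD('a)"
  have inv: "invertible_mat g" if "siegel n M" "g \<in> siegel.G n M" for g :: "'a mat" and M
    using siegel.ginv_left[OF that] siegel.ginv_right[OF that] siegel.ginv_carrier[OF that] siegel.G_carrier[OF that]
    unfolding invertible_mat_def inverts_mat_def by (auto intro!: exI[of _ "siegel.ginv n g"])
  show "GO n = siegel.G n (UNIV - {0 :: 'a})"
    using n inv[of "UNIV - {0}"] unfolding GO_def siegel.G_def[of n "UNIV - {0}", unfolded siegel_def, OF conjI[OF n(1) conjI[OF n(2)]], simplified]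
    by (auto simp: siegel_def)
  show "Orth n = siegel.G n {1 :: 'a}"
    using n inv[of "{1}"] unfolding Orth_def siegel.G_def[of n "{1}", unfolded siegel_def, OF conjI[OF n(1) conjI[OF n(2)]], simplified]
    by (auto simp: siegel_def)
qed

section \<open>Counting skew-symmetric matrices with prescribed columns\<close>

text \<open>Translation by \<open>1\<close> permutes the field, so it does not change the sum of all elements.\<close>
lemma of_nat_card_field: "of_nat CARD('a) = (0 :: 'a::{finite,field})"
proof -
  have "(\<Sum>x\<in>UNIV. x) = (\<Sum>x\<in>UNIV. x + 1 :: 'a)"
    by (rule sum.reindex_bij_witness[of _ "\<lambda>x. x + 1" "\<lambda>x. x - 1"]) auto
  also have "\<dots> = (\<Sum>x\<in>UNIV. x) + of_nat CARD('a)" by (simp add: sum.distrib)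
  finally show ?thesis by simp
qed

lemma two_neq_0: "odd CARD('a) \<Longrightarrow> (2 :: 'a::{finite,field}) \<noteq> 0"
proof
  assume "odd CARD('a)" and two: "(2 :: 'a) = 0"
  then obtain k where "CARD('a) = 2 * k + 1" by (auto elim: oddE)
  then have "(of_nat CARD('a) :: 'a) = 2 * of_nat k + 1" by simp
  then show False using two of_nat_card_field[where 'a = 'a] by simp
qed

lemma card_strict_pairs: "finite {(i, j). i < j \<and> j < m} \<and> card {(i, j). i < j \<and> j < m} = m choose 2" for m :: nat
proof (induction m)
  case (Suc m)
  have e: "{(i, j). i < j \<and> j < Suc m} = {(i, j). i < j \<and> j < m} \<union> (\<lambda>i. (i, m)) ` {..<m}"
    by (auto simp: less_Suc_eq)
  have "card ({(i, j). i < j \<and> j < m} \<union> (\<lambda>i. (i, m)) ` {..<m}) = (m choose 2) + m"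
    using Suc by (subst card_Un_disjoint) (auto simp: card_image inj_on_def)
  then show ?case using Suc unfolding e by (simp add: numeral_2_eq_2)
qed auto

lemma lind_combination_zero:
  assumes "lind vs" "(\<Sum>j<length vs. fvs (c j) (vs ! j)) = 0" "j < length vs"
  shows "c j = 0"
  using assms
proof (induction vs arbitrary: c j)
  case (Cons v vs)
  let ?s = "\<Sum>j<length vs. fvs (c (Suc j)) (vs ! j)"
  have s: "?s \<in> fv.span (set vs)" by (intro fv.span_sum fv.span_scale fv.span_base) auto
  have eq: "fvs (c 0) v + ?s = 0"
    using Cons.prems(2) by (simp only: length_Cons sum.lessThan_Suc_shift nth_Cons_0 nth_Cons_Suc)
  have "c 0 = 0"
  proof (rule ccontr)
    assume c0: "c 0 \<noteq> 0"
    have "fvs (- inverse (c 0)) ?s \<in> fv.span (set vs)" by (rule fv.span_scale[OF s])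
    moreover have "?s = - fvs (c 0) v" using eq by (metis add_eq_0_iff)
    then have "fvs (- inverse (c 0)) ?s = v" using c0 by (simp add: fvs_def fun_eq_iff)
    ultimately show False using Cons.prems(1) by simp
  qed
  moreover have "?s = 0" using eq \<open>c 0 = 0\<close> by simp
  then have "c (Suc i) = 0" if "i < length vs" for i
    using Cons.IH[of "\<lambda>i. c (Suc i)" i] Cons.prems(1) that by simp
  ultimately show ?case using Cons.prems(3) by (cases j) auto
qed simp

lemma act_mat_columns:
  assumes "length vs = N" "set vs \<subseteq> Vn N"
  shows "act (mat N N (\<lambda>(i, j). (vs ! j) i)) c = (\<Sum>j<N. fvs (c j) (vs ! j))"
proof
  fix i
  have "(vs ! j) i = 0" if "j < N" "i \<ge> N" for j
    using subsetD[OF assms(2) nth_mem[of j vs]] assms(1) that by (auto simp: Vn_def)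
  moreover have "(\<Sum>j<N. fvs (c j) (vs ! j)) i = (\<Sum>j<N. c j * (vs ! j) i)" for i
    by (induction N) (auto simp: fvs_def)
  ultimately show "act (mat N N (\<lambda>(i, j). (vs ! j) i)) c i = (\<Sum>j<N. fvs (c j) (vs ! j)) i"
    by (auto simp: act_def mult.commute)
qed

text \<open>A relation between the columns is a vector in the kernel of the matrix.\<close>
lemma lind_columns_invertible:
  fixes hs :: "(nat \<Rightarrow> 'a::field) list"
  assumes "lind hs" "length hs = N" "set hs \<subseteq> Vn N"
  obtains k where "k \<in> carrier_mat N N" "mat N N (\<lambda>(i, j). (hs ! j) i) * k = 1\<^sub>m N"
    "k * mat N N (\<lambda>(i, j). (hs ! j) i) = 1\<^sub>m N"
proof -
  let ?h = "mat N N (\<lambda>(i, j). (hs ! j) i)"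
  have h: "?h \<in> carrier_mat N N" by simp
  have "det ?h \<noteq> 0"
  proof
    assume "det ?h = 0"
    then obtain v where v: "v \<in> carrier_vec N" "v \<noteq> 0\<^sub>v N" "?h *\<^sub>v v = 0\<^sub>v N"
      using det_0_iff_vec_prod_zero_field[OF h] by auto
    have "act ?h (\<lambda>j. v $ j) = 0"
    proof
      fix i show "act ?h (\<lambda>j. v $ j) i = 0 i"
        using arg_cong[OF v(3), of "\<lambda>w. w $ i"] v(1)
        by (auto simp: act_def scalar_prod_def atLeast0LessThan)
    qed
    then have "v $ j = 0" if "j < N" for j
      using lind_combination_zero[OF assms(1), of "\<lambda>j. v $ j" j] that assms by (simp add: act_mat_columns)
    then have "v = 0\<^sub>v N" using v(1) by (intro eq_vecI) auto
    then show False using v(2) by simp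
  qed
  then show ?thesis
    using that det_non_zero_imp_unit[OF h] unfolding Units_def ring_mat_def by auto
qed

context siegel
begin

lemma card_skews_lower_columns:
  assumes m: "m \<le> n" and c: "\<And>i j. m \<le> i \<Longrightarrow> i < n \<Longrightarrow> m \<le> j \<Longrightarrow> j < n \<Longrightarrow> c i j = - c j i"
  shows "card {B \<in> skews. \<forall>i<n. \<forall>j. m \<le> j \<and> j < n \<longrightarrow> B $$ (i, j) = c i j} = CARD('a) ^ (m choose 2)"
proof -
  let ?S = "{B \<in> skews. \<forall>i<n. \<forall>j. m \<le> j \<and> j < n \<longrightarrow> B $$ (i, j) = c i j}"
  let ?I = "{(i, j). i < j \<and> j < m}"
  let ?\<Psi> = "\<lambda>F. mat n n (\<lambda>(i, j). if m \<le> j then c i j else if m \<le> i then - c j i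
      else if i < j then F (i, j) else if j < i then - F (j, i) else 0)"
  have sk: "B $$ (j, i) = - B $$ (i, j)" if "B \<in> skews" "i < n" "j < n" for B i j
  proof -
    have "transpose_mat B = - B" "B \<in> carrier_mat n n" using that(1) by (auto simp: skews_def)
    then show ?thesis using that by (metis carrier_matD index_transpose_mat(1) index_uminus_mat(1))
  qed
  have "bij_betw ?\<Psi> (?I \<rightarrow>\<^sub>E UNIV) ?S"
  proof (rule bij_betw_byWitness[where f' = "\<lambda>B. restrict (\<lambda>ij. B $$ ij) ?I"])
    show "\<forall>F\<in>?I \<rightarrow>\<^sub>E UNIV. restrict (\<lambda>ij. ?\<Psi> F $$ ij) ?I = F"
      using m by (auto simp: fun_eq_iff restrict_def PiE_def extensional_def)
    show "\<forall>B\<in>?S. ?\<Psi> (restrict (\<lambda>ij. B $$ ij) ?I) = B"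
    proof
      fix B assume B: "B \<in> ?S"
      have d: "B $$ (i, i) = 0" if "i < n" for i
      proof -
        have "2 * B $$ (i, i) = 0" using sk[of B i i] B that by simp
        then show ?thesis using two_neq_0[OF q_odd] by simp
      qed
      show "?\<Psi> (restrict (\<lambda>ij. B $$ ij) ?I) = B"
      proof (rule eq_matI)
        fix i j assume "i < dim_row B" "j < dim_col B"
        then have ij: "i < n" "j < n" using B by (auto dest: skews_carrier)
        then show "?\<Psi> (restrict (\<lambda>ij. B $$ ij) ?I) $$ (i, j) = B $$ (i, j)"
          using B sk[of B i j] sk[of B j i] d[of i] by (cases i j rule: linorder_cases) (auto simp: not_le)
      qed (use B in \<open>auto dest: skews_carrier\<close>)
    qed
    show "?\<Psi> ` (?I \<rightarrow>\<^sub>E UNIV) \<subseteq> ?S"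
    proof clarify
      fix F :: "nat \<times> nat \<Rightarrow> 'a"
      have "transpose_mat (?\<Psi> F) = - ?\<Psi> F"
      proof (rule eq_matI)
        fix i j assume "i < dim_row (- ?\<Psi> F)" "j < dim_col (- ?\<Psi> F)"
        then have ij: "i < n" "j < n" by auto
        then show "transpose_mat (?\<Psi> F) $$ (i, j) = (- ?\<Psi> F) $$ (i, j)"
          using c[of j i] by (cases "m \<le> i"; cases "m \<le> j") auto
      qed auto
      then show "?\<Psi> F \<in> skews \<and> (\<forall>i<n. \<forall>j. m \<le> j \<and> j < n \<longrightarrow> ?\<Psi> F $$ (i, j) = c i j)"
        by (simp add: skews_def)
    qed
    show "(\<lambda>B. restrict (\<lambda>ij. B $$ ij) ?I) ` ?S \<subseteq> ?I \<rightarrow>\<^sub>E UNIV"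
      by (auto split: if_splits)
  qed
  then have "card ?S = card (?I \<rightarrow>\<^sub>E (UNIV :: 'a set))" by (rule bij_betw_same_card[symmetric])
  also have "\<dots> = CARD('a) ^ (m choose 2)"
    using card_strict_pairs[of m] by (simp add: card_PiE)
  finally show ?thesis .
qed

text \<open>Completing the vectors to a basis and passing to the Gram matrix of \<open>B\<close> in that basis turns the
  conditions into prescribed values for the last columns; the entries above the diagonal
  of the remaining block are then free.\<close>
lemma card_skews_prescribed:
  assumes ys: "lind ys" "set ys \<subseteq> Vn n" and zs: "length zs = length ys" "set zs \<subseteq> Vn n"
    and compat: "\<And>i j. i < length ys \<Longrightarrow> j < length ys \<Longrightarrow>
      dot n (ys ! i) (zs ! j) = - dot n (ys ! j) (zs ! i)"
  shows "card {B \<in> skews. \<forall>i<length ys. act B (ys ! i) = zs ! i} = CARD('a) ^ ((n - length ys) choose 2)"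
proof -
  obtain us where us: "lind (us @ ys)" "set us \<subseteq> Vn n" "length (us @ ys) = n"
    using lind_extend[OF ys] by blast
  define hs where "hs = us @ ys"
  define m where "m = length us"
  have hs: "lind hs" "length hs = n" "set hs \<subseteq> Vn n" using us ys by (auto simp: hs_def)
  have m: "m \<le> n" "n - length ys = m" using us by (auto simp: m_def)
  let ?h = "mat n n (\<lambda>(i, j). (hs ! j) i)"
  obtain k where k: "k \<in> carrier_mat n n" "?h * k = 1\<^sub>m n" "k * ?h = 1\<^sub>m n"
    using lind_columns_invertible[OF hs] .
  have h: "?h \<in> carrier_mat n n" by simp
  have kt: "transpose_mat k * transpose_mat ?h = 1\<^sub>m n" "transpose_mat ?h * transpose_mat k = 1\<^sub>m n"
    using k h by (simp_all add: transpose_mult[OF h k(1), symmetric] transpose_mult[OF k(1) h, symmetric])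
  have hs_nth: "hs ! (m + i) = ys ! i" for i by (simp add: hs_def m_def)
  define c where "c = (\<lambda>i j. dot n (hs ! i) (zs ! (j - m)))"
  have gram: "(transpose_mat ?h * B * ?h) $$ (i, j) = dot n (hs ! i) (act B (hs ! j))"
    if B: "B \<in> carrier_mat n n" and ij: "i < n" "j < n" for B i j
  proof -
    have "(transpose_mat ?h * B * ?h) $$ (i, j) = (transpose_mat ?h * (B * ?h)) $$ (i, j)"
      using assoc_mult_mat[of "transpose_mat ?h" n n B n ?h n] B by simp
    also have "\<dots> = (\<Sum>a<n. (hs ! i) a * (B * ?h) $$ (a, j))"
      using B ij by (simp add: scalar_prod_def atLeast0LessThan)
    also have "\<dots> = dot n (hs ! i) (act B (hs ! j))"
      unfolding dot_def using B ij
      by (intro sum.cong) (auto simp: scalar_prod_def atLeast0LessThan act_def)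
    finally show ?thesis .
  qed
  have skew_conj: "transpose_mat X * B * X \<in> skews" if "B \<in> skews" "X \<in> carrier_mat n n" for B X
  proof -
    have B: "B \<in> carrier_mat n n" "transpose_mat B = - B" using that by (auto simp: skews_def)
    have "transpose_mat (transpose_mat X * B * X) = transpose_mat X * transpose_mat B * X"
      using B(1) that(2) by (simp add: transpose_mult[of _ n n _ n] assoc_mult_mat[of _ n n _ n _ n])
    also have "\<dots> = - (transpose_mat X * B * X)" unfolding B(2)
      using B(1) that(2) by (auto intro!: eq_matI simp: scalar_prod_def sum_negf atLeast0LessThan)
    finally show ?thesis using B that(2) by (simp add: skews_def)
  qed
  have inv1: "transpose_mat k * (transpose_mat ?h * B * ?h) * k = B" if "B \<in> carrier_mat n n" for B
  proof -
    have "transpose_mat k * (transpose_mat ?h * B * ?h) * k = (transpose_mat k * transpose_mat ?h) * B * (?h * k)"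
      using that k(1) h by (simp add: assoc_mult_mat[of _ n n _ n _ n])
    then show ?thesis using that k kt by simp
  qed
  have inv2: "transpose_mat ?h * (transpose_mat k * B * k) * ?h = B" if "B \<in> carrier_mat n n" for B
  proof -
    have "transpose_mat ?h * (transpose_mat k * B * k) * ?h = (transpose_mat ?h * transpose_mat k) * B * (k * ?h)"
      using that k(1) h by (simp add: assoc_mult_mat[of _ n n _ n _ n])
    then show ?thesis using that k kt by simp
  qed
  let ?S = "{B \<in> skews. \<forall>i<length ys. act B (ys ! i) = zs ! i}"
  let ?S' = "{B \<in> skews. \<forall>i<n. \<forall>j. m \<le> j \<and> j < n \<longrightarrow> B $$ (i, j) = c i j}"
  have "bij_betw (\<lambda>B. transpose_mat ?h * B * ?h) ?S ?S'"
  proof (rule bij_betw_byWitness[where f' = "\<lambda>B. transpose_mat k * B * k"])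
    show "\<forall>B\<in>?S. transpose_mat k * (transpose_mat ?h * B * ?h) * k = B"
      using inv1 skews_carrier by auto
    show "\<forall>B\<in>?S'. transpose_mat ?h * (transpose_mat k * B * k) * ?h = B"
      using inv2 skews_carrier by auto
    show "(\<lambda>B. transpose_mat ?h * B * ?h) ` ?S \<subseteq> ?S'"
    proof clarify
      fix B assume B: "B \<in> skews" "\<forall>i<length ys. act B (ys ! i) = zs ! i"
      have "(transpose_mat ?h * B * ?h) $$ (i, j) = c i j" if "i < n" "m \<le> j" "j < n" for i j
        using gram[OF skews_carrier[OF B(1)] that(1,3)] B(2) that hs_nth[of "j - m"] m
        by (simp add: c_def)
      then show "transpose_mat ?h * B * ?h \<in> skews \<and>
          (\<forall>i<n. \<forall>j. m \<le> j \<and> j < n \<longrightarrow> (transpose_mat ?h * B * ?h) $$ (i, j) = c i j)"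
        using skew_conj[OF B(1) h] by blast
    qed
    show "(\<lambda>B. transpose_mat k * B * k) ` ?S' \<subseteq> ?S"
    proof clarify
      fix B' assume B': "B' \<in> skews" "\<forall>i<n. \<forall>j. m \<le> j \<and> j < n \<longrightarrow> B' $$ (i, j) = c i j"
      define B where "B = transpose_mat k * B' * k"
      have B: "B \<in> skews" unfolding B_def by (rule skew_conj[OF B'(1) k(1)])
      note Bc = skews_carrier[OF B]
      have eq: "transpose_mat ?h * B * ?h = B'"
        unfolding B_def by (rule inv2[OF skews_carrier[OF B'(1)]])
      have "act B (ys ! i) = zs ! i" if i: "i < length ys" for i
      proof -
        have mi: "m \<le> m + i" "m + i < n" using i us by (auto simp: m_def)
        have "dot n (hs ! a) (act B (ys ! i)) = dot n (hs ! a) (zs ! i)" if "a < n" for a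
          using gram[OF Bc that mi(2)] B'(2) that mi unfolding eq by (simp add: hs_nth c_def)
        then have "act (transpose_mat ?h) (act B (ys ! i)) = act (transpose_mat ?h) (zs ! i)"
          by (auto simp: act_def dot_def fun_eq_iff)
        then have "act (transpose_mat k * transpose_mat ?h) (act B (ys ! i))
            = act (transpose_mat k * transpose_mat ?h) (zs ! i)"
          using k(1) by (simp add: act_mult[of _ n n _ n])
        moreover have "zs ! i \<in> Vn n" using zs i by (metis nth_mem subsetD)
        ultimately show ?thesis
          unfolding kt using act_one act_in_Vn[OF Bc] by metis
      qed
      then show "transpose_mat k * B' * k \<in> skews \<and> (\<forall>i<length ys. act (transpose_mat k * B' * k) (ys ! i) = zs ! i)"
        using B unfolding B_def by blast
    qed
  qed
  then have "card ?S = card ?S'" by (rule bij_betw_same_card)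
  also have "\<dots> = CARD('a) ^ (m choose 2)"
  proof (rule card_skews_lower_columns[OF m(1)])
    fix i j assume ij: "m \<le> i" "i < n" "m \<le> j" "j < n"
    have "i - m < length ys" "j - m < length ys" using ij us by (auto simp: m_def)
    then show "c i j = - c j i"
      using compat[of "i - m" "j - m"] hs_nth[of "i - m"] hs_nth[of "j - m"] ij by (simp add: c_def)
  qed
  finally show ?thesis using m(2) by simp
qed

end

section \<open>The filtration of the invariant functions\<close>

lemma fscale_apply: "fscale c f x = c * f x"
  by (simp add: fscale_def)

lemma subspace_kernel: "fv_linear L \<Longrightarrow> fv.subspace {v. L v = 0}"
  by (rule fv.subspaceI) (auto simp only: fv_linear_ops[of L] mem_Collect_eq add_0 fv.scale_zero_right)

lemma sum_fun_apply: "(\<Sum>i\<in>A. f i) x = (\<Sum>i\<in>A. f i x)"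
  for f :: "'i \<Rightarrow> 'b \<Rightarrow> 'c::comm_monoid_add"
  by (induction A rule: infinite_finite_induct) auto

text \<open>The order of the field is a parameter, so that the eigenvalues \<open>mu k\<close> do not need a type argument.\<close>
locale siegel_spectrum = siegel n M for n and M :: "'a::{finite,field} set" +
  fixes q :: complex
  assumes q: "q = of_nat CARD('a)"
begin

abbreviation yg :: "'a mat \<Rightarrow> (nat \<Rightarrow> 'a) \<Rightarrow> nat \<Rightarrow> 'a" where
  "yg g v \<equiv> hi n (act g v)"

abbreviation V2 :: "(nat \<Rightarrow> 'a) set" where "V2 \<equiv> Vn (2 * n)"

abbreviation T :: "('a mat \<Rightarrow> complex) \<Rightarrow> 'a mat \<Rightarrow> complex" where "T \<equiv> intertwiner G n"

text \<open>Let \<open>L\<^sub>g\<close> be the maximal isotropic subspace attached to the coset \<open>P g\<close>, that is the kernel of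
  \<open>yg g\<close>. For \<open>vs\<close> a basis of \<open>W\<close>, the function \<open>incid vs\<close> tests whether \<open>W\<close> is contained in \<open>L\<^sub>g\<close>, and
  \<open>transv vs\<close> whether \<open>W\<close> meets \<open>L\<^sub>g\<close> only in zero.\<close>
definition incid :: "(nat \<Rightarrow> 'a) list \<Rightarrow> 'a mat \<Rightarrow> complex" where
  "incid vs = (\<lambda>g. of_bool (g \<in> G \<and> (\<forall>v\<in>set vs. yg g v = 0)))"

definition transv :: "(nat \<Rightarrow> 'a) list \<Rightarrow> 'a mat \<Rightarrow> complex" where
  "transv vs = (\<lambda>g. of_bool (g \<in> G \<and> lind (map (yg g) vs)))"

definition Filt :: "nat \<Rightarrow> ('a mat \<Rightarrow> complex) set" where
  "Filt k = cfun.span {incid vs | vs. set vs \<subseteq> V2 \<and> length vs < k}"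

definition mu :: "nat \<Rightarrow> complex" where
  "mu k = (- 1) ^ k * q ^ ((k choose 2) + ((n - k) choose 2))"

lemma yg_linear: "fv_linear (yg g)"
  by (rule fv_linearI) (simp_all add: act_add act_fvs lo_hi_add lo_hi_fvs)

lemmas yg_ops = fv_linear_ops[OF yg_linear]

lemma T_eq: "T f g = (if g \<in> G then \<Sum>B\<in>skews. f (Jmat n * unip B * g) else 0)"
  unfolding intertwiner_def unip_rad_eq using inj_unip by (simp add: sum.reindex)

lemma T_add: "T (f + h) = T f + T h"
  by (auto simp: T_eq fun_eq_iff sum.distrib)

lemma T_fscale: "T (fscale c f) = fscale c (T f)"
  by (auto simp: T_eq fun_eq_iff fscale_apply sum_distrib_left)

lemma T_linear: "Vector_Spaces.linear fscale fscale T"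
  by (intro Vector_Spaces.linear.intro module_hom.intro module_hom_axioms.intro
      cfun.module_axioms cfun.vector_space_axioms T_add T_fscale)

interpretation T: Vector_Spaces.linear fscale fscale T by (rule T_linear)

lemmas T_ops = T_add T_fscale T.zero T.diff T.sum

lemma Jug_in_G: "B \<in> skews \<Longrightarrow> g \<in> G \<Longrightarrow> Jmat n * unip B * g \<in> G"
  by (intro mult_G Jmat_G unip_G)

text \<open>If the lower halves are dependent, the same relation would hold between the full
  vectors \<open>g v\<close>, since a solution \<open>B\<close> makes the upper half a linear function of the
  lower one.\<close>
lemma solvable_imp_lind:
  assumes g: "g \<in> G" and B: "B \<in> skews" and vs: "lind vs" "set vs \<subseteq> V2"
    and sol: "\<And>v. v \<in> set vs \<Longrightarrow> lo n (act g v) + act B (yg g v) = 0"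
  shows "lind (map (yg g) vs)"
  using vs sol
proof (induction vs)
  case (Cons v vs)
  let ?S = "{w. w \<in> V2 \<and> lo n (act g w) + act B (yg g w) = 0}"
  have "fv_linear (\<lambda>w. lo n (act g w) + act B (yg g w))"
    by (rule fv_linearI)
       (simp_all only: act_add act_fvs lo_hi_add lo_hi_fvs fv.scale_right_distrib add_ac)
  then have "fv.subspace ?S"
    using fv.subspace_inter[OF subspace_Vn[of "2 * n"] subspace_kernel] by (simp add: Int_def)
  then have sub: "fv.span (set vs) \<subseteq> ?S"
    using Cons.prems by (intro fv.span_minimal) fastforce+
  have "yg g v \<notin> fv.span (yg g ` set vs)"
  proof
    assume "yg g v \<in> fv.span (yg g ` set vs)"
    then obtain w where w: "w \<in> fv.span (set vs)" "yg g v = yg g w"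
      by (auto simp: yg_ops(5))
    have wS: "w \<in> V2" "lo n (act g w) + act B (yg g w) = 0" using sub w(1) by auto
    have "lo n (act g w) + act B (yg g v) = 0" unfolding w(2) by (rule wS(2))
    moreover have "lo n (act g v) + act B (yg g v) = 0" by (rule Cons.prems(3)) simp
    ultimately have "lo n (act g v) = lo n (act g w)" by (metis add_right_cancel)
    then have "act g v = act g w"
      using w(2) by (rule lo_hi_eqI[OF act_in_Vn[OF G_carrier[OF g]] act_in_Vn[OF G_carrier[OF g]]])
    then have "v = w"
      using act_ginv(1)[OF g, of v] act_ginv(1)[OF g, of w] Cons.prems(2) wS(1) by auto
    then show False using w(1) Cons.prems(1) by simp
  qed
  then show ?case using Cons by simp
qed simp

text \<open>The subspaces counted by \<open>T (incid vs)\<close> contain \<open>vs\<close> and are complementary to the one attached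
  to \<open>g\<close>; they exist only if \<open>vs\<close> is independent modulo the latter, and then their number
  does not depend on \<open>g\<close>.\<close>
lemma T_incid:
  assumes vs: "lind vs" "set vs \<subseteq> V2" and iso: "\<And>v w. v \<in> set vs \<Longrightarrow> w \<in> set vs \<Longrightarrow> bform n v w = 0"
  shows "T (incid vs) = fscale (q ^ ((n - length vs) choose 2)) (transv vs)"
proof
  fix g
  show "T (incid vs) g = fscale (q ^ ((n - length vs) choose 2)) (transv vs) g"
  proof (cases "g \<in> G")
    case True
    let ?S = "{B \<in> skews. \<forall>v\<in>set vs. lo n (act g v) + act B (yg g v) = 0}"
    have "T (incid vs) g = (\<Sum>B\<in>skews. of_bool (\<forall>v\<in>set vs. lo n (act g v) + act B (yg g v) = 0))"
      using True by (simp add: T_eq incid_def Jug_in_G hi_act_opposite)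
    also have "\<dots> = of_nat (card ?S)"
      using finite_skews by (simp add: of_bool_def sum.If_cases Int_def)
    also have "card ?S = (if lind (map (yg g) vs) then CARD('a) ^ ((n - length vs) choose 2) else 0)"
    proof (cases "lind (map (yg g) vs)")
      case lind: True
      have "card {B \<in> skews. \<forall>i<length (map (yg g) vs).
          act B (map (yg g) vs ! i) = map (\<lambda>v. - lo n (act g v)) vs ! i}
        = CARD('a) ^ ((n - length (map (yg g) vs)) choose 2)"
      proof (rule card_skews_prescribed[OF lind])
        show "set (map (\<lambda>v. - lo n (act g v)) vs) \<subseteq> Vn n"
          by (auto simp: lo_def Vn_def)
        fix i j assume ij: "i < length (map (yg g) vs)" "j < length (map (yg g) vs)"
        have "bform n (act g (vs ! i)) (act g (vs ! j)) = 0"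
          using bform_act[OF G_carrier gram_G(1), OF True True] iso ij by simp
        then show "dot n (map (yg g) vs ! i) (map (\<lambda>v. - lo n (act g v)) vs ! j) =
           - dot n (map (yg g) vs ! j) (map (\<lambda>v. - lo n (act g v)) vs ! i)"
          using ij by (simp add: bform_def dot_minus dot_commute[of n "hi n _" "lo n _"] add_eq_0_iff)
      qed (use lo_hi_in_Vn in auto)
      moreover have "?S = {B \<in> skews. \<forall>i<length (map (yg g) vs).
          act B (map (yg g) vs ! i) = map (\<lambda>v. - lo n (act g v)) vs ! i}"
        by (auto simp: all_set_conv_all_nth eq_neg_iff_add_eq_0 add.commute)
      ultimately show ?thesis using lind by simp
    next
      case False
      then have "?S = {}" using solvable_imp_lind[OF True _ vs] by blast
      then have "card ?S = 0" by (simp only: card.empty)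
      then show ?thesis using False by simp
    qed
    finally show ?thesis using True by (simp add: fscale_apply transv_def q)
  qed (simp add: T_eq fscale_apply transv_def)
qed

lemma subspace_Filt: "cfun.subspace (Filt k)"
  by (simp add: Filt_def)

lemmas Filt_closed = cfun.subspace_add[OF subspace_Filt] cfun.subspace_diff[OF subspace_Filt]
  cfun.subspace_scale[OF subspace_Filt] cfun.subspace_sum[OF subspace_Filt]
  cfun.subspace_0[OF subspace_Filt]

lemma incid_in_Filt: "set vs \<subseteq> V2 \<Longrightarrow> length vs < k \<Longrightarrow> incid vs \<in> Filt k"
  unfolding Filt_def by (intro cfun.span_base) auto

lemma Filt_mono: "k \<le> l \<Longrightarrow> Filt k \<subseteq> Filt l"
  unfolding Filt_def by (intro cfun.span_mono) auto

lemma incid_reduce: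
  assumes "fv.span (set us) = fv.span (set vs)"
  shows "incid us = incid vs"
proof -
  have "(\<forall>v\<in>set vs. yg g v = 0) \<longleftrightarrow> (\<forall>v\<in>fv.span (set vs). yg g v = 0)" for g vs
  proof
    assume "\<forall>v\<in>set vs. yg g v = 0"
    moreover have "fv.subspace {v. yg g v = 0}" by (rule subspace_kernel[OF yg_linear])
    ultimately have "fv.span (set vs) \<subseteq> {v. yg g v = 0}" by (intro fv.span_minimal) blast+
    then show "\<forall>v\<in>fv.span (set vs). yg g v = 0" by blast
  qed (use fv.span_base in blast)
  then have "(\<forall>v\<in>set us. yg g v = 0) \<longleftrightarrow> (\<forall>v\<in>set vs. yg g v = 0)" for g
    by (simp only: assms)
  then show ?thesis unfolding incid_def by (simp only:)
qed

lemma mult_incid_Filt: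
  assumes "f \<in> Filt k" "v \<in> V2"
  shows "(\<lambda>g. incid [v] g * f g) \<in> Filt (Suc k)"
proof -
  have "cfun.subspace {f. (\<lambda>g. incid [v] g * f g) \<in> Filt (Suc k)}"
  proof (rule cfun.subspaceI)
    show "0 \<in> {f. (\<lambda>g. incid [v] g * f g) \<in> Filt (Suc k)}"
      using Filt_closed(5)[of "Suc k"] by (simp add: zero_fun_def)
  next
    fix f h assume "f \<in> {f. (\<lambda>g. incid [v] g * f g) \<in> Filt (Suc k)}" "h \<in> {f. (\<lambda>g. incid [v] g * f g) \<in> Filt (Suc k)}"
    then show "f + h \<in> {f. (\<lambda>g. incid [v] g * f g) \<in> Filt (Suc k)}"
      using Filt_closed(1)[of "\<lambda>g. incid [v] g * f g" "Suc k" "\<lambda>g. incid [v] g * h g"]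
      by (simp add: plus_fun_def algebra_simps)
  next
    fix c f assume "f \<in> {f. (\<lambda>g. incid [v] g * f g) \<in> Filt (Suc k)}"
    then show "fscale c f \<in> {f. (\<lambda>g. incid [v] g * f g) \<in> Filt (Suc k)}"
      using Filt_closed(3)[of "\<lambda>g. incid [v] g * f g" "Suc k" c] by (simp add: fscale_def algebra_simps)
  qed
  moreover have "{incid vs |vs. set vs \<subseteq> V2 \<and> length vs < k} \<subseteq> {f. (\<lambda>g. incid [v] g * f g) \<in> Filt (Suc k)}"
  proof clarify
    fix vs :: "(nat \<Rightarrow> 'a) list" assume vs: "set vs \<subseteq> V2" "length vs < k"
    have "(\<lambda>g. incid [v] g * incid vs g) = incid (v # vs)" by (auto simp: incid_def fun_eq_iff)
    then show "(\<lambda>g. incid [v] g * incid vs g) \<in> Filt (Suc k)"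
      using incid_in_Filt[of "v # vs" "Suc k"] vs assms(2) by simp
  qed
  ultimately show ?thesis
    using assms(1) cfun.span_minimal unfolding Filt_def by blast
qed

text \<open>Given that \<open>ws\<close> is independent modulo the kernel of \<open>yg g\<close>, the vector \<open>v\<close> fails to extend it
  for exactly one translate \<open>v - w\<close>, \<open>w\<close> in the span of \<open>ws\<close>, that lies in this kernel.
  Each of the \<open>q ^ length ws\<close> translates contributes the same leading term, which gives the
  factor \<open>- q ^ length ws\<close> and so the value of the Moebius function of the subspace lattice.\<close>
lemma transv_leading_term:
  assumes "lind vs" "set vs \<subseteq> V2"
  shows "transv vs - fscale ((- 1) ^ length vs * q ^ (length vs choose 2)) (incid vs) \<in> Filt (length vs)"
  using assms
proof (induction vs)
  case Nil
  have "transv [] - fscale 1 (incid []) = 0"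
    by (auto simp: transv_def incid_def fun_eq_iff fscale_apply)
  moreover have "(- 1) ^ length ([] :: (nat \<Rightarrow> 'a) list) * q ^ (length ([] :: (nat \<Rightarrow> 'a) list) choose 2) = 1"
    by (simp add: numeral_2_eq_2)
  ultimately show ?case using Filt_closed(5) by (simp only:)
next
  case (Cons v ws)
  let ?k = "length ws"
  let ?l = "(- 1) ^ ?k * q ^ (?k choose 2)"
  let ?S = "fv.span (set ws)"
  define r where "r = transv ws - fscale ?l (incid ws)"
  have ws: "lind ws" "set ws \<subseteq> V2" "v \<notin> ?S" "v \<in> V2" using Cons.prems by auto
  have r: "r \<in> Filt ?k" unfolding r_def by (rule Cons.IH[OF ws(1,2)])
  have S: "finite ?S" "card ?S = CARD('a) ^ ?k" using span_finite_card[OF ws(1)] by auto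
  have SV: "?S \<subseteq> V2" by (rule span_subset_Vn[OF ws(2)])
  have Nws: "transv ws = fscale ?l (incid ws) + r" by (simp add: r_def)
  have dec: "transv (v # ws) g = transv ws g - (\<Sum>w\<in>?S. incid [v - w] g * transv ws g)" for g
  proof (cases "g \<in> G \<and> lind (map (yg g) ws)")
    case True
    have inj: "w = w'" if "w \<in> ?S" "w' \<in> ?S" "yg g v = yg g w" "yg g v = yg g w'" for w w'
    proof -
      have "yg g (w - w') = 0" unfolding yg_ops(4) using that by simp
      then have "w - w' = 0"
        using lind_map_inj[OF yg_linear, of g ws "w - w'"] True that fv.span_diff by blast
      then show ?thesis by simp
    qed
    have e: "incid [v - w] g = of_bool (yg g v = yg g w)" for w
      using True by (simp add: incid_def yg_ops(4))
    have "(\<Sum>w\<in>?S. of_bool (yg g v = yg g w) :: complex) = of_bool (yg g v \<in> yg g ` ?S)"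
    proof (cases "yg g v \<in> yg g ` ?S")
      case t: True
      then obtain w0 where w0: "w0 \<in> ?S" "yg g v = yg g w0" by auto
      have "(\<Sum>w\<in>?S. of_bool (yg g v = yg g w) :: complex) = (\<Sum>w\<in>?S. if w = w0 then 1 else 0)"
        using w0 inj by (intro sum.cong) auto
      then show ?thesis using t w0(1) S(1) by simp
    qed (auto intro!: sum.neutral)
    then show ?thesis using True by (simp add: transv_def e yg_ops(5))
  qed (auto simp: transv_def)
  have "transv (v # ws) = transv ws - (\<Sum>w\<in>?S. (\<lambda>g. incid [v - w] g * transv ws g))"
    by (rule ext) (simp add: dec sum_fun_apply)
  also have "(\<Sum>w\<in>?S. (\<lambda>g. incid [v - w] g * transv ws g))
      = (\<Sum>w\<in>?S. fscale ?l (incid (v # ws)) + (\<lambda>g. incid [v - w] g * r g))"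
  proof (rule sum.cong[OF refl])
    fix w assume w: "w \<in> ?S"
    have "fv.span (set ((v - w) # ws)) = fv.span (set (v # ws))"
    proof -
      have "v - w \<in> fv.span (insert v (set ws))"
        using w by (intro fv.span_diff) (auto intro: fv.span_base fv.span_mono[THEN subsetD])
      moreover have "(v - w) + w \<in> fv.span (insert (v - w) (set ws))"
        using w by (intro fv.span_add) (auto intro: fv.span_base fv.span_mono[THEN subsetD])
      ultimately show ?thesis
        by (intro equalityI fv.span_minimal) (auto intro: fv.span_base)
    qed
    then have "incid ((v - w) # ws) = incid (v # ws)" by (rule incid_reduce)
    moreover have "incid ((v - w) # ws) g = incid [v - w] g * incid ws g" for g
      by (auto simp: incid_def)
    ultimately have "incid [v - w] g * incid ws g = incid (v # ws) g" for g by metis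
    then show "(\<lambda>g. incid [v - w] g * transv ws g) = fscale ?l (incid (v # ws)) + (\<lambda>g. incid [v - w] g * r g)"
      by (simp add: Nws fun_eq_iff fscale_apply algebra_simps)
  qed
  also have "\<dots> = fscale (q ^ ?k * ?l) (incid (v # ws)) + (\<Sum>w\<in>?S. (\<lambda>g. incid [v - w] g * r g))"
  proof -
    have "(\<Sum>w\<in>?S. fscale ?l (incid (v # ws))) g = fscale (q ^ ?k * ?l) (incid (v # ws)) g" for g
      unfolding sum_fun_apply by (simp add: fscale_apply S q)
    then show ?thesis unfolding sum.distrib by (simp add: fun_eq_iff)
  qed
  finally have "transv (v # ws) - fscale (- (q ^ ?k * ?l)) (incid (v # ws))
      = transv ws - (\<Sum>w\<in>?S. (\<lambda>g. incid [v - w] g * r g))"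
    by (auto simp: fun_eq_iff fscale_apply algebra_simps)
  moreover have "transv ws \<in> Filt (Suc ?k)"
    unfolding Nws using incid_in_Filt[OF ws(2), of "Suc ?k"] r Filt_mono[of ?k "Suc ?k"]
    by (intro Filt_closed) auto
  moreover have "(\<Sum>w\<in>?S. (\<lambda>g. incid [v - w] g * r g)) \<in> Filt (Suc ?k)"
    using mult_incid_Filt[OF r] SV ws(4) fv.subspace_diff[OF subspace_Vn] by (intro Filt_closed) blast
  ultimately have "transv (v # ws) - fscale (- (q ^ ?k * ?l)) (incid (v # ws)) \<in> Filt (Suc ?k)"
    by (simp only: Filt_closed(2))
  moreover have "- (q ^ ?k * ?l) = (- 1) ^ length (v # ws) * q ^ (length (v # ws) choose 2)"
    by (simp add: numeral_2_eq_2 power_add)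
  ultimately show ?case by (simp only: list.size add_Suc_right add_0_right One_nat_def)
qed

text \<open>If some \<open>L\<^sub>g\<close> contains the span of \<open>vs\<close>, then this span is totally isotropic.\<close>
lemma incid_cases:
  assumes "set vs \<subseteq> V2"
  obtains "incid vs = 0"
  | us where "lind us" "set us \<subseteq> V2" "incid vs = incid us" "length us \<le> length vs"
      "\<And>v w. v \<in> set us \<Longrightarrow> w \<in> set us \<Longrightarrow> bform n v w = 0"
proof -
  obtain us where us: "lind us" "set us \<subseteq> set vs" "fv.span (set us) = fv.span (set vs)"
    "length us \<le> length vs" using lind_reduce by blast
  have e: "incid vs = incid us" by (rule incid_reduce[OF us(3)[symmetric]])
  show ?thesis
  proof (cases "\<forall>v\<in>set us. \<forall>w\<in>set us. bform n v w = 0")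
    case True
    then show ?thesis using us assms e by (intro that(2)[of us]) auto
  next
    case False
    then obtain v w where vw: "v \<in> set us" "w \<in> set us" "bform n v w \<noteq> 0" by blast
    have "incid us g = 0" for g
    proof (rule ccontr)
      assume "incid us g \<noteq> 0"
      then have g: "g \<in> G" "yg g v = 0" "yg g w = 0" using vw by (auto simp: incid_def)
      then have "sim g * bform n v w = 0"
        using bform_act[OF G_carrier gram_G(1), OF g(1) g(1), of v w] by (simp add: bform_def dot_zero)
      then show False using gram_G(3)[OF g(1)] vw(3) by simp
    qed
    then show ?thesis using that(1) e by (simp add: fun_eq_iff)
  qed
qed

text \<open>Combine the count \<open>T_incid\<close> with the expansion of \<open>transv vs\<close>: both contribute a power of \<open>q\<close> to \<open>mu\<close>, and
  the latter also the sign.\<close>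
lemma T_incid_triangular:
  assumes "lind vs" "set vs \<subseteq> V2" "\<And>v w. v \<in> set vs \<Longrightarrow> w \<in> set vs \<Longrightarrow> bform n v w = 0"
  shows "T (incid vs) - fscale (mu (length vs)) (incid vs) \<in> Filt (length vs)"
proof -
  let ?k = "length vs"
  let ?c = "q ^ ((n - ?k) choose 2)"
  have "T (incid vs) - fscale (mu ?k) (incid vs)
      = fscale ?c (transv vs - fscale ((- 1) ^ ?k * q ^ (?k choose 2)) (incid vs))"
    by (simp add: T_incid[OF assms] fun_eq_iff fscale_apply mu_def power_add algebra_simps)
  then show ?thesis using Filt_closed(3)[OF transv_leading_term[OF assms(1,2)]] by simp
qed

lemma T_Filt: "f \<in> Filt k \<Longrightarrow> T f \<in> Filt k"
proof -
  assume f: "f \<in> Filt k"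
  have "cfun.subspace {f. T f \<in> Filt k}"
    by (rule cfun.subspaceI) (auto simp: T_ops Filt_closed)
  moreover have "{incid vs |vs. set vs \<subseteq> V2 \<and> length vs < k} \<subseteq> {f. T f \<in> Filt k}"
  proof clarify
    fix vs :: "(nat \<Rightarrow> 'a) list" assume vs: "set vs \<subseteq> V2" "length vs < k"
    show "T (incid vs) \<in> Filt k"
    proof (cases rule: incid_cases[OF vs(1)])
      case 1
      then show ?thesis by (simp only: T_ops Filt_closed)
    next
      case (2 us)
      have "T (incid us) - fscale (mu (length us)) (incid us) \<in> Filt k"
        using T_incid_triangular[OF 2(1,2,5)] Filt_mono[of "length us" k] 2(4) vs(2) by auto
      moreover have "fscale (mu (length us)) (incid us) \<in> Filt k"
        using 2 vs by (intro Filt_closed incid_in_Filt) auto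
      ultimately have "T (incid us) - fscale (mu (length us)) (incid us) + fscale (mu (length us)) (incid us) \<in> Filt k"
        by (rule Filt_closed)
      then show ?thesis by (simp add: 2(3))
    qed
  qed
  ultimately show ?thesis using f cfun.span_minimal unfolding Filt_def by blast
qed

lemma Filt_triangular:
  assumes "f \<in> Filt (Suc k)"
  shows "T f - fscale (mu k) f \<in> Filt k"
proof -
  have "cfun.subspace {f. T f - fscale (mu k) f \<in> Filt k}"
  proof (rule cfun.subspaceI)
    show "0 \<in> {f. T f - fscale (mu k) f \<in> Filt k}"
      using Filt_closed(5) by (simp add: T_ops)
  next
    fix f h assume "f \<in> {f. T f - fscale (mu k) f \<in> Filt k}" "h \<in> {f. T f - fscale (mu k) f \<in> Filt k}"
    then have "(T f - fscale (mu k) f) + (T h - fscale (mu k) h) \<in> Filt k"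
      by (intro Filt_closed(1)) auto
    then show "f + h \<in> {f. T f - fscale (mu k) f \<in> Filt k}"
      by (simp only: mem_Collect_eq T_ops cfun.scale_right_distrib add_diff_add)
  next
    fix c f assume "f \<in> {f. T f - fscale (mu k) f \<in> Filt k}"
    then have "fscale c (T f - fscale (mu k) f) \<in> Filt k" by (intro Filt_closed(3)) auto
    then show "fscale c f \<in> {f. T f - fscale (mu k) f \<in> Filt k}"
      by (simp add: T_ops cfun.scale_right_diff_distrib mult.commute)
  qed
  moreover have "{incid vs |vs. set vs \<subseteq> V2 \<and> length vs < Suc k} \<subseteq> {f. T f - fscale (mu k) f \<in> Filt k}"
  proof clarify
    fix vs :: "(nat \<Rightarrow> 'a) list" assume vs: "set vs \<subseteq> V2" "length vs < Suc k"
    show "T (incid vs) - fscale (mu k) (incid vs) \<in> Filt k"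
    proof (cases rule: incid_cases[OF vs(1)])
      case 1
      then show ?thesis using Filt_closed(5) by (simp add: T_ops)
    next
      case (2 us)
      show ?thesis
      proof (cases "length us = k")
        case True
        then show ?thesis using T_incid_triangular[OF 2(1,2,5)] 2(3) by simp
      next
        case False
        then have "incid us \<in> Filt k" using 2 vs by (intro incid_in_Filt) auto
        then show ?thesis unfolding 2(3) by (intro Filt_closed T_Filt)
      qed
    qed
  qed
  ultimately show ?thesis using assms cfun.span_minimal unfolding Filt_def by blast
qed

definition Inv :: "('a mat \<Rightarrow> complex) set" where
  "Inv = Ind G n (\<lambda>_. 1)"

lemma Inv_iff: "f \<in> Inv \<longleftrightarrow> (\<forall>g. g \<notin> G \<longrightarrow> f g = 0) \<and> (\<forall>p\<in>P. \<forall>g\<in>G. f (p * g) = f g)"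
  by (simp add: Inv_def Ind_def)

lemma incid_Inv: "incid vs \<in> Inv"
  unfolding Inv_iff incid_def using hi_act_P mult_G P_G by simp

lemma subspace_Inv: "cfun.subspace Inv"
  by (rule cfun.subspaceI) (auto simp: Inv_iff fscale_apply)

text \<open>The functions \<open>incid vs\<close> for \<open>vs\<close> a basis of a maximal isotropic subspace are the indicator
  functions of the cosets of \<open>P\<close>.\<close>
lemma Filt_eq_Inv: "Filt (Suc n) = Inv"
proof
  show "Filt (Suc n) \<subseteq> Inv"
    unfolding Filt_def by (rule cfun.span_minimal[OF _ subspace_Inv]) (auto simp: incid_Inv)
  show "Inv \<subseteq> Filt (Suc n)"
  proof
    fix f assume f: "f \<in> Inv"
    define e :: "nat \<Rightarrow> nat \<Rightarrow> 'a" where "e = (\<lambda>i j. if j = i then 1 else 0)"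
    define vs where "vs = (\<lambda>g. map (\<lambda>i. act (ginv g) (e i)) [0..<n])"
    have eV: "e i \<in> Vn n" if "i < n" for i using that by (auto simp: e_def Vn_def)
    have basis: "(\<forall>i<n. L (e i) = 0) \<longleftrightarrow> (\<forall>v\<in>Vn n. L v = 0)" if L: "fv_linear L" for L
    proof
      assume a: "\<forall>i<n. L (e i) = 0"
      show "\<forall>v\<in>Vn n. L v = 0"
      proof
        fix v :: "nat \<Rightarrow> 'a" assume v: "v \<in> Vn n"
        have "fv.subspace {v. L v = 0}" by (rule subspace_kernel[OF L])
        moreover have "v = (\<Sum>i<n. fvs (v i) (e i))"
        proof
          fix j
          have "(\<Sum>i<n. fvs (v i) (e i)) j = (\<Sum>i<n. v i * e i j)" for j
            by (induction n) (auto simp: fvs_def)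
          then show "v j = (\<Sum>i<n. fvs (v i) (e i)) j"
            using v by (simp add: e_def if_distrib[of "\<lambda>x. _ * x"] Vn_def cong: if_cong)
        qed
        ultimately show "L v = 0"
          using a fv.subspace_sum[of "{v. L v = 0}" "{..<n}" "\<lambda>i. fvs (v i) (e i)"]
            fv.subspace_scale[of "{v. L v = 0}"] by (metis (mono_tags, lifting) lessThan_iff mem_Collect_eq)
      qed
    qed (use eV in blast)
    have E_vs: "incid (vs g) h = of_bool (h \<in> G \<and> h * ginv g \<in> P)" if g: "g \<in> G" for g h
    proof (cases "h \<in> G")
      case True
      have "(\<forall>v\<in>set (vs g). yg h v = 0) \<longleftrightarrow> (\<forall>i<n. yg (h * ginv g) (e i) = 0)"
        using g True by (auto simp: vs_def act_mult[of _ "2 * n" "2 * n" _ "2 * n"] G_carrier ginv_carrier)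
      then show ?thesis
        using basis[OF yg_linear, of "h * ginv g"] P_iff[OF mult_G[OF True ginv_G[OF g]]] True
        by (simp add: incid_def)
    qed (simp add: incid_def)
    have "finite P" using finite_G finite_subset[of P G] P_G by auto
    moreover have "1\<^sub>m (2 * n) \<in> P"
      using P_iff[OF one_G] Vn_mono[of n "2 * n"] by (auto simp: act_one subsetD) (auto simp: hi_def Vn_def fun_eq_iff)
    ultimately have cP: "card P \<noteq> 0" by auto
    have "f = (\<Sum>g\<in>G. fscale (f g / of_nat (card P)) (incid (vs g)))"
    proof
      fix h
      show "f h = (\<Sum>g\<in>G. fscale (f g / of_nat (card P)) (incid (vs g))) h"
      proof (cases "h \<in> G")
        case True
        have "(\<Sum>g\<in>G. fscale (f g / of_nat (card P)) (incid (vs g))) h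
            = (\<Sum>g\<in>G. if h * ginv g \<in> P then f g / of_nat (card P) else 0)"
          unfolding sum_fun_apply using True by (intro sum.cong) (auto simp: fscale_apply E_vs)
        also have "\<dots> = (\<Sum>g\<in>{g \<in> G. h * ginv g \<in> P}. f h / of_nat (card P))"
        proof (subst sum.inter_filter[OF finite_G, symmetric], rule sum.cong[OF refl])
          fix g assume g: "g \<in> {x \<in> G. h * ginv x \<in> P}"
          then have "f (h * ginv g * g) = f g" using f unfolding Inv_iff by blast
          then show "f g / of_nat (card P) = f h / of_nat (card P)"
            using g True by (simp add: ginv_cancel G_carrier)
        qed
        also have "\<dots> = of_nat (card {g \<in> G. h * ginv g \<in> P}) * (f h / of_nat (card P))" by simp
        also have "card {g \<in> G. h * ginv g \<in> P} = card P"
        proof (rule bij_betw_same_card, rule bij_betw_byWitness[where f' = "\<lambda>p. ginv p * h"])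
          have gg: "ginv (h * ginv g) * h = g" if "g \<in> G" for g
          proof -
            have "ginv (h * ginv g) * (h * ginv g * g) = g"
              using ginv_cancel(1)[of "h * ginv g" g] that True by (simp add: mult_G ginv_G G_carrier)
            then show ?thesis using that True by (simp add: ginv_cancel G_carrier)
          qed
          have pp: "h * ginv (ginv p * h) = p" if "p \<in> P" for p
          proof -
            have "p * (ginv p * h) * ginv (ginv p * h) = p"
              using that True by (intro ginv_cancel) (auto intro: mult_G ginv_G P_G G_carrier)
            then show ?thesis using that True by (simp add: ginv_cancel P_G G_carrier)
          qed
          show "\<forall>g\<in>{g \<in> G. h * ginv g \<in> P}. ginv (h * ginv g) * h = g" using gg by simp
          show "\<forall>p\<in>P. h * ginv (ginv p * h) = p" using pp by simp
          show "(\<lambda>g. h * ginv g) ` {g \<in> G. h * ginv g \<in> P} \<subseteq> P" by auto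
          show "(\<lambda>p. ginv p * h) ` P \<subseteq> {g \<in> G. h * ginv g \<in> P}"
            using pp True by (auto intro: mult_G ginv_G P_G)
        qed
        finally show ?thesis using cP by simp
      qed (use f in \<open>auto simp: Inv_iff sum_fun_apply fscale_apply incid_def\<close>)
    qed
    also have "\<dots> \<in> Filt (Suc n)"
    proof (intro Filt_closed incid_in_Filt)
      fix g assume "g \<in> G"
      then show "set (vs g) \<subseteq> V2" by (auto simp: vs_def intro!: act_in_Vn ginv_carrier)
      show "length (vs g) < Suc n" by (simp add: vs_def)
    qed
    finally show "f \<in> Filt (Suc n)" .
  qed
qed

end

section \<open>Diagonalization from triangularity and self-adjointness\<close>

text \<open>An operator that is triangular along a filtration splits it into eigenvectors once every
  generalized eigenvector is an eigenvector: subtract from \<open>f\<close> the components of \<open>(T - mu k) f\<close> on which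
  \<open>T - mu k\<close> is invertible; what remains is annihilated by \<open>(T - mu k)\<^sup>2\<close>.\<close>
lemma triangular_splitting:
  fixes T :: "('b \<Rightarrow> complex) \<Rightarrow> 'b \<Rightarrow> complex" and V :: "nat \<Rightarrow> ('b \<Rightarrow> complex) set"
  assumes T: "Vector_Spaces.linear fscale fscale T"
    and sub: "\<And>k. cfun.subspace (V k)" and V0: "V 0 \<subseteq> {0}" and mono: "\<And>j k. j \<le> k \<Longrightarrow> V j \<subseteq> V k"
    and tri: "\<And>k f. k < m \<Longrightarrow> f \<in> V (Suc k) \<Longrightarrow> T f - fscale (mu k) f \<in> V k"
    and ss: "\<And>k f. k < m \<Longrightarrow> f \<in> V m \<Longrightarrow>
      T (T f - fscale (mu k) f) = fscale (mu k) (T f - fscale (mu k) f) \<Longrightarrow> T f = fscale (mu k) f"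
  shows "k \<le> m \<Longrightarrow> f \<in> V k \<Longrightarrow>
    \<exists>h. (\<forall>j<k. h j \<in> V (Suc j) \<and> T (h j) = fscale (mu j) (h j)) \<and> f = (\<Sum>j<k. h j)"
proof (induction k arbitrary: f)
  case 0
  then have "f = 0" using V0 by auto
  then show ?case by simp
next
  case (Suc k)
  interpret T: Vector_Spaces.linear fscale fscale T by (rule T)
  let ?c = "mu k"
  obtain h where h: "\<And>j. j < k \<Longrightarrow> h j \<in> V (Suc j)" "\<And>j. j < k \<Longrightarrow> T (h j) = fscale (mu j) (h j)"
    and g: "T f - fscale ?c f = (\<Sum>j<k. h j)"
    using Suc.IH[OF _ tri[of k f]] Suc.prems by (meson Suc_leD Suc_le_lessD)
  define a where "a = (\<lambda>j. fscale (if mu j = ?c then 0 else inverse (mu j - ?c)) (h j))"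
  define f' where "f' = f - (\<Sum>j<k. a j)"
  have a: "a j \<in> V (Suc j)" "T (a j) = fscale (mu j) (a j)" if "j < k" for j
    using h[OF that] cfun.subspace_scale[OF sub] by (simp_all add: a_def T.scale mult.commute)
  have Ta: "T (a j) - fscale ?c (a j) = fscale (if mu j = ?c then 0 else 1) (h j)" if "j < k" for j
    unfolding a(2)[OF that] by (auto simp: a_def fun_eq_iff fscale_apply divide_simps algebra_simps)
  have f': "f' \<in> V (Suc k)"
    unfolding f'_def using a(1) mono[of "Suc _" "Suc k"]
    by (intro cfun.subspace_diff[OF sub] cfun.subspace_sum[OF sub] Suc.prems) (meson Suc_mono lessThan_iff less_imp_le subsetD)
  have "T f' - fscale ?c f' = (T f - fscale ?c f) - (\<Sum>j<k. T (a j) - fscale ?c (a j))"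
    unfolding f'_def by (simp add: T.diff T.sum cfun.scale_right_diff_distrib cfun.scale_sum_right sum_subtractf)
  also have "\<dots> = (\<Sum>j<k. h j) - (\<Sum>j<k. fscale (if mu j = ?c then 0 else 1) (h j))"
    unfolding g by (intro arg_cong2[where f = "(-)"] sum.cong) (auto simp: Ta)
  also have "\<dots> = (\<Sum>j<k. fscale (if mu j = ?c then 1 else 0) (h j))"
    unfolding sum_subtractf[symmetric] by (intro sum.cong) (auto simp: fun_eq_iff fscale_apply)
  finally have e: "T f' - fscale ?c f' = (\<Sum>j<k. fscale (if mu j = ?c then 1 else 0) (h j))" .
  have "T (T f' - fscale ?c f') = fscale ?c (T f' - fscale ?c f')"
    unfolding e T.sum cfun.scale_sum_right
    by (intro sum.cong) (auto simp: T.scale h(2))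
  then have Tf': "T f' = fscale ?c f'"
    using ss[of k f'] f' mono[of "Suc k" m] Suc.prems(1) by auto
  let ?h = "\<lambda>j. if j = k then f' else a j"
  have "f = (\<Sum>j<Suc k. ?h j)" by (simp add: f'_def)
  then show ?case using a Tf' f' by (intro exI[of _ ?h]) (auto simp: less_Suc_eq)
qed

context siegel_spectrum
begin

interpretation T: Vector_Spaces.linear fscale fscale T by (rule T_linear)

definition inn :: "('a mat \<Rightarrow> complex) \<Rightarrow> ('a mat \<Rightarrow> complex) \<Rightarrow> complex" where
  "inn f h = (\<Sum>g\<in>G. f g * cnj (h g))"

lemma inn_diff: "inn (f - f') h = inn f h - inn f' h"
  and inn_fscale: "inn (fscale c f) h = c * inn f h" "inn f (fscale c h) = cnj c * inn f h"
  and inn_sum_right: "inn f (\<Sum>j\<in>A. hs j) = (\<Sum>j\<in>A. inn f (hs j))"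
proof -
  show "inn (f - f') h = inn f h - inn f' h"
    by (simp add: inn_def algebra_simps sum_subtractf)
  show "inn (fscale c f) h = c * inn f h" "inn f (fscale c h) = cnj c * inn f h"
    by (simp_all add: inn_def fscale_apply sum_distrib_left algebra_simps)
  show "inn f (\<Sum>j\<in>A. hs j) = (\<Sum>j\<in>A. inn f (hs j))"
    unfolding inn_def sum_fun_apply by (simp add: sum_distrib_left sum.swap[of _ G])
qed

lemma inn_self_zero: "f \<in> Inv \<Longrightarrow> inn f f = 0 \<Longrightarrow> f = 0"
proof
  fix g assume f: "f \<in> Inv" and "inn f f = 0"
  moreover have "inn f f = complex_of_real (\<Sum>g\<in>G. (cmod (f g))\<^sup>2)"
    unfolding inn_def of_real_sum by (intro sum.cong refl) (simp only: of_real_power complex_norm_square[symmetric])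
  ultimately have "complex_of_real (\<Sum>g\<in>G. (cmod (f g))\<^sup>2) = 0" by simp
  then have "(\<Sum>g\<in>G. (cmod (f g))\<^sup>2) = 0" by (simp only: of_real_eq_0_iff)
  then have "\<forall>g\<in>G. f g = 0"
    by (subst (asm) sum_nonneg_eq_0_iff) (auto simp: finite_G)
  then show "f g = 0 g" using f by (cases "g \<in> G") (auto simp: Inv_iff)
qed

text \<open>On invariant functions \<open>T\<close> is, up to the factor \<open>card skews\<close>, the compression of translation by
  the involution \<open>Jmat n\<close>.\<close>
lemma inn_T_left:
  assumes "h \<in> Inv"
  shows "inn (T f) h = of_nat (card skews) * (\<Sum>g\<in>G. f (Jmat n * g) * cnj (h g))"
proof -
  have "inn (T f) h = (\<Sum>B\<in>skews. \<Sum>g\<in>G. f (Jmat n * unip B * g) * cnj (h g))"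
    unfolding inn_def by (simp add: T_eq sum_distrib_right sum.swap[of _ skews])
  also have "\<dots> = (\<Sum>B\<in>skews. \<Sum>g\<in>G. f (Jmat n * g) * cnj (h g))"
  proof (rule sum.cong[OF refl])
    fix B assume B: "B \<in> skews"
    have "(\<Sum>g\<in>G. f (Jmat n * unip B * g) * cnj (h g))
        = (\<Sum>g\<in>G. f (Jmat n * (unip B * g)) * cnj (h (unip B * g)))"
      using B assms unip_P[OF B] unip_G[OF B]
      by (intro sum.cong) (auto simp: Inv_iff mult_assoc G_carrier)
    also have "\<dots> = (\<Sum>g\<in>G. f (Jmat n * g) * cnj (h g))"
      by (rule sum.reindex_bij_betw[OF bij_left_mult[OF unip_G[OF B]]])
    finally show "(\<Sum>g\<in>G. f (Jmat n * unip B * g) * cnj (h g)) = (\<Sum>g\<in>G. f (Jmat n * g) * cnj (h g))" .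
  qed
  finally show ?thesis by simp
qed

lemma inn_T_sym:
  assumes "f \<in> Inv" "h \<in> Inv"
  shows "inn (T f) h = inn f (T h)"
proof -
  have cnj_swap: "inn f (T h) = cnj (inn (T h) f)" by (simp add: inn_def mult.commute)
  have "(\<Sum>g\<in>G. f (Jmat n * g) * cnj (h g)) = (\<Sum>g\<in>G. f (Jmat n * (Jmat n * g)) * cnj (h (Jmat n * g)))"
    by (rule sum.reindex_bij_betw[OF bij_left_mult[OF Jmat_G], symmetric])
  also have "\<dots> = (\<Sum>g\<in>G. f g * cnj (h (Jmat n * g)))"
  proof (rule sum.cong[OF refl])
    fix g assume "g \<in> G"
    then have "Jmat n * (Jmat n * g) = g"
      using assoc_mult_mat[of "Jmat n" "2 * n" "2 * n" "Jmat n" "2 * n" g "2 * n"] G_carrier[of g]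
      by (simp add: Jmat_sq left_mult_one_mat[of _ "2 * n" "2 * n"])
    then show "f (Jmat n * (Jmat n * g)) * cnj (h (Jmat n * g)) = f g * cnj (h (Jmat n * g))" by simp
  qed
  finally show ?thesis
    unfolding cnj_swap inn_T_left[OF assms(1)] inn_T_left[OF assms(2)] by (simp add: mult.commute)
qed

lemma T_Inv: "f \<in> Inv \<Longrightarrow> T f \<in> Inv"
  using T_Filt[of f "Suc n"] by (simp add: Filt_eq_Inv)

text \<open>For an eigenvalue \<open>c\<close> that is real, the image of \<open>T - c\<close> is orthogonal to its kernel.\<close>
lemma T_semisimple:
  assumes f: "f \<in> Inv" and c: "cnj c = c"
    and e: "T (T f - fscale c f) = fscale c (T f - fscale c f)"
  shows "T f = fscale c f"
proof -
  let ?e = "T f - fscale c f"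
  have eI: "?e \<in> Inv" by (intro cfun.subspace_diff[OF subspace_Inv] cfun.subspace_scale[OF subspace_Inv] T_Inv f)
  have "inn ?e ?e = inn f (T ?e) - c * inn f ?e"
    by (simp only: inn_diff inn_fscale inn_T_sym[OF f eI])
  also have "\<dots> = 0" unfolding e inn_fscale c by simp
  finally have "?e = 0" using inn_self_zero[OF eI] by simp
  then show ?thesis by simp
qed

lemma cnj_mu: "cnj (mu k) = mu k"
  unfolding mu_def by (simp add: q)

lemma Filt_0: "Filt 0 = {0}"
  by (simp add: Filt_def)

lemma Inv_splits:
  assumes "f \<in> Inv"
  shows "\<exists>h. (\<forall>k<Suc n. h k \<in> Inv \<and> T (h k) = fscale (mu k) (h k)) \<and> f = (\<Sum>k<Suc n. h k)"
proof -
  have "\<exists>h. (\<forall>j<Suc n. h j \<in> Filt (Suc j) \<and> T (h j) = fscale (mu j) (h j)) \<and> f = (\<Sum>j<Suc n. h j)"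
    by (rule triangular_splitting[OF T_linear subspace_Filt, where m = "Suc n" and mu = mu])
       (use assms Filt_mono Filt_triangular T_semisimple cnj_mu in \<open>auto simp: Filt_0 Filt_eq_Inv\<close>)
  then obtain h where h: "\<forall>j<Suc n. h j \<in> Filt (Suc j) \<and> T (h j) = fscale (mu j) (h j)"
    "f = (\<Sum>j<Suc n. h j)" by blast
  have "h k \<in> Inv" if "k < Suc n" for k
    using h(1) that Filt_mono[of "Suc k" "Suc n"] Filt_eq_Inv by auto
  then show ?thesis using h by blast
qed

text \<open>An eigenvector for any other value would be orthogonal to all \<open>h k\<close>, hence to itself.\<close>
lemma eigenvalue_cases:
  assumes f: "f \<in> Inv" "f \<noteq> 0" "T f = fscale c f"
  shows "\<exists>k\<le>n. c = mu k"
proof (rule ccontr)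
  assume no: "\<not> ?thesis"
  obtain h where h: "\<forall>k<Suc n. h k \<in> Inv \<and> T (h k) = fscale (mu k) (h k)" "f = (\<Sum>k<Suc n. h k)"
    using Inv_splits[OF f(1)] by blast
  have "inn f (h k) = 0" if k: "k < Suc n" for k
  proof -
    have hk: "h k \<in> Inv" "T (h k) = fscale (mu k) (h k)" using h(1) k by auto
    have "c * inn f (h k) = mu k * inn f (h k)"
      using inn_T_sym[OF f(1) hk(1)] unfolding f(3) hk(2) inn_fscale cnj_mu .
    then show ?thesis using no k by (auto simp: less_Suc_eq_le)
  qed
  then have "inn f f = 0" by (subst (2) h(2)) (simp add: inn_sum_right del: sum.lessThan_Suc)
  then show False using inn_self_zero[OF f(1)] f(2) by simp
qed

section \<open>Bi-invariant functions as polynomials\<close>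

text \<open>The order of the intersection of \<open>L\<^sub>g\<close> with the standard isotropic subspace. It determines the double
  coset of \<open>g\<close>, so bi-invariant functions will be polynomials in it.\<close>
definition Kg :: "'a mat \<Rightarrow> nat" where
  "Kg g = card {v \<in> Vn n. yg g v = 0}"

definition Phi :: "complex poly \<Rightarrow> 'a mat \<Rightarrow> complex" where
  "Phi p = (\<lambda>g. if g \<in> G then poly p (of_nat (Kg g)) else 0)"

text \<open>The polynomials of degree less than \<open>k\<close>, written so that the zero polynomial needs no exception.\<close>
definition polys :: "nat \<Rightarrow> complex poly set" where
  "polys k = {p. \<forall>i\<ge>k. coeff p i = 0}"

definition Eqv :: "('a mat \<Rightarrow> complex) set" where
  "Eqv = Ind_eqv G n (\<lambda>_. 1)"

lemma Eqv_iff: "f \<in> Eqv \<longleftrightarrow> f \<in> Inv \<and> (\<forall>p\<in>P. \<forall>g\<in>G. f (g * p) = f g)"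
  by (simp add: Eqv_def Ind_eqv_def Inv_def)

lemma Phi_ops: "Phi (p + r) = Phi p + Phi r" "Phi (p - r) = Phi p - Phi r" "Phi (smult c p) = fscale c (Phi p)"
  "Phi 0 = 0"
  by (auto simp: Phi_def fun_eq_iff fscale_apply)

lemma Phi_sum: "Phi (\<Sum>i\<in>A. p i) = (\<Sum>i\<in>A. Phi (p i))"
  by (induction A rule: infinite_finite_induct) (auto simp: Phi_ops)

lemma Kg_left: "p \<in> P \<Longrightarrow> g \<in> G \<Longrightarrow> Kg (p * g) = Kg g"
  by (simp add: Kg_def hi_act_P)

lemma Kg_right: "p \<in> P \<Longrightarrow> g \<in> G \<Longrightarrow> Kg (g * p) = Kg g"
proof -
  assume p: "p \<in> P" and g: "g \<in> G"
  have im: "act p ` {v \<in> Vn n. yg (g * p) v = 0} = {v \<in> Vn n. yg g v = 0}"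
  proof -
    have e: "yg (g * p) v = yg g (act p v)" for v
      using p g by (simp only: act_mult[of _ "2 * n" "2 * n" _ "2 * n"] G_carrier P_G)
    have "act p ` {v \<in> Vn n. yg g (act p v) = 0} = {w \<in> act p ` Vn n. yg g w = 0}" by blast
    then show ?thesis unfolding e act_P_Vn_eq(1)[OF p] .
  qed
  have "inj_on (act p) {v \<in> Vn n. yg (g * p) v = 0}"
    using act_P_Vn_eq(2)[OF p] by (rule inj_on_subset) blast
  from card_image[OF this] show ?thesis unfolding Kg_def im by (rule sym)
qed

lemma Phi_Eqv: "Phi p \<in> Eqv"
  using Kg_left Kg_right mult_G P_G by (auto simp: Eqv_iff Inv_iff Phi_def)

lemma Eqv_subset_Inv: "Eqv \<subseteq> Inv"
  by (auto simp: Eqv_iff)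

text \<open>Summing \<open>incid vs\<close> over all independent \<open>k\<close>-tuples of the standard isotropic subspace counts the
  independent tuples of its intersection with the subspace attached to \<open>g\<close>. Applying \<open>T\<close> counts
  instead the tuples independent modulo that intersection.\<close>
lemma T_Phi_product:
  assumes "k \<le> n"
  shows "T (Phi (\<Prod>i<k. [:- (q ^ i), 1:])) = fscale (q ^ ((n - k) choose 2)) (Phi (\<Prod>i<k. [:q ^ n, - (q ^ i):]))"
proof -
  let ?L = "{vs. set vs \<subseteq> Vn n \<and> length vs = k \<and> lind vs} :: (nat \<Rightarrow> 'a) list set"
  have fin: "finite ?L"
    by (rule finite_subset[OF _ finite_lists_length_eq[OF finite_Vn, of n k]]) auto
  have "fv_linear (\<lambda>v. v)" by (rule fv_linearI) auto
  note cnt1 = card_lind_tuples[OF this]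
  have 1: "Phi (\<Prod>i<k. [:- (q ^ i), 1:]) = (\<Sum>vs\<in>?L. incid vs)"
  proof
    fix g
    show "Phi (\<Prod>i<k. [:- (q ^ i), 1:]) g = (\<Sum>vs\<in>?L. incid vs) g"
    proof (cases "g \<in> G")
      case True
      let ?W = "{v \<in> Vn n. yg g v = 0}"
      have W: "fv.subspace ?W" "finite ?W"
        using fv.subspace_inter[OF subspace_Vn[of n] subspace_kernel[OF yg_linear]] finite_Vn[of n]
        by (auto simp: Int_def)
      have zero: "{w \<in> ?W. w = 0} = {0}" using fv.subspace_0[OF W(1)] by auto
      have "(\<Sum>vs\<in>?L. incid vs) g = (\<Sum>vs\<in>?L. of_bool (\<forall>v\<in>set vs. yg g v = 0))"
        using True by (simp add: sum_fun_apply incid_def)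
      also have "\<dots> = of_nat (card {vs \<in> ?L. \<forall>v\<in>set vs. yg g v = 0})"
        using fin by (simp add: of_bool_def sum.If_cases Int_def)
      also have "{vs \<in> ?L. \<forall>v\<in>set vs. yg g v = 0} = {vs. set vs \<subseteq> ?W \<and> length vs = k \<and> lind (map (\<lambda>v. v) vs)}"
        by auto
      also have "of_nat (card \<dots>) = (\<Prod>i<k. of_nat (card ?W) - of_nat (card {w \<in> ?W. w = 0}) * of_nat CARD('a) ^ i :: complex)"
        by (rule cnt1[OF W])
      also have "\<dots> = Phi (\<Prod>i<k. [:- (q ^ i), 1:]) g"
        unfolding zero using True by (simp add: Phi_def poly_prod Kg_def q)
      finally show ?thesis ..
    qed (simp add: Phi_def sum_fun_apply incid_def)
  qed
  have 2: "(\<Sum>vs\<in>?L. transv vs) = Phi (\<Prod>i<k. [:q ^ n, - (q ^ i):])"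
  proof
    fix g
    show "(\<Sum>vs\<in>?L. transv vs) g = Phi (\<Prod>i<k. [:q ^ n, - (q ^ i):]) g"
    proof (cases "g \<in> G")
      case True
      have "(\<Sum>vs\<in>?L. transv vs) g = (\<Sum>vs\<in>?L. of_bool (lind (map (yg g) vs)))"
        using True by (simp add: sum_fun_apply transv_def)
      also have "\<dots> = of_nat (card {vs \<in> ?L. lind (map (yg g) vs)})"
        using fin by (simp add: of_bool_def sum.If_cases Int_def)
      also have "{vs \<in> ?L. lind (map (yg g) vs)} = {vs. set vs \<subseteq> Vn n \<and> length vs = k \<and> lind (map (yg g) vs)}"
        using lind_map_imp_lind[OF yg_linear] by auto
      also have "of_nat (card \<dots>) = (\<Prod>i<k. of_nat (card (Vn n :: (nat \<Rightarrow> 'a) set))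
          - of_nat (card {w \<in> Vn n. yg g w = 0}) * of_nat CARD('a) ^ i :: complex)"
        by (rule card_lind_tuples[OF yg_linear subspace_Vn finite_Vn])
      also have "\<dots> = Phi (\<Prod>i<k. [:q ^ n, - (q ^ i):]) g"
        using True by (simp add: Phi_def poly_prod Kg_def q card_Vn algebra_simps)
      finally show ?thesis .
    qed (simp add: Phi_def sum_fun_apply transv_def)
  qed
  have iso: "bform n v w = 0" if "v \<in> Vn n" "w \<in> Vn n" for v w :: "nat \<Rightarrow> 'a"
  proof -
    have "hi n v = 0" "hi n w = 0" using that by (auto simp: hi_def Vn_def fun_eq_iff)
    then show ?thesis by (simp add: bform_def dot_zero)
  qed
  have "T (Phi (\<Prod>i<k. [:- (q ^ i), 1:])) = (\<Sum>vs\<in>?L. fscale (q ^ ((n - k) choose 2)) (transv vs))"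
    unfolding 1 T.sum
  proof (rule sum.cong[OF refl])
    fix vs assume vs: "vs \<in> ?L"
    have "set vs \<subseteq> V2" using vs Vn_mono[of n "2 * n", where 'a = 'a] by auto
    then show "T (incid vs) = fscale (q ^ ((n - k) choose 2)) (transv vs)"
      using T_incid[of vs] vs iso by blast
  qed
  then show ?thesis unfolding 2[symmetric] cfun.scale_sum_right .
qed

lemma polys_mult_linear:
  assumes "p \<in> polys (Suc k)"
  shows "p * [:a, b:] \<in> polys (Suc (Suc k)) \<and> coeff (p * [:a, b:]) (Suc k) = b * coeff p k"
proof -
  have c: "coeff (p * [:a, b:]) (Suc i) = a * coeff p (Suc i) + b * coeff p i" for i
    by (simp add: mult_pCons_right algebra_simps)
  have "coeff (p * [:a, b:]) i = 0" if "i \<ge> Suc (Suc k)" for i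
    using that assms c[of "i - 1"] by (cases i) (auto simp: polys_def)
  then show ?thesis using assms c[of k] by (auto simp: polys_def)
qed

lemma polys_prod_linear:
  "(\<Prod>i<k. [:a i, b i:]) \<in> polys (Suc k) \<and> coeff (\<Prod>i<k. [:a i, b i:]) k = (\<Prod>i<k. b i)"
proof (induction k)
  case (Suc k)
  then show ?case using polys_mult_linear[of "\<Prod>i<k. [:a i, b i:]" k "a k" "b k"] by (simp add: mult.commute)
qed (simp add: polys_def coeff_1)

lemma prod_neg_powers: "(\<Prod>i<k. - (q ^ i)) = (- 1) ^ k * q ^ (k choose 2)"
  by (induction k) (simp_all add: numeral_2_eq_2 power_add)

lemma polys_closed: "p \<in> polys k \<Longrightarrow> r \<in> polys k \<Longrightarrow> p + r \<in> polys k"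
  "p \<in> polys k \<Longrightarrow> r \<in> polys k \<Longrightarrow> p - r \<in> polys k" "p \<in> polys k \<Longrightarrow> smult c p \<in> polys k" "0 \<in> polys k"
  by (auto simp: polys_def)

lemma polys_mono: "j \<le> k \<Longrightarrow> polys j \<subseteq> polys k"
  by (auto simp: polys_def)

lemma polys_reduce:
  assumes "p \<in> polys (Suc k)" "r \<in> polys (Suc k)" "coeff r k = 1"
  shows "p - smult (coeff p k) r \<in> polys k"
proof -
  have "coeff p i - coeff p k * coeff r i = 0" if "i \<ge> k" for i
  proof (cases "i = k")
    case False
    then have "coeff p i = 0" "coeff r i = 0" using assms(1,2) that by (auto simp: polys_def)
    then show ?thesis by simp
  qed (simp add: assms(3))
  then show ?thesis unfolding polys_def mem_Collect_eq coeff_diff coeff_smult by blast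
qed

text \<open>By \<open>T_Phi_product\<close> the polynomial \<open>\<Prod>i<k. X - q ^ i\<close>, monic of degree \<open>k\<close>, goes to one of the same degree, whose
  leading coefficient is \<open>mu k\<close>.\<close>
lemma Phi_polys_triangular:
  assumes "k \<le> n" "p \<in> polys (Suc k)"
  shows "T (Phi p) - fscale (mu k) (Phi p) \<in> Phi ` polys k"
  using assms
proof (induction k arbitrary: p)
  case k: 0
  have "smult (coeff p 0) 1 = p"
    using k by (intro poly_eqI) (auto simp: polys_def coeff_pCons split: nat.splits)
  then have p: "Phi p = fscale (coeff p 0) (Phi 1)" by (metis Phi_ops(3))
  have T1: "T (Phi 1) = fscale (mu 0) (Phi 1)"
    using T_Phi_product[of 0] by (simp add: mu_def binomial_eq_0)
  have "T (Phi p) - fscale (mu 0) (Phi p) = 0"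
    unfolding p T.scale T1
    by (simp only: cfun.scale_scale mult.commute diff_self)
  moreover have "Phi 0 \<in> Phi ` polys 0" by (intro imageI polys_closed)
  ultimately show ?case by (metis Phi_ops(4))
next
  case (Suc k)
  let ?P = "\<Prod>i<Suc k. [:- (q ^ i), 1:]" and ?Q = "\<Prod>i<Suc k. [:q ^ n, - (q ^ i):]"
  let ?m = "mu (Suc k)" and ?c = "q ^ ((n - Suc k) choose 2)"
  have P: "?P \<in> polys (Suc (Suc k))" "coeff ?P (Suc k) = 1" and Q: "?Q \<in> polys (Suc (Suc k))"
    "coeff ?Q (Suc k) = (- 1) ^ Suc k * q ^ (Suc k choose 2)"
    using polys_prod_linear[of "\<lambda>i. - (q ^ i)" "\<lambda>_. 1" "Suc k"] polys_prod_linear[of "\<lambda>_. q ^ n" "\<lambda>i. - (q ^ i)" "Suc k"]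
      prod_neg_powers[of "Suc k"] by (simp_all del: prod.lessThan_Suc)
  define r where "r = p - smult (coeff p (Suc k)) ?P"
  have r: "r \<in> polys (Suc k)" unfolding r_def by (rule polys_reduce[OF Suc.prems(2) P])
  obtain s where s: "s \<in> polys k" "T (Phi r) - fscale (mu k) (Phi r) = Phi s"
    using Suc.IH[OF Suc_leD[OF Suc.prems(1)] r] by blast
  have Tr: "T (Phi r) = Phi (s + smult (mu k) r)"
    using s(2) by (simp add: Phi_ops algebra_simps)
  have r1: "s + smult (mu k) r - smult ?m r \<in> polys (Suc k)"
    using r s(1) polys_mono[of k "Suc k"] by (intro polys_closed) auto
  have r2: "smult ?c (?Q - smult (coeff ?Q (Suc k)) ?P) \<in> polys (Suc k)"
    by (intro polys_closed(3) polys_reduce[OF Q(1) P])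
  have m: "?m = ?c * coeff ?Q (Suc k)" unfolding Q(2) mu_def by (simp add: power_add)
  have TP: "T (Phi ?P) - fscale ?m (Phi ?P) = Phi (smult ?c (?Q - smult (coeff ?Q (Suc k)) ?P))"
    unfolding T_Phi_product[OF Suc.prems(1)] Phi_ops m
    by (simp add: cfun.scale_right_diff_distrib del: prod.lessThan_Suc)
  have p: "p = smult (coeff p (Suc k)) ?P + r" by (simp add: r_def)
  have "T (Phi p) - fscale ?m (Phi p)
      = fscale (coeff p (Suc k)) (T (Phi ?P) - fscale ?m (Phi ?P)) + (T (Phi r) - fscale ?m (Phi r))"
    by (subst (1 2) p) (simp add: Phi_ops T.add T.scale fun_eq_iff fscale_apply algebra_simps del: prod.lessThan_Suc)
  also have "\<dots> = Phi (smult (coeff p (Suc k)) (smult ?c (?Q - smult (coeff ?Q (Suc k)) ?P))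
      + (s + smult (mu k) r - smult ?m r))"
    unfolding TP Tr by (simp only: Phi_ops)
  also have "\<dots> \<in> Phi ` polys (Suc k)"
    by (intro imageI polys_closed(1)[OF polys_closed(3)[OF r2] r1])
  finally show ?case .
qed

text \<open>Splitting the monomial of degree \<open>k\<close> along the degree filtration, its top component is an eigenvector
  with the same leading term.\<close>
lemma Phi_eigen:
  assumes "k \<le> n"
  shows "\<exists>p\<in>polys (Suc k). coeff p k = 1 \<and> T (Phi p) = fscale (mu k) (Phi p)"
proof -
  have sub: "cfun.subspace (Phi ` polys j)" for j
  proof (rule cfun.subspaceI)
    show "0 \<in> Phi ` polys j" by (rule image_eqI[of _ Phi 0]) (simp_all add: Phi_ops polys_closed)
  next
    fix x y assume "x \<in> Phi ` polys j" "y \<in> Phi ` polys j"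
    then show "x + y \<in> Phi ` polys j" using polys_closed(1) by (auto simp: Phi_ops(1)[symmetric])
  next
    fix c x assume "x \<in> Phi ` polys j"
    then show "fscale c x \<in> Phi ` polys j" using polys_closed(3) by (auto simp: Phi_ops(3)[symmetric])
  qed
  have "\<exists>h. (\<forall>j<Suc k. h j \<in> Phi ` polys (Suc j) \<and> T (h j) = fscale (mu j) (h j)) \<and> Phi (monom 1 k) = (\<Sum>j<Suc k. h j)"
  proof (rule triangular_splitting[OF T_linear sub, where m = "Suc n" and mu = mu])
    have "p \<in> polys 0 \<Longrightarrow> p = 0" for p by (intro poly_eqI) (simp add: polys_def)
    then have "polys 0 \<subseteq> {0}" by blast
    then show "Phi ` polys 0 \<subseteq> {0}" using Phi_ops(4) by blast
    show "Phi ` polys i \<subseteq> Phi ` polys j" if "i \<le> j" for i j using polys_mono[OF that] by auto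
    show "T f - fscale (mu i) f \<in> Phi ` polys i" if "i < Suc n" "f \<in> Phi ` polys (Suc i)" for i f
      using that Phi_polys_triangular by auto
    show "T f = fscale (mu i) f"
      if "f \<in> Phi ` polys (Suc n)" "T (T f - fscale (mu i) f) = fscale (mu i) (T f - fscale (mu i) f)" for i f
      using that T_semisimple[OF _ cnj_mu] Phi_Eqv Eqv_subset_Inv by auto
    show "Suc k \<le> Suc n" using assms by simp
    show "Phi (monom 1 k) \<in> Phi ` polys (Suc k)" by (intro imageI) (simp add: polys_def)
  qed
  then obtain h where h: "\<And>j. j < Suc k \<Longrightarrow> h j \<in> Phi ` polys (Suc j)" "T (h k) = fscale (mu k) (h k)"
    "Phi (monom 1 k) = (\<Sum>j<Suc k. h j)" by auto
  have "(\<Sum>j<k. h j) \<in> Phi ` polys k"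
  proof (intro cfun.subspace_sum[OF sub])
    fix j assume "j \<in> {..<k}"
    then show "h j \<in> Phi ` polys k" using h(1)[of j] polys_mono[of "Suc j" k] by auto
  qed
  then obtain r where r: "r \<in> polys k" "(\<Sum>j<k. h j) = Phi r" by auto
  have "h k = Phi (monom 1 k - r)" using h(3) r(2) by (simp add: Phi_ops algebra_simps)
  moreover have "monom 1 k - r \<in> polys (Suc k)" "coeff (monom 1 k - r) k = 1"
    using r(1) by (auto simp: polys_def)
  ultimately show ?thesis using h(2) by metis
qed

end

section \<open>Elimination and double cosets\<close>

definition rank_one :: "nat \<Rightarrow> (nat \<Rightarrow> 'a::field) \<Rightarrow> (nat \<Rightarrow> 'a) \<Rightarrow> 'a mat" where
  "rank_one n c d = mat n n (\<lambda>(i, j). c i * d j)"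

definition scaling :: "nat \<Rightarrow> nat \<Rightarrow> 'a::field \<Rightarrow> 'a mat" where
  "scaling n k a = mat n n (\<lambda>(i, j). if i = j then if i = k then a else 1 else 0)"

definition coord_proj :: "nat \<Rightarrow> nat set \<Rightarrow> 'a::field mat" where
  "coord_proj n S = mat n n (\<lambda>(i, j). if i = j \<and> i \<in> S then 1 else 0)"

abbreviation unit_blocks :: "nat \<Rightarrow> nat \<Rightarrow> 'a::field mat" where
  "unit_blocks n r \<equiv> coord_proj n {..<r}"

lemma coord_proj_carrier [simp]: "coord_proj n S \<in> carrier_mat n n"
  by (simp add: coord_proj_def)

lemma coord_proj_dim [simp]: "dim_row (coord_proj n S) = n" "dim_col (coord_proj n S) = n"
  by (simp_all add: coord_proj_def)

lemma coord_proj_transpose [simp]: "transpose_mat (coord_proj n S) = coord_proj n S"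
  by (rule eq_matI) (auto simp: coord_proj_def)

lemma act_coord_proj: "act (coord_proj n S) v = (\<lambda>i. if i < n \<and> i \<in> S then v i else 0)"
proof
  fix i
  have "(\<Sum>j<n. coord_proj n S $$ (i, j) * v j) = (\<Sum>j<n. if j = i then (if i \<in> S then v i else 0) else 0)" if "i < n"
    using that by (intro sum.cong) (auto simp: coord_proj_def)
  then show "act (coord_proj n S) v i = (if i < n \<and> i \<in> S then v i else 0)"
    by (simp add: act_def carrier_matD[OF coord_proj_carrier])
qed

lemma coord_proj_mult: "coord_proj n S * coord_proj n S' = coord_proj n (S \<inter> S')"
  by (rule mat_eq_iff_act[of _ n n])
     (auto simp: act_mult[of _ n n _ n] act_coord_proj fun_eq_iff)

lemma coord_proj_ops: "coord_proj n {} = 0\<^sub>m n n" "coord_proj n {..<r} + coord_proj n {r..} = 1\<^sub>m n"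
  "coord_proj n {r..} + coord_proj n {..<r} = 1\<^sub>m n"
  "{..<r} \<inter> {r..} = {}" "{r..} \<inter> {..<r} = {}"
  by (auto intro!: eq_matI simp: coord_proj_def)

lemma mult_coord_proj_right:
  assumes "m \<in> carrier_mat n n" "i < n" "j < n"
  shows "(m * coord_proj n S) $$ (i, j) = (if j \<in> S then m $$ (i, j) else 0)"
proof -
  have "(m * coord_proj n S) $$ (i, j) = (\<Sum>k<n. m $$ (i, k) * coord_proj n S $$ (k, j))"
    using assms by (simp add: scalar_prod_def atLeast0LessThan coord_proj_def)
  also have "\<dots> = (\<Sum>k<n. if k = j then (if j \<in> S then m $$ (i, j) else 0) else 0)"
    using assms by (intro sum.cong) (auto simp: coord_proj_def)
  finally have "(m * coord_proj n S) $$ (i, j) = (\<Sum>k<n. if k = j then (if j \<in> S then m $$ (i, j) else 0) else 0)" .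
  then show ?thesis using assms by simp
qed

lemma mult_coord_proj_left:
  assumes "m \<in> carrier_mat n n" "i < n" "j < n"
  shows "(coord_proj n S * m) $$ (i, j) = (if i \<in> S then m $$ (i, j) else 0)"
proof -
  have "(coord_proj n S * m) $$ (i, j) = (\<Sum>k<n. coord_proj n S $$ (i, k) * m $$ (k, j))"
    using assms by (simp add: scalar_prod_def atLeast0LessThan coord_proj_def)
  also have "\<dots> = (\<Sum>k<n. if k = i then (if i \<in> S then m $$ (i, j) else 0) else 0)"
    using assms by (intro sum.cong) (auto simp: coord_proj_def)
  finally have "(coord_proj n S * m) $$ (i, j) = (\<Sum>k<n. if k = i then (if i \<in> S then m $$ (i, j) else 0) else 0)" .
  then show ?thesis using assms by simp
qed

text \<open>Square-zero perturbations of the identity instead of elementary row operations: a homomorphism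
  to \<open>{1, -1}\<close> kills them, because \<open>1 + c = (1 + c / 2)\<^sup>2\<close> when \<open>c\<^sup>2 = 0\<close>.\<close>
inductive_set elem_gen :: "nat \<Rightarrow> 'a::field mat set" for n where
  one_plus: "c \<in> carrier_mat n n \<Longrightarrow> c * c = 0\<^sub>m n n \<Longrightarrow> 1\<^sub>m n + c \<in> elem_gen n"
| scaling: "k < n \<Longrightarrow> a \<noteq> 0 \<Longrightarrow> scaling n k a \<in> elem_gen n"
| mult: "x \<in> elem_gen n \<Longrightarrow> y \<in> elem_gen n \<Longrightarrow> x * y \<in> elem_gen n"

lemma elem_gen_carrier: "x \<in> elem_gen n \<Longrightarrow> x \<in> carrier_mat n n"
  by (induction rule: elem_gen.induct) (auto simp: scaling_def)

lemma rank_one_sq: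
  assumes "(\<Sum>i<n. c i * d i) = 0"
  shows "rank_one n c d * rank_one n c d = 0\<^sub>m n n"
proof (rule eq_matI)
  fix i j assume "i < dim_row (0\<^sub>m n n :: 'a mat)" "j < dim_col (0\<^sub>m n n :: 'a mat)"
  then have ij: "i < n" "j < n" by auto
  then have "(rank_one n c d * rank_one n c d) $$ (i, j) = (\<Sum>k<n. c i * d k * (c k * d j))"
    by (simp add: rank_one_def scalar_prod_def atLeast0LessThan)
  also have "\<dots> = c i * d j * (\<Sum>k<n. c k * d k)" by (simp add: sum_distrib_left ac_simps)
  finally show "(rank_one n c d * rank_one n c d) $$ (i, j) = 0\<^sub>m n n $$ (i, j)" using ij assms by simp
qed (auto simp: rank_one_def)

lemma elem_gen_rank_one: "(\<Sum>i<n. c i * d i) = 0 \<Longrightarrow> 1\<^sub>m n + rank_one n c d \<in> elem_gen n"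
  by (intro elem_gen.one_plus rank_one_sq) (auto simp: rank_one_def)

lemma elem_gen_one: "1\<^sub>m n \<in> elem_gen n"
  using elem_gen.one_plus[of "0\<^sub>m n n" n] by simp

lemma rank_one_left:
  assumes "m \<in> carrier_mat n n" "i < n" "j < n"
  shows "((1\<^sub>m n + rank_one n c d) * m) $$ (i, j) = m $$ (i, j) + c i * (\<Sum>k<n. d k * m $$ (k, j))"
proof -
  have r: "rank_one n c d \<in> carrier_mat n n" by (simp add: rank_one_def)
  have "(1\<^sub>m n + rank_one n c d) * m = m + rank_one n c d * m"
    using assms(1) r by (simp add: add_mult_distrib_mat[of _ n n _ _ n])
  then show ?thesis
    using assms by (simp add: rank_one_def scalar_prod_def atLeast0LessThan sum_distrib_left ac_simps)
qed

lemma rank_one_right: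
  assumes "m \<in> carrier_mat n n" "i < n" "j < n"
  shows "(m * (1\<^sub>m n + rank_one n c d)) $$ (i, j) = m $$ (i, j) + (\<Sum>k<n. m $$ (i, k) * c k) * d j"
proof -
  have r: "rank_one n c d \<in> carrier_mat n n" by (simp add: rank_one_def)
  have "m * (1\<^sub>m n + rank_one n c d) = m + m * rank_one n c d"
    using assms(1) r by (simp add: mult_add_distrib_mat[of _ n n _ n])
  then show ?thesis
    using assms by (simp add: rank_one_def scalar_prod_def atLeast0LessThan sum_distrib_right sum_distrib_left ac_simps)
qed

lemma scaling_left:
  assumes "m \<in> carrier_mat n n" "i < n" "j < n"
  shows "(scaling n k a * m) $$ (i, j) = (if i = k then a else 1) * m $$ (i, j)"
proof -
  have "(scaling n k a * m) $$ (i, j) = (\<Sum>l<n. (if i = l then if i = k then a else 1 else 0) * m $$ (l, j))"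
    using assms by (simp add: scaling_def scalar_prod_def atLeast0LessThan)
  also have "\<dots> = (\<Sum>l<n. if i = l then (if i = k then a else 1) * m $$ (l, j) else 0)"
    by (intro sum.cong) auto
  finally show ?thesis using assms by simp
qed

definition reduced :: "nat \<Rightarrow> nat \<Rightarrow> 'a::field mat \<Rightarrow> bool" where
  "reduced n k m \<longleftrightarrow> m \<in> carrier_mat n n \<and>
     (\<forall>i<n. \<forall>j<n. i < k \<or> j < k \<longrightarrow> m $$ (i, j) = (if i = j then 1 else 0))"

lemma sum_indicator: "k < n \<Longrightarrow> (\<Sum>i<n. (if i = k then 1 else 0) * f i) = f k"
  "k < n \<Longrightarrow> (\<Sum>i<n. f i * (if i = k then 1 else 0)) = f k" for f :: "nat \<Rightarrow> 'a::field"
  by (simp_all add: if_distrib[of "\<lambda>x. x * _"] if_distrib[of "\<lambda>x. _ * x"] cong: if_cong)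

text \<open>One step of Gaussian elimination with row and column operations.\<close>
lemma reduced_step:
  assumes m: "reduced n k m" and nz: "i < n" "j < n" "k \<le> i" "k \<le> j" "m $$ (i, j) \<noteq> 0"
  shows "\<exists>x\<in>elem_gen n. \<exists>y\<in>elem_gen n. reduced n (Suc k) (x * m * y)"
proof -
  let ?e = "\<lambda>k l. if l = k then 1 else 0 :: 'a"
  have k: "k < n" using nz by simp
  have mc: "m \<in> carrier_mat n n" and mr: "\<And>a b. a < n \<Longrightarrow> b < n \<Longrightarrow> a < k \<or> b < k \<Longrightarrow> m $$ (a, b) = (if a = b then 1 else 0)"
    using m by (auto simp: reduced_def)
  \<comment> \<open>Rows are added instead of exchanged, because exchanges are not among the generators.\<close>
  obtain x1 j1 where x1: "x1 \<in> elem_gen n" "reduced n k (x1 * m)" "j1 < n" "k \<le> j1" "(x1 * m) $$ (k, j1) \<noteq> 0"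
  proof (cases "\<exists>l. l < n \<and> k \<le> l \<and> m $$ (k, l) \<noteq> 0")
    case True
    then show ?thesis using that[of "1\<^sub>m n"] elem_gen_one m mc by auto
  next
    case False
    then have ik: "i \<noteq> k" using nz by auto
    let ?x = "1\<^sub>m n + rank_one n (?e k) (?e i)"
    have ent: "(?x * m) $$ (a, b) = m $$ (a, b) + ?e k a * m $$ (i, b)" if "a < n" "b < n" for a b
      using rank_one_left[OF mc that] nz(1) by (simp add: sum_indicator)
    have "reduced n k (?x * m)"
      unfolding reduced_def
    proof (intro conjI allI impI)
      show "?x * m \<in> carrier_mat n n" by (intro square_mult_carrier mc) (simp add: rank_one_def)
      fix a b assume "a < n" "b < n" "a < k \<or> b < k"
      then show "(?x * m) $$ (a, b) = (if a = b then 1 else 0)"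
        unfolding ent[OF \<open>a < n\<close> \<open>b < n\<close>] using mr[of a b] mr[of i b] nz by auto
    qed
    moreover have "(?x * m) $$ (k, j) \<noteq> 0" using ent[OF k nz(2)] False nz by auto
    moreover have "?x \<in> elem_gen n" using ik k by (intro elem_gen_rank_one) (simp add: sum_indicator)
    ultimately show ?thesis using that nz by blast
  qed
  define m1 where "m1 = x1 * m"
  have m1: "m1 \<in> carrier_mat n n" "\<And>a b. a < n \<Longrightarrow> b < n \<Longrightarrow> a < k \<or> b < k \<Longrightarrow> m1 $$ (a, b) = (if a = b then 1 else 0)"
    "m1 $$ (k, j1) \<noteq> 0" using x1 by (auto simp: reduced_def m1_def)
  obtain y1 where y1: "y1 \<in> elem_gen n" "reduced n k (m1 * y1)" "(m1 * y1) $$ (k, k) \<noteq> 0"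
  proof (cases "m1 $$ (k, k) = 0")
    case False
    then show ?thesis using that[of "1\<^sub>m n"] elem_gen_one m1 by (auto simp: reduced_def)
  next
    case True
    then have jk: "j1 \<noteq> k" using m1 by auto
    let ?y = "1\<^sub>m n + rank_one n (?e j1) (?e k)"
    have ent: "(m1 * ?y) $$ (a, b) = m1 $$ (a, b) + m1 $$ (a, j1) * ?e k b" if "a < n" "b < n" for a b
      using rank_one_right[OF m1(1) that] x1(3) by (simp add: sum_indicator)
    have "reduced n k (m1 * ?y)"
      unfolding reduced_def
    proof (intro conjI allI impI)
      show "m1 * ?y \<in> carrier_mat n n" by (intro square_mult_carrier m1(1)) (simp add: rank_one_def)
      fix a b assume "a < n" "b < n" "a < k \<or> b < k"
      then show "(m1 * ?y) $$ (a, b) = (if a = b then 1 else 0)"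
        unfolding ent[OF \<open>a < n\<close> \<open>b < n\<close>] using m1(2)[of a b] m1(2)[of a j1] x1(3,4) by auto
    qed
    moreover have "(m1 * ?y) $$ (k, k) \<noteq> 0" using ent[OF k k] True m1(3) by simp
    moreover have "?y \<in> elem_gen n" using jk x1(3) by (intro elem_gen_rank_one) (simp add: sum_indicator)
    ultimately show ?thesis using that by blast
  qed
  define m2 where "m2 = m1 * y1"
  have m2: "m2 \<in> carrier_mat n n" "\<And>a b. a < n \<Longrightarrow> b < n \<Longrightarrow> a < k \<or> b < k \<Longrightarrow> m2 $$ (a, b) = (if a = b then 1 else 0)"
    "m2 $$ (k, k) \<noteq> 0" using y1 by (auto simp: reduced_def m2_def)
  define s where "s = scaling n k (inverse (m2 $$ (k, k)))"
  have s: "s \<in> elem_gen n" unfolding s_def using k m2(3) by (intro elem_gen.scaling) auto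
  define m3 where "m3 = s * m2"
  have m3c: "m3 \<in> carrier_mat n n" using elem_gen_carrier[OF s] m2(1) by (simp add: m3_def)
  have m3: "m3 $$ (a, b) = (if a = k then inverse (m2 $$ (k, k)) else 1) * m2 $$ (a, b)" if "a < n" "b < n" for a b
    using scaling_left[OF m2(1) that] by (simp add: m3_def s_def)
  have m3r: "m3 $$ (a, b) = (if a = b then 1 else 0)" if "a < n" "b < n" "a < k \<or> b < k" for a b
    using that m2 by (auto simp: m3)
  have m3k: "m3 $$ (k, k) = 1" using m2(3) k by (simp add: m3)
  let ?x = "1\<^sub>m n + rank_one n (\<lambda>a. if a = k then 0 else - m3 $$ (a, k)) (?e k)"
  have x: "?x \<in> elem_gen n" using k by (intro elem_gen_rank_one) (simp add: sum_indicator)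
  define m4 where "m4 = ?x * m3"
  have m4c: "m4 \<in> carrier_mat n n" using elem_gen_carrier[OF x] m3c unfolding m4_def by (rule square_mult_carrier)
  have m4: "m4 $$ (a, b) = m3 $$ (a, b) + (if a = k then 0 else - m3 $$ (a, k)) * m3 $$ (k, b)"
    if "a < n" "b < n" for a b
    using rank_one_left[OF m3c that] k by (simp add: m4_def sum_indicator)
  have m4r: "m4 $$ (a, b) = (if a = b then 1 else 0)" if "a < n" "b < n" "a < k \<or> b \<le> k" for a b
    using that m3r[of a b] m3r[of a k] m3r[of k b] m3k k by (cases "b = k") (auto simp: m4)
  let ?y = "1\<^sub>m n + rank_one n (?e k) (\<lambda>b. if b = k then 0 else - m4 $$ (k, b))"
  have y: "?y \<in> elem_gen n" using k by (intro elem_gen_rank_one) (simp add: sum_indicator)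
  have m5: "(m4 * ?y) $$ (a, b) = m4 $$ (a, b) + m4 $$ (a, k) * (if b = k then 0 else - m4 $$ (k, b))"
    if "a < n" "b < n" for a b
    using rank_one_right[OF m4c that] k by (simp add: sum_indicator)
  have red: "reduced n (Suc k) (m4 * ?y)"
    unfolding reduced_def
  proof (intro conjI allI impI)
    show "m4 * ?y \<in> carrier_mat n n" using m4c elem_gen_carrier[OF y] by (rule square_mult_carrier)
    fix a b assume ab: "a < n" "b < n" "a < Suc k \<or> b < Suc k"
    show "(m4 * ?y) $$ (a, b) = (if a = b then 1 else 0)"
      unfolding m5[OF ab(1,2)]
      using ab m4r[of a b] m4r[of a k] m4r[of k b] m4r[of k k] k by (cases "a = k"; cases "b = k") auto
  qed
  have "m4 * ?y = ?x * (s * (x1 * m * y1)) * ?y" by (simp add: m4_def m3_def m2_def m1_def)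
  also have "\<dots> = (?x * s * x1) * m * (y1 * ?y)"
    using elem_gen_carrier[OF x] elem_gen_carrier[OF y] elem_gen_carrier[OF s] elem_gen_carrier[OF x1(1)]
      elem_gen_carrier[OF y1(1)] mc
    by (simp add: assoc_mult_mat[of _ n n _ n _ n])
  finally have eq: "m4 * ?y = (?x * s * x1) * m * (y1 * ?y)" .
  have "?x * s * x1 \<in> elem_gen n" "y1 * ?y \<in> elem_gen n"
    using x y s x1(1) y1(1) by (simp_all only: elem_gen.mult)
  with red[unfolded eq] show ?thesis by blast
qed

lemma elimination:
  assumes "m \<in> carrier_mat n n"
  shows "\<exists>x\<in>elem_gen n. \<exists>y\<in>elem_gen n. \<exists>r\<le>n. x * m * y = unit_blocks n r"
proof -
  have step: "\<exists>x\<in>elem_gen n. \<exists>y\<in>elem_gen n. \<exists>r\<le>n. x * m * y = unit_blocks n r"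
    if "reduced n k m" "k \<le> n" for k and m :: "'a mat"
    using that
  proof (induction "n - k" arbitrary: k m rule: less_induct)
    case less
    have mc: "m \<in> carrier_mat n n" using less.prems by (simp add: reduced_def)
    show ?case
    proof (cases "\<exists>i j. i < n \<and> j < n \<and> k \<le> i \<and> k \<le> j \<and> m $$ (i, j) \<noteq> 0")
      case True
      then obtain i j where ij: "i < n" "j < n" "k \<le> i" "k \<le> j" "m $$ (i, j) \<noteq> 0" by blast
      then obtain x y where xy: "x \<in> elem_gen n" "y \<in> elem_gen n" "reduced n (Suc k) (x * m * y)"
        using reduced_step[OF less.prems(1)] by blast
      then obtain x' y' r where *: "x' \<in> elem_gen n" "y' \<in> elem_gen n" "r \<le> n" "x' * (x * m * y) * y' = unit_blocks n r"
        using less.hyps[OF _ xy(3)] ij by (meson Suc_leI diff_less_mono2 le_less_trans lessI)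
      have "(x' * x) * m * (y * y') = unit_blocks n r"
        using *(4) elem_gen_carrier[OF xy(1)] elem_gen_carrier[OF xy(2)] elem_gen_carrier[OF *(1)] elem_gen_carrier[OF *(2)] mc
        by (simp add: assoc_mult_mat[of _ n n _ n _ n])
      then show ?thesis using elem_gen.mult xy * by blast
    next
      case False
      have "m = unit_blocks n k"
      proof (rule eq_matI)
        fix i j assume "i < dim_row (unit_blocks n k :: 'a mat)" "j < dim_col (unit_blocks n k :: 'a mat)"
        then have "i < n" "j < n" by (auto simp: coord_proj_def)
        then show "m $$ (i, j) = unit_blocks n k $$ (i, j)"
          using False less.prems(1) by (cases "i < k \<or> j < k") (auto simp: reduced_def coord_proj_def)
      qed (use mc in \<open>auto simp: coord_proj_def\<close>)
      moreover have "1\<^sub>m n * m * 1\<^sub>m n = m" using mc by simp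
      ultimately show ?thesis using elem_gen_one less.prems(2) by metis
    qed
  qed
  show ?thesis by (rule step[of 0]) (use assms in \<open>auto simp: reduced_def\<close>)
qed

lemma scaling_mult: "k < n \<Longrightarrow> scaling n k a * scaling n k b = scaling n k (a * b)"
  and scaling_one: "scaling n k 1 = 1\<^sub>m n"
proof -
  show "scaling n k 1 = 1\<^sub>m n" by (rule eq_matI) (auto simp: scaling_def)
  assume "k < n"
  have c: "scaling n k b \<in> carrier_mat n n" by (simp add: scaling_def)
  show "scaling n k a * scaling n k b = scaling n k (a * b)"
  proof (rule eq_matI)
    fix i j assume "i < dim_row (scaling n k (a * b))" "j < dim_col (scaling n k (a * b))"
    then have "i < n" "j < n" by (auto simp: scaling_def)
    then show "(scaling n k a * scaling n k b) $$ (i, j) = scaling n k (a * b) $$ (i, j)"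
      unfolding scaling_left[OF c \<open>i < n\<close> \<open>j < n\<close>] by (auto simp: scaling_def)
  qed (auto simp: scaling_def)
qed

lemma one_plus_mult:
  assumes "c \<in> carrier_mat n n" "c * c = 0\<^sub>m n n"
  shows "(1\<^sub>m n + a \<cdot>\<^sub>m c) * (1\<^sub>m n + b \<cdot>\<^sub>m c) = 1\<^sub>m n + (a + b) \<cdot>\<^sub>m (c :: 'a::field mat)"
proof -
  have "(1\<^sub>m n + a \<cdot>\<^sub>m c) * (1\<^sub>m n + b \<cdot>\<^sub>m c) = 1\<^sub>m n * (1\<^sub>m n + b \<cdot>\<^sub>m c) + (a \<cdot>\<^sub>m c) * (1\<^sub>m n + b \<cdot>\<^sub>m c)"
    using assms(1) by (intro add_mult_distrib_mat[of _ n n]) auto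
  also have "(a \<cdot>\<^sub>m c) * (1\<^sub>m n + b \<cdot>\<^sub>m c) = (a \<cdot>\<^sub>m c) * 1\<^sub>m n + (a \<cdot>\<^sub>m c) * (b \<cdot>\<^sub>m c)"
    using assms(1) by (intro mult_add_distrib_mat[of _ n n]) auto
  also have "(a \<cdot>\<^sub>m c) * (b \<cdot>\<^sub>m c) = 0\<^sub>m n n"
    using assms by (simp add: mult_smult_distrib[of _ n n _ n] mult_smult_assoc_mat[of _ n n _ n])
  finally show ?thesis using assms(1) by (intro eq_matI) (auto simp: algebra_simps)
qed

lemma elem_gen_inverse:
  assumes "x \<in> elem_gen n"
  shows "\<exists>x'\<in>elem_gen n. x * x' = 1\<^sub>m n \<and> x' * x = 1\<^sub>m n"
  using assms
proof induction
  case (one_plus c)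
  have "1\<^sub>m n + (- 1) \<cdot>\<^sub>m c \<in> elem_gen n"
    using one_plus by (intro elem_gen.one_plus)
      (auto simp: mult_smult_distrib[of _ n n _ n] mult_smult_assoc_mat[of _ n n _ n])
  moreover have "c + c = (1 + 1) \<cdot>\<^sub>m c" by (rule eq_matI) (auto simp: algebra_simps)
  moreover have "(1\<^sub>m n + c) * (1\<^sub>m n + (- 1) \<cdot>\<^sub>m c) = 1\<^sub>m n" "(1\<^sub>m n + (- 1) \<cdot>\<^sub>m c) * (1\<^sub>m n + c) = 1\<^sub>m n"
  proof -
    have z: "1\<^sub>m n + (0 :: 'a) \<cdot>\<^sub>m c = 1\<^sub>m n" using one_plus(1) by (intro eq_matI) auto
    show "(1\<^sub>m n + c) * (1\<^sub>m n + (- 1) \<cdot>\<^sub>m c) = 1\<^sub>m n" "(1\<^sub>m n + (- 1) \<cdot>\<^sub>m c) * (1\<^sub>m n + c) = 1\<^sub>m n"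
      using one_plus_mult[OF one_plus, of 1 "- 1"] one_plus_mult[OF one_plus, of "- 1" 1] z
      by (simp_all add: smult_one)
  qed
  ultimately show ?case by blast
next
  case (scaling k a)
  then show ?case
    by (intro bexI[of _ "scaling n k (inverse a)"] elem_gen.scaling)
       (auto simp: scaling_mult scaling_one)
next
  case (mult x y)
  then obtain x' y' where *: "x' \<in> elem_gen n" "y' \<in> elem_gen n" "x * x' = 1\<^sub>m n" "x' * x = 1\<^sub>m n"
    "y * y' = 1\<^sub>m n" "y' * y = 1\<^sub>m n" by blast
  note c = elem_gen_carrier[OF mult(1)] elem_gen_carrier[OF mult(2)] elem_gen_carrier[OF *(1)] elem_gen_carrier[OF *(2)]
  have "(x * y) * (y' * x') = x * (y * y') * x'" "(y' * x') * (x * y) = y' * (x' * x) * y"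
    using c by (simp_all add: assoc_mult_mat[of _ n n _ n _ n])
  then show ?case using * c elem_gen.mult by (intro bexI[of _ "y' * x'"]) auto
qed

lemma invertible_in_elem_gen:
  assumes "m \<in> carrier_mat n n" "m' \<in> carrier_mat n n" "m' * m = 1\<^sub>m n"
  shows "m \<in> elem_gen n"
proof -
  obtain x y r where *: "x \<in> elem_gen n" "y \<in> elem_gen n" "r \<le> n" "x * m * y = unit_blocks n r"
    using elimination[OF assms(1)] by blast
  obtain x' y' where **: "x' \<in> elem_gen n" "x * x' = 1\<^sub>m n" "x' * x = 1\<^sub>m n" "y' \<in> elem_gen n" "y * y' = 1\<^sub>m n" "y' * y = 1\<^sub>m n"
    using elem_gen_inverse[OF *(1)] elem_gen_inverse[OF *(2)] by blast
  note c = elem_gen_carrier[OF *(1)] elem_gen_carrier[OF *(2)] elem_gen_carrier[OF **(1)] elem_gen_carrier[OF **(4)] assms(1,2)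
  have "(y' * m' * x') * (x * m * y) = y' * (m' * ((x' * x) * m)) * y"
    using c by (simp add: assoc_mult_mat[of _ n n _ n _ n])
  also have "\<dots> = 1\<^sub>m n" using c ** assms(3) by simp
  finally have inv: "(y' * m' * x') * unit_blocks n r = 1\<^sub>m n" by (simp add: *(4))
  have "r = n"
  proof (rule ccontr)
    assume "r \<noteq> n"
    then have r: "r < n" using *(3) by simp
    have "((y' * m' * x') * unit_blocks n r) $$ (r, r) = 0"
      using c r by (subst mult_coord_proj_right[of _ n]) simp_all
    then show False using inv r by simp
  qed
  then have "unit_blocks n r = (1\<^sub>m n :: 'a mat)" by (intro eq_matI) (auto simp: coord_proj_def)
  then have "x' * (x * m * y) * y' = x' * 1\<^sub>m n * y'" by (simp add: *(4))
  moreover have "x' * (x * m * y) * y' = (x' * x) * m * (y * y')"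
    using c by (simp add: assoc_mult_mat[of _ n n _ n _ n])
  ultimately have "m = x' * y'" using c ** by simp
  then show ?thesis using elem_gen.mult[OF **(1,4)] by simp
qed

context siegel
begin

text \<open>The exchange of the first \<open>r\<close> coordinates of the two standard isotropic subspaces.\<close>
definition wr :: "nat \<Rightarrow> 'a mat" where
  "wr r = four_block_mat (coord_proj n {r..}) (coord_proj n {..<r}) (coord_proj n {..<r}) (coord_proj n {r..})"

definition levi :: "'a mat \<Rightarrow> 'a mat \<Rightarrow> 'a mat" where
  "levi A D = four_block_mat A (0\<^sub>m n n) (0\<^sub>m n n) D"

lemma wr_G: "wr r \<in> G"
  unfolding wr_def
  by (rule block_G[OF _ M_props(1)]) (simp_all add: coord_proj_mult coord_proj_ops smult_one)

lemma wr_sq: "wr r * wr r = 1\<^sub>m (2 * n)"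
  unfolding wr_def
  by (subst mult_blocks[where n = n]) (simp_all add: coord_proj_mult coord_proj_ops mult_2)

lemma levi_G:
  assumes "A \<in> carrier_mat n n" "D \<in> carrier_mat n n" "transpose_mat A * D = 1\<^sub>m n"
  shows "levi A D \<in> G" "levi A D \<in> P"
proof -
  show "levi A D \<in> G"
    unfolding levi_def by (rule block_G[OF _ M_props(1)]) (use assms in \<open>simp_all add: smult_one\<close>)
  then show "levi A D \<in> P"
    unfolding Siegel_def using assms
    by (simp add: levi_def) (intro exI[of _ A] exI[of _ "0\<^sub>m n n"] exI[of _ D] conjI, simp_all)
qed

text \<open>Being closed under transposition gives the relations between the rows of an element, next to those
  between its columns.\<close>
lemma transpose_G: assumes g: "g \<in> G" shows "transpose_mat g \<in> G"
proof (rule G_I[OF _ gram_G(2)[OF g]])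
  note c = G_carrier[OF g]
  show "transpose_mat g \<in> carrier_mat (2 * n) (2 * n)" using c by simp
  have "g * ginv g * Jmat n = Jmat n" by (simp add: ginv_right[OF g] left_mult_one_mat[of _ "2 * n" "2 * n"])
  moreover have "g * ginv g * Jmat n = inverse (sim g) \<cdot>\<^sub>m (g * Jmat n * transpose_mat g * (Jmat n * Jmat n))"
    using c by (simp add: ginv_def mult_smult_distrib[of _ "2 * n" "2 * n" _ "2 * n"]
        mult_smult_assoc_mat[of _ "2 * n" "2 * n" _ "2 * n"] assoc_mult_mat[of _ "2 * n" "2 * n" _ "2 * n" _ "2 * n"])
  ultimately have "inverse (sim g) \<cdot>\<^sub>m (g * Jmat n * transpose_mat g) = Jmat n"
    using c by (simp add: Jmat_sq)
  then have "sim g \<cdot>\<^sub>m (inverse (sim g) \<cdot>\<^sub>m (g * Jmat n * transpose_mat g)) = sim g \<cdot>\<^sub>m Jmat n" by simp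
  then show "transpose_mat (transpose_mat g) * Jmat n * transpose_mat g = sim g \<cdot>\<^sub>m Jmat n"
    using gram_G(3)[OF g] by (simp add: smult_smult_times smult_one)
qed

text \<open>The lower left block can be brought to the form \<open>unit_blocks n r\<close> by Levi elements on both sides.
  The first \<open>r\<close> rows of the lower right block are then skew-symmetric data that a unipotent element
  removes, and its remaining rows vanish in the first \<open>r\<close> columns.\<close>
lemma double_coset_rep:
  assumes g: "g \<in> G"
  shows "\<exists>r\<le>n. \<exists>p\<in>P. \<exists>p'\<in>P. p * g * p' * wr r \<in> P"
proof -
  obtain A B C D where b: "blocks n A B C D" and gb: "g = four_block_mat A B C D"
    using four_block_exists[OF G_carrier[OF g]] .
  obtain x y r where xy: "x \<in> elem_gen n" "y \<in> elem_gen n" "r \<le> n" "x * C * y = unit_blocks n r"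
    using elimination[of C n] b by blast
  obtain x' y' where inv: "x' \<in> elem_gen n" "x' * x = 1\<^sub>m n" "y' \<in> elem_gen n" "y' * y = 1\<^sub>m n"
    using elem_gen_inverse[OF xy(1)] elem_gen_inverse[OF xy(2)] by blast
  note c = elem_gen_carrier[OF xy(1)] elem_gen_carrier[OF xy(2)] elem_gen_carrier[OF inv(1)] elem_gen_carrier[OF inv(3)]
  let ?p = "levi (transpose_mat x') x" and ?p2 = "levi y (transpose_mat y')"
  have p: "?p \<in> P" "?p2 \<in> P"
    using c inv by (auto intro!: levi_G simp: transpose_mult[of _ n n _ n, symmetric])
  define A1 B1 D1 where "A1 = transpose_mat x' * A * y" and "B1 = transpose_mat x' * B * transpose_mat y'"
    and "D1 = x * D * transpose_mat y'"
  have b1: "blocks n A1 B1 (unit_blocks n r) D1"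
    using b c by (simp add: A1_def B1_def D1_def)
  have g1: "?p * g * ?p2 = four_block_mat A1 B1 (unit_blocks n r) D1"
  proof -
    have "?p * g = four_block_mat (transpose_mat x' * A) (transpose_mat x' * B) (x * C) (x * D)"
      unfolding gb levi_def using b c by (subst mult_blocks[where n = n]) auto
    then show ?thesis
      unfolding levi_def using b c
      by (subst (asm) gb, simp only:, subst mult_blocks[where n = n]) (auto simp: A1_def B1_def D1_def xy(4))
  qed
  have g1G: "four_block_mat A1 B1 (unit_blocks n r) D1 \<in> G"
    unfolding g1[symmetric] by (intro mult_G g P_G p)
  have sk: "unit_blocks n r * transpose_mat D1 + D1 * unit_blocks n r = 0\<^sub>m n n"
    using G_blocks(3)[of "transpose_mat A1" "unit_blocks n r" "transpose_mat B1" "transpose_mat D1"]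
      transpose_G[OF g1G] b1 by (simp add: transpose_blocks[OF b1])
  have D1: "(if i < r then D1 $$ (j, i) else 0) + (if j < r then D1 $$ (i, j) else 0) = 0"
    if "i < n" "j < n" for i j
  proof -
    have "(unit_blocks n r * transpose_mat D1 + D1 * unit_blocks n r) $$ (i, j) = 0"
      unfolding sk using that by simp
    moreover have "(unit_blocks n r * transpose_mat D1 + D1 * unit_blocks n r) $$ (i, j)
        = (unit_blocks n r * transpose_mat D1) $$ (i, j) + (D1 * unit_blocks n r) $$ (i, j)"
      using that b1 by (intro index_add_mat) auto
    moreover have "transpose_mat D1 $$ (i, j) = D1 $$ (j, i)" using that b1 by auto
    ultimately show ?thesis
      using that b1 mult_coord_proj_left[of "transpose_mat D1" n i j "{..<r}"]
        mult_coord_proj_right[of D1 n i j "{..<r}"] by (auto split: if_splits)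
  qed
  define S where "S = mat n n (\<lambda>(i, j). if i < r then - D1 $$ (i, j) else if j < r then D1 $$ (j, i) else 0)"
  have S: "S \<in> skews"
  proof -
    have "transpose_mat S = - S"
    proof (rule eq_matI)
      fix i j assume "i < dim_row (- S)" "j < dim_col (- S)"
      then have "i < n" "j < n" by (auto simp: S_def)
      then show "transpose_mat S $$ (i, j) = (- S) $$ (i, j)"
        using D1[of i j] by (cases "i < r"; cases "j < r") (simp_all add: S_def add_eq_0_iff)
    qed (auto simp: S_def)
    then show ?thesis by (simp add: skews_def S_def)
  qed
  define D2 where "D2 = unit_blocks n r * S + D1"
  have D2c: "D2 \<in> carrier_mat n n" using b1 skews_carrier[OF S] by (simp add: D2_def)
  have D2: "D2 * unit_blocks n r = 0\<^sub>m n n"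
  proof (rule eq_matI)
    fix i j assume "i < dim_row (0\<^sub>m n n :: 'a mat)" "j < dim_col (0\<^sub>m n n :: 'a mat)"
    then have ij: "i < n" "j < n" by auto
    have "D2 $$ (i, j) = (unit_blocks n r * S) $$ (i, j) + D1 $$ (i, j)"
      unfolding D2_def using b1 skews_carrier[OF S] ij by (intro index_add_mat) auto
    then have "D2 $$ (i, j) = (if i < r then S $$ (i, j) else 0) + D1 $$ (i, j)"
      using mult_coord_proj_left[OF skews_carrier[OF S] ij, of "{..<r}"] by simp
    then show "(D2 * unit_blocks n r) $$ (i, j) = 0\<^sub>m n n $$ (i, j)"
      using D1[OF ij] ij mult_coord_proj_right[OF D2c ij, of "{..<r}"]
      by (cases "i < r"; cases "j < r") (simp_all add: S_def)
  qed (use b1 in \<open>auto simp: D2_def\<close>)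
  have "?p * g * ?p2 * unip S * wr r = four_block_mat A1 (A1 * S + B1) (unit_blocks n r) D2 * wr r"
    unfolding g1 unip_def using b1 skews_carrier[OF S] by (subst mult_blocks[where n = n]) (auto simp: D2_def)
  also have "\<dots> = four_block_mat (A1 * coord_proj n {r..} + (A1 * S + B1) * unit_blocks n r)
      (A1 * unit_blocks n r + (A1 * S + B1) * coord_proj n {r..}) (0\<^sub>m n n)
      (unit_blocks n r * unit_blocks n r + D2 * coord_proj n {r..})"
    unfolding wr_def using b1 skews_carrier[OF S] D2c
    by (subst mult_blocks[where n = n]) (auto simp: D2 coord_proj_mult coord_proj_ops)
  finally have eq: "?p * g * ?p2 * unip S * wr r = four_block_mat (A1 * coord_proj n {r..} + (A1 * S + B1) * unit_blocks n r)
      (A1 * unit_blocks n r + (A1 * S + B1) * coord_proj n {r..}) (0\<^sub>m n n)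
      (unit_blocks n r * unit_blocks n r + D2 * coord_proj n {r..})" .
  have "?p * g * ?p2 * unip S * wr r \<in> G" by (intro mult_G g P_G p unip_P S wr_G)
  then have inP: "?p * g * ?p2 * unip S * wr r \<in> P"
    unfolding Siegel_def eq using b1 skews_carrier[OF S] D2c
    by (intro CollectI conjI exI[of _ "A1 * coord_proj n {r..} + (A1 * S + B1) * unit_blocks n r"]
        exI[of _ "A1 * unit_blocks n r + (A1 * S + B1) * coord_proj n {r..}"]
        exI[of _ "unit_blocks n r * unit_blocks n r + D2 * coord_proj n {r..}"]) auto
  have "?p * g * ?p2 * unip S = ?p * g * (?p2 * unip S)"
    by (rule mult_assoc[OF G_carrier[OF mult_G[OF P_G[OF p(1)] g]] G_carrier[OF P_G[OF p(2)]]
          G_carrier[OF unip_G[OF S]]])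
  then show ?thesis using inP p mult_P[OF p(2) unip_P[OF S]] xy(3) by (intro exI[of _ r]) (metis (no_types))
qed

end

lemma polynomial_interpolation:
  fixes x c :: "nat \<Rightarrow> 'b::field"
  assumes "inj_on x {..m}"
  shows "\<exists>p. (\<forall>i\<ge>Suc m. coeff p i = 0) \<and> (\<forall>j\<le>m. poly p (x j) = c j)"
  using assms
proof (induction m)
  case 0
  show ?case by (intro exI[of _ "[:c 0:]"]) (auto simp: coeff_pCons split: nat.splits)
next
  case (Suc m)
  obtain p where p: "\<forall>i\<ge>Suc m. coeff p i = 0" "\<forall>j\<le>m. poly p (x j) = c j"
    using Suc by (meson atMost_subset_iff inj_on_subset le_SucI order_refl)
  define w where "w = (\<Prod>j\<le>m. [:- x j, 1:])"
  have w0: "poly w (x j) = 0" if "j \<le> m" for j using that by (auto simp: w_def poly_prod)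
  have ws: "poly w (x (Suc m)) \<noteq> 0"
    using inj_onD[OF Suc.prems, of "Suc m"] by (force simp: w_def poly_prod)
  have "degree w \<le> sum (degree \<circ> (\<lambda>j. [:- x j, 1:])) {..m}" unfolding w_def by (rule degree_prod_sum_le) simp
  then have dw: "degree w \<le> Suc m" by simp
  define t where "t = (c (Suc m) - poly p (x (Suc m))) / poly w (x (Suc m))"
  have "coeff (p + smult t w) i = 0" if "i \<ge> Suc (Suc m)" for i
    using that p(1) dw by (simp add: coeff_eq_0)
  moreover have "poly (p + smult t w) (x j) = c j" if "j \<le> Suc m" for j
    using that p(2) w0 ws by (cases "j = Suc m") (auto simp: t_def le_Suc_eq)
  ultimately show ?case by blast
qed

context siegel_spectrum
begin

lemma Kg_wr: "r \<le> n \<Longrightarrow> Kg (wr r) = CARD('a) ^ (n - r)"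
proof -
  assume r: "r \<le> n"
  have y: "yg (wr r) v = 0 \<longleftrightarrow> (\<forall>i<r. v i = 0)" if "v \<in> Vn n" for v
  proof -
    have "lo n v = v" "hi n v = 0" using that by (auto simp: lo_def hi_def Vn_def fun_eq_iff)
    then have "yg (wr r) v = act (unit_blocks n r) v"
      unfolding wr_def by (simp add: act_four_block act_ops(3))
    then show ?thesis using r by (auto simp: act_coord_proj fun_eq_iff)
  qed
  have bij: "bij_betw (\<lambda>w i. if i < r then 0 else w (i - r)) (Vn (n - r)) {v \<in> Vn n. \<forall>i<r. v i = (0 :: 'a)}"
    by (rule bij_betw_byWitness[where f' = "\<lambda>v i. v (i + r)"]) (auto simp: Vn_def fun_eq_iff)
  have "{v \<in> Vn n. yg (wr r) v = 0} = {v \<in> Vn n. \<forall>i<r. v i = 0}" using y by blast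
  then show ?thesis using bij_betw_same_card[OF bij] by (simp add: Kg_def card_Vn)
qed

lemma Eqv_at_wr:
  assumes "g \<in> G"
  shows "\<exists>r\<le>n. \<forall>f\<in>Eqv. f g = f (wr r)"
proof -
  obtain r p p' where r: "r \<le> n" "p \<in> P" "p' \<in> P" "p * g * p' * wr r \<in> P"
    using double_coset_rep[OF assms] by blast
  have "f g = f (wr r)" if f: "f \<in> Eqv" for f
  proof -
    have h: "p * g * p' \<in> G" by (intro mult_G P_G[OF r(2)] P_G[OF r(3)] assms)
    have "p * g * p' * wr r * wr r = p * g * p'"
      using mult_assoc[OF G_carrier[OF h] G_carrier[OF wr_G] G_carrier[OF wr_G], of r r] right_mult_one_mat[OF G_carrier[OF h]]
      by (simp add: wr_sq)
    then have "f (p * g * p') = f (wr r)"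
      using f r(4) wr_G[of r] unfolding Eqv_iff Inv_iff by metis
    moreover have "f (p * g * p') = f g"
      using f r assms mult_G P_G unfolding Eqv_iff Inv_iff by metis
    ultimately show ?thesis by simp
  qed
  then show ?thesis using r(1) by blast
qed

lemma q_powers_inj: "inj_on (\<lambda>j. q ^ j) S"
proof (rule inj_onI)
  fix i j assume "q ^ i = q ^ j"
  then have "(of_nat (CARD('a) ^ i) :: complex) = of_nat (CARD('a) ^ j)" by (simp add: q)
  then have "CARD('a) ^ i = CARD('a) ^ j" by (simp only: of_nat_eq_iff)
  then show "i = j" using card_field_gt_1[where 'a = 'a] by simp
qed

lemma Phi_surj:
  assumes f: "f \<in> Eqv"
  obtains p where "p \<in> polys (Suc n)" "f = Phi p"
proof -
  obtain p where p: "\<forall>i\<ge>Suc n. coeff p i = 0" "\<forall>j\<le>n. poly p (q ^ j) = f (wr (n - j))"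
    using polynomial_interpolation[OF q_powers_inj[of "{..n}"], of "\<lambda>j. f (wr (n - j))"] by blast
  have "f g = Phi p g" for g
  proof (cases "g \<in> G")
    case True
    then obtain r where r: "r \<le> n" "\<And>f. f \<in> Eqv \<Longrightarrow> f g = f (wr r)" using Eqv_at_wr by blast
    have "Phi p g = poly p (q ^ (n - r))"
      unfolding r(2)[OF Phi_Eqv] using wr_G r(1) by (simp add: Phi_def Kg_wr q)
    then show ?thesis using p(2) r f by simp
  next
    case False
    then show ?thesis using f by (simp add: Phi_def Eqv_iff Inv_iff)
  qed
  then show ?thesis using that[of p] p(1) by (auto simp: polys_def)
qed

lemma Phi_inj:
  assumes p: "p \<in> polys (Suc n)" and z: "Phi p = 0"
  shows "p = 0"
proof (rule ccontr)
  assume p0: "p \<noteq> 0"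
  have "poly p (q ^ j) = 0" if "j \<le> n" for j
    using fun_cong[OF z, of "wr (n - j)"] that by (simp add: Phi_def wr_G Kg_wr q)
  then have "(\<lambda>j. q ^ j) ` {..n} \<subseteq> {x. poly p x = 0}" by auto
  then have "card ((\<lambda>j. q ^ j) ` {..n}) \<le> card {x. poly p x = 0}"
    by (intro card_mono poly_roots_finite p0)
  then have "Suc n \<le> degree p"
    using card_poly_roots_bound[OF p0] by (simp add: card_image[OF q_powers_inj])
  moreover have "degree p \<le> n" using p by (intro degree_le) (auto simp: polys_def)
  ultimately show False by simp
qed

text \<open>\<open>Kg\<close> takes the \<open>n + 1\<close> values \<open>q ^ j\<close>, so interpolation identifies bi-invariant functions with polynomials of
  degree at most \<open>n\<close>; eigenvectors of pairwise different degrees then form a basis.\<close>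
lemma Eqv_eigenbasis:
  "\<exists>h. (\<forall>k<Suc n. h k \<in> Eqv \<and> T (h k) = fscale (mu k) (h k)) \<and>
    (\<forall>f\<in>Eqv. \<exists>a. f = (\<Sum>k<Suc n. fscale (a k) (h k))) \<and>
    (\<forall>a. (\<Sum>k<Suc n. fscale (a k) (h k)) = 0 \<longrightarrow> (\<forall>k<Suc n. a k = 0))"
proof -
  have "\<forall>k. \<exists>p. k \<le> n \<longrightarrow> p \<in> polys (Suc k) \<and> coeff p k = 1 \<and> T (Phi p) = fscale (mu k) (Phi p)"
    using Phi_eigen by blast
  then obtain e where e: "\<And>k. k \<le> n \<Longrightarrow> e k \<in> polys (Suc k)" "\<And>k. k \<le> n \<Longrightarrow> coeff (e k) k = 1"
    "\<And>k. k \<le> n \<Longrightarrow> T (Phi (e k)) = fscale (mu k) (Phi (e k))" by metis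
  have comb: "Phi (\<Sum>k<m. smult (a k) (e k)) = (\<Sum>k<m. fscale (a k) (Phi (e k)))" for a m
    by (simp add: Phi_sum Phi_ops)
  have span: "\<exists>a. p = (\<Sum>k<m. smult (a k) (e k))" if "m \<le> Suc n" "p \<in> polys m" for m p
    using that
  proof (induction m arbitrary: p)
    case 0
    then have "p = 0" by (intro poly_eqI) (simp add: polys_def)
    then show ?case by simp
  next
    case (Suc m)
    have "p - smult (coeff p m) (e m) \<in> polys m"
      using Suc.prems e by (intro polys_reduce) auto
    then obtain a where a: "p - smult (coeff p m) (e m) = (\<Sum>k<m. smult (a k) (e k))"
      using Suc.IH Suc.prems(1) by (metis Suc_leD)
    have "p = (\<Sum>k<Suc m. smult ((a(m := coeff p m)) k) (e k))"
      using a by (simp add: algebra_simps)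
    then show ?case by blast
  qed
  have indep: "\<forall>k<m. a k = 0" if "m \<le> Suc n" "(\<Sum>k<m. smult (a k) (e k)) = 0" for m a
    using that
  proof (induction m)
    case (Suc m)
    have "coeff (\<Sum>k<Suc m. smult (a k) (e k)) m = (\<Sum>k<m. a k * coeff (e k) m) + a m"
      using e(2)[of m] Suc.prems(1) by (simp add: coeff_sum)
    moreover have "(\<Sum>k<m. a k * coeff (e k) m) = 0"
      using e(1) Suc.prems(1) by (intro sum.neutral) (auto simp: polys_def)
    ultimately have "a m = 0" unfolding Suc.prems(2) by simp
    then show ?case using Suc by (auto simp: less_Suc_eq)
  qed simp
  show ?thesis
  proof (intro exI[of _ "\<lambda>k. Phi (e k)"] conjI allI impI ballI)
    fix k assume "k < Suc n"
    then show "Phi (e k) \<in> Eqv" "T (Phi (e k)) = fscale (mu k) (Phi (e k))" using e Phi_Eqv by auto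
  next
    fix f assume "f \<in> Eqv"
    then obtain p where p: "p \<in> polys (Suc n)" "f = Phi p" by (rule Phi_surj)
    then obtain a where "p = (\<Sum>k<Suc n. smult (a k) (e k))" using span by blast
    then show "\<exists>a. f = (\<Sum>k<Suc n. fscale (a k) (Phi (e k)))" using p comb by metis
  next
    fix a k assume z: "(\<Sum>k<Suc n. fscale (a k) (Phi (e k))) = 0" and k: "k < Suc n"
    have "(\<Sum>k<Suc n. smult (a k) (e k)) \<in> polys (Suc n)"
      using e(1) by (auto simp: polys_def coeff_sum intro!: sum.neutral)
    then have "(\<Sum>k<Suc n. smult (a k) (e k)) = 0" by (rule Phi_inj) (simp only: comb z)
    then show "a k = 0" using indep k by blast
  qed
qed

end

section \<open>Quadratic characters and signs\<close>

definition odd_sign :: "'v::ab_group_add set \<Rightarrow> ('v \<Rightarrow> complex) \<Rightarrow> bool" where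
  "odd_sign X F \<longleftrightarrow> (\<forall>v\<in>X. - v \<in> X \<and> (F v = 1 \<or> F v = - 1) \<and> F (- v) = - F v)"

text \<open>The vectors on which an odd sign is \<open>1\<close> represent the orbits of \<open>\<plusminus>1\<close> on \<open>X\<close>, so the product of an
  even function over them depends neither on the sign nor on a permutation of the orbits.\<close>
lemma prod_even_half:
  fixes e :: "'v::ab_group_add \<Rightarrow> 'm::comm_monoid_mult"
  assumes F: "odd_sign X F" and F': "odd_sign X F'" and g: "bij_betw g X X"
    and odd: "\<And>v. v \<in> X \<Longrightarrow> g (- v) = - g v" and even: "\<And>v. v \<in> X \<Longrightarrow> e (- v) = e v"
  shows "(\<Prod>v | v \<in> X \<and> F v = 1. e (g v)) = (\<Prod>w | w \<in> X \<and> F' w = 1. e w)"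
proof -
  let ?\<phi> = "\<lambda>v. if F' (g v) = 1 then g v else - g v"
  have gX: "g v \<in> X" if "v \<in> X" for v using g that by (auto simp: bij_betw_def)
  have inj: "v = w" if "v \<in> X" "w \<in> X" "g v = g w" for v w
    using g that by (auto simp: bij_betw_def inj_on_def)
  have "bij_betw ?\<phi> {v. v \<in> X \<and> F v = 1} {w. w \<in> X \<and> F' w = 1}"
  proof (rule bij_betwI')
    fix v w assume v: "v \<in> {v. v \<in> X \<and> F v = 1}" and w: "w \<in> {v. v \<in> X \<and> F v = 1}"
    have neg: "- v \<in> X" "- w \<in> X" "F (- v) = - 1" "F (- w) = - 1" using v w F by (auto simp: odd_sign_def)
    show "(?\<phi> v = ?\<phi> w) = (v = w)"
    proof
      assume "?\<phi> v = ?\<phi> w"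
      then have "g v = g w \<or> g v = - g w" by (metis minus_minus)
      then have "g v = g w \<or> g v = g (- w)" using odd w by auto
      then have "v = w \<or> v = - w" using inj v w neg by auto
      then show "v = w" using v neg by auto
    qed simp
  next
    fix v assume "v \<in> {v. v \<in> X \<and> F v = 1}"
    then show "?\<phi> v \<in> {w. w \<in> X \<and> F' w = 1}" using gX[of v] F' by (auto simp: odd_sign_def)
  next
    fix w assume w: "w \<in> {w. w \<in> X \<and> F' w = 1}"
    then obtain v where v: "v \<in> X" "w = g v" using g by (auto simp: bij_betw_def)
    show "\<exists>v\<in>{v. v \<in> X \<and> F v = 1}. w = ?\<phi> v"
    proof (cases "F v = 1")
      case True
      then show ?thesis using v w by (intro bexI[of _ v]) auto
    next
      case False
      then have "- v \<in> X" "F (- v) = 1" using v F by (auto simp: odd_sign_def)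
      moreover have "F' (- w) = - 1" using w F' by (auto simp: odd_sign_def)
      ultimately show ?thesis using v odd by (intro bexI[of _ "- v"]) auto
    qed
  qed
  from prod.reindex_bij_betw[OF this, of e, symmetric]
  show ?thesis
    using even gX by (auto intro!: prod.cong)
qed

definition pm_character :: "('a::field \<Rightarrow> complex) \<Rightarrow> bool" where
  "pm_character \<beta> \<longleftrightarrow> (\<forall>x y. x \<noteq> 0 \<longrightarrow> y \<noteq> 0 \<longrightarrow> \<beta> (x * y) = \<beta> x * \<beta> y) \<and> (\<forall>x. x \<noteq> 0 \<longrightarrow> \<beta> x = 1 \<or> \<beta> x = - 1)"

text \<open>An arbitrary choice of one element in each pair \<open>x\<close>, \<open>- x\<close> of nonzero elements.\<close>
definition half_sign :: "'a::{finite,uminus} \<Rightarrow> bool" where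
  "half_sign x = (let e = (SOME e :: 'a \<Rightarrow> nat. inj e) in e x < e (- x))"

abbreviation sg :: "'a::{finite,field} \<Rightarrow> complex" where
  "sg x \<equiv> (if half_sign x then 1 else - 1)"

lemma half_sign_uminus:
  fixes x :: "'a::{finite,field}"
  assumes "odd CARD('a)" "x \<noteq> 0"
  shows "half_sign (- x) \<longleftrightarrow> \<not> half_sign x"
proof -
  define e :: "'a \<Rightarrow> nat" where "e = (SOME e. inj e)"
  have "\<exists>e :: 'a \<Rightarrow> nat. inj e" using finite_imp_inj_to_nat_seg[of "UNIV :: 'a set"] by auto
  then have "inj e" unfolding e_def by (rule someI_ex)
  moreover have "x \<noteq> - x"
  proof
    assume "x = - x"
    then have "2 * x = 0" by (metis add.right_inverse mult_2)
    then show False using two_neq_0[OF assms(1)] assms(2) by simp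
  qed
  ultimately have "e x \<noteq> e (- x)" by (simp add: inj_eq)
  then show ?thesis by (auto simp: half_sign_def Let_def e_def[symmetric])
qed

lemma odd_sign_sg: "odd CARD('a) \<Longrightarrow> odd_sign (UNIV - {0}) (sg :: 'a::{finite,field} \<Rightarrow> complex)"
  by (auto simp: odd_sign_def half_sign_uminus)

definition pos_half :: "'a::{finite,field} set" where
  "pos_half = {x. x \<noteq> 0 \<and> half_sign x}"

lemma card_pos_half: "odd CARD('a) \<Longrightarrow> 2 * card (pos_half :: 'a::{finite,field} set) = CARD('a) - 1"
proof -
  assume odd: "odd CARD('a)"
  let ?R = "pos_half :: 'a set"
  have u: "UNIV - {0} = ?R \<union> uminus ` ?R"
  proof (intro equalityI subsetI)
    fix x :: 'a assume "x \<in> UNIV - {0}"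
    then show "x \<in> ?R \<union> uminus ` ?R"
      using half_sign_uminus[OF odd, of x] by (cases "half_sign x") (auto simp: pos_half_def image_iff intro: exI[of _ "- x"])
  qed (auto simp: pos_half_def)
  have "card (UNIV - {0 :: 'a}) = card ?R + card (uminus ` ?R)"
    unfolding u by (rule card_Un_disjoint) (auto simp: pos_half_def half_sign_uminus[OF odd])
  then show ?thesis by (simp add: card_image card_Diff_singleton)
qed

text \<open>Over a finite field of odd order the squares have index two in the multiplicative group, so
  they are the kernel of every nontrivial character with values \<open>\<plusminus>1\<close>.\<close>
lemma quadratic_character_unique:
  fixes \<beta> \<gamma> :: "'a::{finite,field} \<Rightarrow> complex"
  assumes odd: "odd CARD('a)" and "pm_character \<beta>" "\<exists>x. x \<noteq> 0 \<and> \<beta> x \<noteq> 1" "pm_character \<gamma>" "\<exists>x. x \<noteq> 0 \<and> \<gamma> x \<noteq> 1" "x \<noteq> 0"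
  shows "\<beta> x = \<gamma> x"
proof -
  let ?S = "(\<lambda>x. x\<^sup>2) ` pos_half :: 'a set"
  have "inj_on (\<lambda>x. x\<^sup>2) (pos_half :: 'a set)"
    by (rule inj_onI) (auto simp: power2_eq_iff pos_half_def half_sign_uminus[OF odd])
  then have cS: "2 * card ?S = CARD('a) - 1" using card_pos_half[OF odd] by (simp add: card_image)
  have ker: "{x. x \<noteq> 0 \<and> \<chi> x = 1} = ?S" if chi: "pm_character \<chi>" "\<exists>x. x \<noteq> 0 \<and> \<chi> x \<noteq> 1" for \<chi> :: "'a \<Rightarrow> complex"
  proof -
    obtain b where b: "b \<noteq> 0" "\<chi> b = - 1" using chi by (auto simp: pm_character_def)
    have m: "\<chi> (x * y) = \<chi> x * \<chi> y" "\<chi> x = 1 \<or> \<chi> x = - 1" if "x \<noteq> 0" "y \<noteq> 0" for x y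
      using chi(1) that by (auto simp: pm_character_def)
    let ?K = "{x. x \<noteq> 0 \<and> \<chi> x = 1}"
    have "bij_betw ((*) b) ?K {x. x \<noteq> 0 \<and> \<chi> x = - 1}"
    proof (rule bij_betw_byWitness[where f' = "(*) (inverse b)"])
      have "\<chi> (inverse b * x) = 1" if "x \<noteq> 0" "\<chi> x = - 1" for x
        using m(1)[of b "inverse b * x"] b that by (simp add: mult.assoc[symmetric])
      then show "(*) (inverse b) ` {x. x \<noteq> 0 \<and> \<chi> x = - 1} \<subseteq> ?K" using b by auto
    qed (use b m in auto)
    then have "card {x. x \<noteq> 0 \<and> \<chi> x = - 1} = card ?K" by (simp add: bij_betw_same_card)
    moreover have u: "UNIV - {0} = ?K \<union> {x. x \<noteq> 0 \<and> \<chi> x = - 1}" using m(2)[of _ 1] by auto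
    have "card (UNIV - {0 :: 'a}) = card ?K + card {x. x \<noteq> 0 \<and> \<chi> x = - 1}"
      unfolding u by (rule card_Un_disjoint) auto
    ultimately have "2 * card ?K = CARD('a) - 1" by (simp add: card_Diff_singleton)
    moreover have "?S \<subseteq> ?K"
    proof
      fix y assume "y \<in> ?S"
      then obtain x where x: "x \<noteq> 0" "y = x * x" by (auto simp: pos_half_def power2_eq_square)
      then have "\<chi> y = 1" using m(1)[of x x] m(2)[of x x] by auto
      then show "y \<in> ?K" using x by simp
    qed
    ultimately show ?thesis using cS by (intro card_subset_eq[symmetric]) auto
  qed
  have pm: "\<chi> x = 1 \<or> \<chi> x = - 1" if "pm_character \<chi>" for \<chi> :: "'a \<Rightarrow> complex"
    using that assms(6) by (auto simp: pm_character_def)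
  have "x \<in> {x. x \<noteq> 0 \<and> \<beta> x = 1} \<longleftrightarrow> x \<in> {x. x \<noteq> 0 \<and> \<gamma> x = 1}"
    unfolding ker[OF assms(2,3)] ker[OF assms(4,5)] ..
  then have "\<beta> x = 1 \<longleftrightarrow> \<gamma> x = 1" using assms(6) by simp
  then show ?thesis using pm[OF assms(2)] pm[OF assms(4)] by auto
qed

definition gauss_sign :: "'a::{finite,field} \<Rightarrow> complex" where
  "gauss_sign a = (\<Prod>x\<in>pos_half. sg (a * x))"

lemma prod_signs:
  "finite R \<Longrightarrow> (\<Prod>x\<in>R. if Q x then 1 else - 1) = (- 1 :: 'b::comm_ring_1) ^ card {x \<in> R. \<not> Q x}"
  by (simp add: prod.If_cases Int_def)

text \<open>Gauss's lemma: if the sign were trivial at \<open>a\<close>, then \<open>a ^ ((q - 1) / 2) = 1\<close>; a polynomial of degree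
  \<open>(q - 1) / 2\<close> cannot vanish on all \<open>q - 1\<close> nonzero elements.\<close>
lemma gauss_sign_nontrivial:
  assumes odd: "odd CARD('a::{finite,field})"
  shows "\<exists>a :: 'a. a \<noteq> 0 \<and> gauss_sign a \<noteq> 1"
proof (rule ccontr)
  assume no: "\<not> ?thesis"
  let ?R = "pos_half :: 'a set" and ?s = "\<lambda>x :: 'a. if half_sign x then 1 else - 1 :: 'a"
  have R: "?R = {x. x \<in> UNIV - {0} \<and> sg x = 1}" by (auto simp: pos_half_def)
  have pw: "a ^ card ?R = 1" if a: "a \<noteq> 0" for a :: 'a
  proof -
    have "gauss_sign a = 1" using no a by blast
    then have "(- 1 :: complex) ^ card {x \<in> ?R. \<not> half_sign (a * x)} = 1"
      unfolding gauss_sign_def by (subst (asm) prod_signs) auto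
    then have "even (card {x \<in> ?R. \<not> half_sign (a * x)})" by (metis neg_one_odd_power one_neq_neg_one)
    then have s1: "(\<Prod>x\<in>?R. ?s (a * x)) = 1" by (subst prod_signs) auto
    have "(\<Prod>x\<in>?R. ?s (a * x) * (a * x)) = (\<Prod>x\<in>?R. ?s x * x)"
      unfolding R
    proof (rule prod_even_half[OF odd_sign_sg[OF odd] odd_sign_sg[OF odd], where e = "\<lambda>x. ?s x * x"])
      show "bij_betw ((*) a) (UNIV - {0}) (UNIV - {0})"
        by (rule bij_betw_byWitness[where f' = "(*) (inverse a)"]) (use a in auto)
    qed (auto simp: half_sign_uminus[OF odd])
    also have "(\<Prod>x\<in>?R. ?s x * x) = \<Prod>?R" by (intro prod.cong) (auto simp: pos_half_def)
    also have "(\<Prod>x\<in>?R. ?s (a * x) * (a * x)) = a ^ card ?R * \<Prod>?R"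
      unfolding prod.distrib s1 by simp
    finally have "a ^ card ?R * \<Prod>?R = \<Prod>?R" .
    moreover have "\<Prod>?R \<noteq> 0" by (simp add: pos_half_def)
    ultimately show ?thesis by simp
  qed
  define r where "r = card ?R"
  have q: "CARD('a) > 1" by (rule card_field_gt_1)
  then have r: "r \<ge> 1" "2 * r = CARD('a) - 1" using card_pos_half[OF odd] unfolding r_def by linarith+
  define p :: "'a poly" where "p = monom 1 r - 1"
  have "coeff p r = 1" using r by (simp add: p_def coeff_1)
  then have p0: "p \<noteq> 0" by auto
  have "degree p \<le> r" unfolding p_def by (intro degree_diff_le) (auto simp: degree_monom_le)
  moreover have "card (UNIV - {0 :: 'a}) \<le> card {x. poly p x = 0}"
    using pw unfolding r_def[symmetric] by (intro card_mono) (auto simp: p_def poly_monom)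
  moreover have "card {x. poly p x = 0} \<le> degree p" by (rule card_poly_roots_bound[OF p0])
  ultimately have "CARD('a) - 1 \<le> r" by (simp add: card_Diff_singleton)
  then show False using r by linarith
qed

section \<open>The spinor norm\<close>

locale orth = siegel n "{1 :: 'a::{finite,field}}" for n
begin

definition sphere :: "(nat \<Rightarrow> 'a) set" where
  "sphere = {v \<in> Vn (2 * n). dot n (lo n v) (hi n v) = 1}"

text \<open>The sign of the first nonzero coordinate, in an order of the coordinates in which \<open>i\<close> and \<open>n + i\<close> come last.\<close>
definition coord_sign :: "nat \<Rightarrow> (nat \<Rightarrow> 'a) \<Rightarrow> complex" where
  "coord_sign i v = (if \<exists>j. j < 2 * n \<and> j \<noteq> i \<and> j \<noteq> n + i \<and> v j \<noteq> 0
     then sg (v (LEAST j. j < 2 * n \<and> j \<noteq> i \<and> j \<noteq> n + i \<and> v j \<noteq> 0)) else sg (v i))"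

text \<open>A concrete form of the spinor norm: choose a sign on the vectors of norm \<open>1\<close> that is odd under
  \<open>v \<mapsto> - v\<close>, and multiply the sign changes caused by \<open>g\<close> over the orbits of \<open>\<plusminus>1\<close>. This is multiplicative and
  independent of the chosen sign, for the same reason as the sign of a permutation.\<close>
definition spin :: "'a mat \<Rightarrow> complex" where
  "spin g = (\<Prod>v | v \<in> sphere \<and> coord_sign 0 v = 1. coord_sign 0 (act g v))"

lemma sim_1: "g \<in> G \<Longrightarrow> sim g = 1"
  using gram_G(2) by auto

lemma finite_sphere: "finite sphere"
  by (rule finite_subset[OF _ finite_Vn[of "2 * n"]]) (auto simp: sphere_def)

lemma lo_hi_minus: "lo n (- v) = - lo n v" "hi n (- v) = - hi n v" for v :: "nat \<Rightarrow> 'a"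
  by (auto simp: lo_def hi_def fun_eq_iff)

lemma sphere_minus: "v \<in> sphere \<Longrightarrow> - v \<in> sphere"
  by (auto simp: sphere_def lo_hi_minus dot_minus Vn_def)

lemma act_minus: "act g (- v) = - act g v"
  using act_fvs[of g "- 1" v] by (simp add: fvs_def fun_Compl_def)

lemma act_sphere: "g \<in> G \<Longrightarrow> v \<in> sphere \<Longrightarrow> act g v \<in> sphere"
proof -
  assume g: "g \<in> G" and v: "v \<in> sphere"
  have b: "bform n w w = 2 * dot n (lo n w) (hi n w)" for w :: "nat \<Rightarrow> 'a"
    by (simp add: bform_def dot_commute)
  have "bform n (act g v) (act g v) = bform n v v"
    using bform_act[OF G_carrier[OF g] gram_G(1)[OF g]] sim_1[OF g] by simp
  then have "dot n (lo n (act g v)) (hi n (act g v)) = 1"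
    using v two_neq_0[OF q_odd] unfolding b by (simp add: sphere_def)
  then show ?thesis unfolding sphere_def using act_in_Vn[OF G_carrier[OF g]] by simp
qed

lemma bij_act_sphere: "g \<in> G \<Longrightarrow> bij_betw (act g) sphere sphere"
  by (rule bij_betw_byWitness[where f' = "act (ginv g)"])
     (use act_ginv act_sphere ginv_G in \<open>auto simp: sphere_def\<close>)

lemma odd_coord_sign:
  assumes i: "i < n"
  shows "odd_sign sphere (coord_sign i)"
  unfolding odd_sign_def
proof (intro ballI conjI)
  fix v assume v: "v \<in> sphere"
  show "- v \<in> sphere" by (rule sphere_minus[OF v])
  show "coord_sign i v = 1 \<or> coord_sign i v = - 1" by (simp add: coord_sign_def)
  let ?Q = "\<lambda>j. j < 2 * n \<and> j \<noteq> i \<and> j \<noteq> n + i \<and> v j \<noteq> 0"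
  show "coord_sign i (- v) = - coord_sign i v"
  proof (cases "\<exists>j. ?Q j")
    case True
    then have "v (LEAST j. ?Q j) \<noteq> 0" using LeastI_ex[of ?Q] by auto
    then show ?thesis using True half_sign_uminus[OF q_odd, of "v (LEAST j. ?Q j)"] by (simp add: coord_sign_def)
  next
    case False
    have "dot n (lo n v) (hi n v) = (\<Sum>j<n. if j = i then v i * v (n + i) else 0)"
      unfolding dot_def
    proof (rule sum.cong[OF refl])
      fix x assume "x \<in> {..<n}"
      then show "lo n v x * hi n v x = (if x = i then v i * v (n + i) else 0)"
      proof (cases "x = i")
        case xi: False
        moreover have "x < 2 * n" "x \<noteq> n + i" using \<open>x \<in> {..<n}\<close> by auto
        ultimately have "v x = 0" using False by blast
        then show ?thesis using xi by (simp add: lo_def)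
      qed (use i in \<open>simp add: lo_def hi_def\<close>)
    qed
    then have "v i \<noteq> 0" using v i by (auto simp: sphere_def)
    then show ?thesis using False half_sign_uminus[OF q_odd, of "v i"] by (auto simp: coord_sign_def)
  qed
qed

lemma odd_sign_props:
  assumes "odd_sign X F" "v \<in> X"
  shows "F v * F v = 1" "F (- v) = - F v"
  using assms by (auto simp: odd_sign_def)

lemma spin_indep:
  assumes F: "odd_sign sphere F" and g: "g \<in> G"
  shows "spin g = (\<Prod>v | v \<in> sphere \<and> F v = 1. F (act g v))"
proof -
  let ?F = "coord_sign 0"
  have F0: "odd_sign sphere ?F" using n_pos by (intro odd_coord_sign) simp
  note b = bij_act_sphere[OF g]
  let ?X = "{v. v \<in> sphere \<and> F v = 1}" and ?Y = "{v. v \<in> sphere \<and> ?F v = 1}"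
  have idb: "bij_betw (\<lambda>v. v) sphere sphere" by (rule bij_betw_byWitness[where f' = "\<lambda>v. v"]) auto
  have "spin g = (\<Prod>v\<in>?Y. ?F (act g v) * ?F v)"
    unfolding spin_def by (intro prod.cong) auto
  also have "(\<Prod>v\<in>?Y. ?F (act g v) * ?F v) = (\<Prod>v\<in>?X. ?F (act g v) * ?F v)"
    by (rule prod_even_half[OF F0 F idb, of "\<lambda>v. ?F (act g v) * ?F v"])
       (use odd_sign_props(2)[OF F0] act_sphere[OF g] in \<open>auto simp: act_minus\<close>)
  finally have 1: "spin g = (\<Prod>v\<in>?X. ?F (act g v)) * (\<Prod>v\<in>?X. ?F v)" by (simp add: prod.distrib)
  have "(\<Prod>v\<in>?X. ?F (act g v) * F (act g v)) = (\<Prod>v\<in>?X. ?F v * F v)"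
    by (rule prod_even_half[OF F F b, where e = "\<lambda>v. ?F v * F v"])
       (use odd_sign_props(2)[OF F0] odd_sign_props(2)[OF F] in \<open>auto simp: act_minus\<close>)
  also have "\<dots> = (\<Prod>v\<in>?X. ?F v)" by (intro prod.cong) auto
  finally have 2: "(\<Prod>v\<in>?X. ?F v) = (\<Prod>v\<in>?X. ?F (act g v)) * (\<Prod>v\<in>?X. F (act g v))"
    by (simp add: prod.distrib)
  have "(\<Prod>v\<in>?X. ?F (act g v)) * (\<Prod>v\<in>?X. ?F (act g v)) = 1"
    unfolding prod.distrib[symmetric]
    by (intro prod.neutral) (use odd_sign_props(1)[OF F0] act_sphere[OF g] in auto)
  then show ?thesis unfolding 1 2 by (simp add: mult.assoc[symmetric])
qed

lemma spin_mult:
  assumes g: "g \<in> G" and h: "h \<in> G"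
  shows "spin (g * h) = spin g * spin h"
proof -
  let ?F = "coord_sign 0"
  have F0: "odd_sign sphere ?F" using n_pos by (intro odd_coord_sign) simp
  let ?Y = "{v. v \<in> sphere \<and> ?F v = 1}"
  have "spin (g * h) = (\<Prod>v\<in>?Y. (?F (act g (act h v)) * ?F (act h v)) * ?F (act h v))"
    unfolding spin_def
  proof (rule prod.cong[OF refl])
    fix v assume "v \<in> ?Y"
    then have "?F (act h v) * ?F (act h v) = 1" using odd_sign_props(1)[OF F0] act_sphere[OF h] by auto
    then show "?F (act (g * h) v) = (?F (act g (act h v)) * ?F (act h v)) * ?F (act h v)"
      using g h by (simp add: act_mult[of _ "2 * n" "2 * n" _ "2 * n"] G_carrier mult.assoc)
  qed
  also have "\<dots> = (\<Prod>v\<in>?Y. ?F (act g (act h v)) * ?F (act h v)) * spin h"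
    by (simp add: prod.distrib spin_def)
  also have "(\<Prod>v\<in>?Y. ?F (act g (act h v)) * ?F (act h v)) = (\<Prod>v\<in>?Y. ?F (act g v) * ?F v)"
    by (rule prod_even_half[OF F0 F0 bij_act_sphere[OF h], where e = "\<lambda>v. ?F (act g v) * ?F v"])
       (use odd_sign_props(2)[OF F0] act_sphere[OF g] in \<open>auto simp: act_minus\<close>)
  also have "\<dots> = spin g" unfolding spin_def by (intro prod.cong) auto
  finally show ?thesis .
qed

lemma spin_pm: "g \<in> G \<Longrightarrow> spin g = 1 \<or> spin g = - 1"
proof -
  assume g: "g \<in> G"
  have F0: "odd_sign sphere (coord_sign 0)" using n_pos by (intro odd_coord_sign) simp
  have "spin g * spin g = 1"
    unfolding spin_def prod.distrib[symmetric]
    by (intro prod.neutral) (use odd_sign_props(1)[OF F0] act_sphere[OF g] in auto)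
  then show ?thesis by (simp add: square_eq_1_iff)
qed

lemma spin_square: "g \<in> G \<Longrightarrow> spin (g * g) = 1"
  using spin_mult spin_pm by fastforce

lemma levi_mult:
  assumes "A \<in> carrier_mat n n" "D \<in> carrier_mat n n" "A' \<in> carrier_mat n n" "D' \<in> carrier_mat n n"
  shows "levi A D * levi A' D' = levi (A * A') (D * D')"
  unfolding levi_def using assms by (subst mult_blocks[where n = n]) auto

lemma act_scaling: "i < n \<Longrightarrow> act (scaling n i a) v = (\<lambda>j. if j < n then (if j = i then a else 1) * v j else 0)"
proof
  fix j assume "i < n"
  have "(\<Sum>k<n. scaling n i a $$ (j, k) * v k) = (\<Sum>k<n. if k = j then (if j = i then a else 1) * v j else 0)" if "j < n"
    using that by (intro sum.cong) (auto simp: scaling_def)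
  then show "act (scaling n i a) v j = (if j < n then (if j = i then a else 1) * v j else 0)"
    by (simp add: act_def scaling_def)
qed

lemma scaling_facts:
  assumes "i < n"
  shows "scaling n i a \<in> carrier_mat n n" "transpose_mat (scaling n i a) = scaling n i a"
    "a \<noteq> 0 \<Longrightarrow> transpose_mat (scaling n i a) * scaling n i (inverse a) = 1\<^sub>m n"
proof -
  show "scaling n i a \<in> carrier_mat n n" by (simp add: scaling_def)
  show t: "transpose_mat (scaling n i a) = scaling n i a" by (rule eq_matI) (auto simp: scaling_def)
  show "a \<noteq> 0 \<Longrightarrow> transpose_mat (scaling n i a) * scaling n i (inverse a) = 1\<^sub>m n"
    unfolding t by (simp add: scaling_mult[OF assms] scaling_one)
qed

abbreviation dilation :: "nat \<Rightarrow> 'a \<Rightarrow> 'a mat" where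
  "dilation i a \<equiv> levi (scaling n i a) (scaling n i (inverse a))"

lemma dilation_G: "i < n \<Longrightarrow> a \<noteq> 0 \<Longrightarrow> dilation i a \<in> G"
  by (intro levi_G scaling_facts)

text \<open>Compute with the sign that looks at the coordinates \<open>i\<close> and \<open>n + i\<close> last: it is unchanged by the
  dilation except on the hyperbola in the plane of these two coordinates, which is a copy of the
  multiplicative group.\<close>
lemma spin_dilation:
  assumes i: "i < n" and a: "a \<noteq> 0"
  shows "spin (dilation i a) = gauss_sign a"
proof -
  let ?d = "dilation i a" and ?F = "coord_sign i"
  let ?rest = "\<lambda>v j. j < 2 * n \<and> j \<noteq> i \<and> j \<noteq> n + i \<and> v j \<noteq> (0 :: 'a)"
  have actd: "act ?d v j = (if j < 2 * n then (if j = i then a else if j = n + i then inverse a else 1) * v j else 0)"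
    for v j
  proof -
    have c: "?d \<in> carrier_mat (2 * n) (2 * n)" using dilation_G[OF i a] by (rule G_carrier)
    have lohi: "lo n (act ?d v) = act (scaling n i a) (lo n v)" "hi n (act ?d v) = act (scaling n i (inverse a)) (hi n v)"
      unfolding levi_def act_four_block[OF scaling_facts(1)[OF i] zero_carrier_mat zero_carrier_mat scaling_facts(1)[OF i]]
      by (simp_all add: act_zero)
    consider "j < n" | "n \<le> j" "j < 2 * n" | "2 * n \<le> j" by linarith
    then show ?thesis
    proof cases
      case 1
      then show ?thesis using fun_cong[OF lohi(1), of j] i by (simp add: act_scaling[OF i] lo_def)
    next
      case 2
      then show ?thesis using fun_cong[OF lohi(2), of "j - n"] i by (auto simp: act_scaling[OF i] hi_def split: if_splits)
    next
      case 3
      then show ?thesis using act_in_Vn[OF c, of v] by (simp add: Vn_def)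
    qed
  qed
  have rest: "?rest (act ?d v) = ?rest v" for v by (auto simp: actd fun_eq_iff)
  let ?X = "{v. v \<in> sphere \<and> ?F v = 1}" and ?Y = "{v. v \<in> sphere \<and> \<not> (\<exists>j. ?rest v j) \<and> half_sign (v i)}"
  have "spin ?d = (\<Prod>v\<in>?X. ?F (act ?d v))" by (rule spin_indep[OF odd_coord_sign[OF i] dilation_G[OF i a]])
  also have "\<dots> = (\<Prod>v\<in>?Y. ?F (act ?d v))"
  proof (rule prod.mono_neutral_right)
    show "finite ?X" using finite_sphere by auto
    show "?Y \<subseteq> ?X" by (auto simp: coord_sign_def)
    show "\<forall>v\<in>?X - ?Y. ?F (act ?d v) = 1"
    proof
      fix v assume v: "v \<in> ?X - ?Y"
      then have ex: "\<exists>j. ?rest v j" by (auto simp: coord_sign_def split: if_splits)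
      have L: "?rest v (LEAST j. ?rest v j)" by (rule LeastI_ex[OF ex])
      have "?F (act ?d v) = sg (act ?d v (LEAST j. ?rest v j))"
        unfolding coord_sign_def rest using ex by simp
      also have "\<dots> = sg (v (LEAST j. ?rest v j))" using L by (simp add: actd)
      also have "\<dots> = ?F v" unfolding coord_sign_def using ex by simp
      finally show "?F (act ?d v) = 1" using v by simp
    qed
  qed
  also have "\<dots> = (\<Prod>v\<in>?Y. sg (a * v i))"
  proof (rule prod.cong[OF refl])
    fix v assume "v \<in> ?Y"
    then have nr: "\<not> (\<exists>j. ?rest v j)" by blast
    show "?F (act ?d v) = sg (a * v i)"
      unfolding coord_sign_def rest if_not_P[OF nr] using i by (simp add: actd)
  qed
  also have "\<dots> = (\<Prod>x\<in>pos_half. sg (a * x))"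
  proof (rule prod.reindex_bij_betw)
    let ?w = "\<lambda>x j. if j = i then x else if j = n + i then inverse x else (0 :: 'a)"
    have dots: "dot n (lo n v) (hi n v) = v i * v (n + i)" if "\<not> (\<exists>j. ?rest v j)" for v
    proof -
      have "dot n (lo n v) (hi n v) = (\<Sum>j<n. if j = i then v i * v (n + i) else 0)"
        unfolding dot_def
      proof (rule sum.cong[OF refl])
        fix x assume "x \<in> {..<n}"
        then show "lo n v x * hi n v x = (if x = i then v i * v (n + i) else 0)"
        proof (cases "x = i")
          case False
          moreover have "x < 2 * n" "x \<noteq> n + i" using \<open>x \<in> {..<n}\<close> by auto
          ultimately have "v x = 0" using that by blast
          then show ?thesis using False by (simp add: lo_def)
        qed (use i in \<open>simp add: lo_def hi_def\<close>)
      qed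
      then show ?thesis using i by simp
    qed
    show "bij_betw (\<lambda>v. v i) ?Y pos_half"
    proof (rule bij_betw_byWitness[where f' = ?w])
      show "\<forall>v\<in>?Y. ?w (v i) = v"
      proof
        fix v assume v: "v \<in> ?Y"
        then have "v i * v (n + i) = 1" using dots[of v] by (simp add: sphere_def)
        then have "v (n + i) = inverse (v i)" by (metis inverse_unique)
        moreover have "v j = 0" if "j \<noteq> i" "j \<noteq> n + i" for j
          using v that by (cases "j < 2 * n") (auto simp: sphere_def Vn_def)
        ultimately show "?w (v i) = v" by (auto simp: fun_eq_iff)
      qed
      show "\<forall>x\<in>pos_half. ?w x i = x" by simp
      show "(\<lambda>v. v i) ` ?Y \<subseteq> pos_half"
        using dots by (auto simp: pos_half_def sphere_def)
      show "?w ` pos_half \<subseteq> ?Y"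
      proof clarify
        fix x :: 'a assume x: "x \<in> pos_half"
        have nr: "\<not> (\<exists>j. ?rest (?w x) j)" by auto
        have "dot n (lo n (?w x)) (hi n (?w x)) = 1"
          using dots[OF nr] x i by (auto simp: pos_half_def)
        then show "?w x \<in> sphere \<and> \<not> (\<exists>j. ?rest (?w x) j) \<and> half_sign (?w x i)"
          using x i nr by (auto simp: sphere_def Vn_def pos_half_def)
      qed
    qed
  qed
  finally show ?thesis by (simp add: gauss_sign_def)
qed

lemma pm_character_gauss_sign: "pm_character (gauss_sign :: 'a \<Rightarrow> complex)"
  unfolding pm_character_def
proof (intro conjI allI impI)
  have n0: "0 < n" using n_pos by simp
  fix x y :: 'a assume "x \<noteq> 0"
  note sx = spin_dilation[OF n0 this, symmetric] and dx = dilation_G[OF n0 this]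
  show "gauss_sign x = 1 \<or> gauss_sign x = - 1" unfolding sx by (rule spin_pm[OF dx])
  assume "y \<noteq> 0"
  note sy = spin_dilation[OF n0 this, symmetric] and dy = dilation_G[OF n0 this]
  have "dilation 0 x * dilation 0 y = dilation 0 (x * y)"
    using n0 by (simp add: levi_mult scaling_facts scaling_mult mult.commute)
  then show "gauss_sign (x * y) = gauss_sign x * gauss_sign y"
    using spin_mult[OF dx dy] spin_dilation[OF n0, of "x * y"] \<open>x \<noteq> 0\<close> \<open>y \<noteq> 0\<close> unfolding sx sy by simp
qed

lemma right_inverse_unique:
  assumes "A \<in> carrier_mat n n" "D \<in> carrier_mat n n" "D' \<in> carrier_mat n n"
    "transpose_mat A * D = 1\<^sub>m n" "transpose_mat A * D' = 1\<^sub>m n"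
  shows "D = (D' :: 'a mat)"
proof -
  have "D * transpose_mat A = 1\<^sub>m n" using assms by (intro mat_mult_left_right_inverse[of "transpose_mat A" n D]) auto
  moreover have "D * (transpose_mat A * D') = D * transpose_mat A * D'"
    using assms by (intro assoc_mult_mat[symmetric]) auto
  ultimately show ?thesis using assms by simp
qed

lemma half_double: "c \<in> carrier_mat n n \<Longrightarrow> c * c = 0\<^sub>m n n \<Longrightarrow>
    (1\<^sub>m n + inverse 2 \<cdot>\<^sub>m c) * (1\<^sub>m n + inverse 2 \<cdot>\<^sub>m c) = 1\<^sub>m n + (c :: 'a mat)"
proof -
  assume c: "c \<in> carrier_mat n n" "c * c = 0\<^sub>m n n"
  have "inverse 2 + inverse 2 = (1 :: 'a)"
    using two_neq_0[OF q_odd] by (metis mult_2 right_inverse)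
  then show ?thesis using one_plus_mult[OF c, of "inverse 2" "inverse 2"] by (simp add: smult_one)
qed

lemma pm_character_square: "pm_character \<beta> \<Longrightarrow> x \<noteq> 0 \<Longrightarrow> \<beta> (x * x) = 1"
  unfolding pm_character_def by (metis mult_1 mult_minus1 minus_minus)

text \<open>Both sides are multiplicative in \<open>A\<close> and \<open>1\<close> on squares, so only the dilations have to be compared,
  where \<open>spin_dilation\<close> reduces the claim to the uniqueness of the quadratic character.\<close>
lemma spin_levi:
  fixes \<beta> :: "'a \<Rightarrow> complex"
  assumes \<beta>: "pm_character \<beta>" "\<exists>x. x \<noteq> 0 \<and> \<beta> x \<noteq> 1"
    and "A \<in> elem_gen n" "D \<in> carrier_mat n n" "transpose_mat A * D = 1\<^sub>m n"
  shows "spin (levi A D) = \<beta> (det A) \<and> det A \<noteq> 0"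
  using assms(3-5)
proof (induction A arbitrary: D)
  case (one_plus c)
  define h where "h = 1\<^sub>m n + inverse 2 \<cdot>\<^sub>m c"
  define k where "k = 1\<^sub>m n + (- inverse 2) \<cdot>\<^sub>m c"
  have hk: "h \<in> carrier_mat n n" "k \<in> carrier_mat n n" using one_plus(1) by (auto simp: h_def k_def)
  have hh: "h * h = 1\<^sub>m n + c" unfolding h_def by (rule half_double[OF one_plus(1,2)])
  have z: "1\<^sub>m n + (0 :: 'a) \<cdot>\<^sub>m c = 1\<^sub>m n" using one_plus(1) by (intro eq_matI) auto
  have kh: "k * h = 1\<^sub>m n" unfolding h_def k_def using one_plus_mult[OF one_plus(1,2), of "- inverse 2" "inverse 2"] z by simp
  then have t: "transpose_mat h * transpose_mat k = 1\<^sub>m n"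
    using transpose_mult[OF hk(2,1)] by simp
  let ?l = "levi h (transpose_mat k)"
  have lG: "?l \<in> G" using hk t by (intro levi_G) auto
  have "?l * ?l = levi (h * h) (transpose_mat k * transpose_mat k)"
    by (rule levi_mult) (use hk in auto)
  then have "?l * ?l = levi (1\<^sub>m n + c) (transpose_mat k * transpose_mat k)"
    unfolding hh .
  moreover have "transpose_mat k * transpose_mat k = D"
  proof (rule right_inverse_unique[of "1\<^sub>m n + c"])
    have "transpose_mat (1\<^sub>m n + c) * (transpose_mat k * transpose_mat k)
        = transpose_mat h * (transpose_mat h * transpose_mat k) * transpose_mat k"
      using hk by (simp add: hh[symmetric] transpose_mult[of _ n n _ n] assoc_mult_mat[of _ n n _ n _ n])
    then show "transpose_mat (1\<^sub>m n + c) * (transpose_mat k * transpose_mat k) = 1\<^sub>m n"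
      unfolding t using hk t by simp
  qed (use one_plus hk in auto)
  ultimately have 1: "spin (levi (1\<^sub>m n + c) D) = 1" using spin_square[OF lG] by simp
  have "det k * det h = 1" using det_mult[OF hk(2,1)] kh by simp
  then have "det h \<noteq> 0" by auto
  moreover have "det (1\<^sub>m n + c) = det h * det h" using det_mult[OF hk(1,1)] hh by simp
  ultimately show ?case using 1 pm_character_square[OF \<beta>(1)] by simp
next
  case (scaling k a)
  have "D = scaling n k (inverse a)"
    by (rule right_inverse_unique[OF scaling_facts(1)[OF scaling(1)] scaling.prems(1) scaling_facts(1)[OF scaling(1)]
          scaling.prems(2) scaling_facts(3)[OF scaling(1,2)]])
  moreover have "scaling n k a = multrow_mat n k a" by (auto simp: scaling_def multrow_mat_def)
  then have "det (scaling n k a) = a" using det_multrow_mat[OF scaling(1)] by simp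
  ultimately show ?case
    using spin_dilation[OF scaling(1,2)] scaling(2)
      quadratic_character_unique[OF q_odd pm_character_gauss_sign gauss_sign_nontrivial[OF q_odd] \<beta> scaling(2)] by simp
next
  case (mult x y)
  obtain x' y' where inv: "x' \<in> elem_gen n" "x' * x = 1\<^sub>m n" "y' \<in> elem_gen n" "y' * y = 1\<^sub>m n"
    using elem_gen_inverse[OF mult(1)] elem_gen_inverse[OF mult(2)] by blast
  note c = elem_gen_carrier[OF mult(1)] elem_gen_carrier[OF mult(2)] elem_gen_carrier[OF inv(1)] elem_gen_carrier[OF inv(3)]
  have t: "transpose_mat x * transpose_mat x' = 1\<^sub>m n" "transpose_mat y * transpose_mat y' = 1\<^sub>m n"
    using c inv by (simp_all add: transpose_mult[of _ n n _ n, symmetric])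
  have "transpose_mat (x * y) * (transpose_mat x' * transpose_mat y')
      = transpose_mat y * (transpose_mat x * transpose_mat x') * transpose_mat y'"
    using c by (simp add: transpose_mult[of _ n n _ n] assoc_mult_mat[of _ n n _ n _ n])
  also have "\<dots> = 1\<^sub>m n" unfolding t(1) using c t(2) by simp
  finally have D: "D = transpose_mat x' * transpose_mat y'"
    using c mult.prems right_inverse_unique[of "x * y" D "transpose_mat x' * transpose_mat y'"] by simp
  have IH: "spin (levi x (transpose_mat x')) = \<beta> (det x) \<and> det x \<noteq> 0"
    "spin (levi y (transpose_mat y')) = \<beta> (det y) \<and> det y \<noteq> 0"
    by (rule mult.IH(1)[OF _ t(1)] mult.IH(2)[OF _ t(2)], use c in simp)+
  have "levi (x * y) D = levi x (transpose_mat x') * levi y (transpose_mat y')"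
    unfolding D using c by (simp add: levi_mult)
  moreover have "levi x (transpose_mat x') \<in> G" "levi y (transpose_mat y') \<in> G"
    by (rule levi_G(1)[OF _ _ t(1)] levi_G(1)[OF _ _ t(2)]; use c in simp)+
  ultimately show ?case
    using IH \<beta>(1) det_mult[OF c(1,2)] by (simp add: spin_mult pm_character_def)
qed

lemma spin_unip: assumes B: "B \<in> skews" shows "spin (unip B) = 1"
proof -
  let ?C = "inverse 2 \<cdot>\<^sub>m B"
  have Bc: "B \<in> carrier_mat n n" by (rule skews_carrier[OF B])
  have "transpose_mat ?C = - ?C"
  proof (rule eq_matI)
    fix i j assume "i < dim_row (- ?C)" "j < dim_col (- ?C)"
    then have "i < n" "j < n" using Bc by auto
    moreover have "transpose_mat B $$ (i, j) = (- B) $$ (i, j)" using B by (simp add: skews_def)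
    ultimately show "transpose_mat ?C $$ (i, j) = (- ?C) $$ (i, j)" using Bc by auto
  qed (use Bc in auto)
  then have C: "?C \<in> skews" using Bc by (simp add: skews_def)
  have "inverse 2 + inverse 2 = (1 :: 'a)"
    using two_neq_0[OF q_odd] by (metis mult_2 right_inverse)
  then have "?C + ?C = B" using Bc by (intro eq_matI) (auto simp: distrib_right[symmetric])
  then have "unip ?C * unip ?C = unip B"
    unfolding unip_def using Bc by (subst mult_blocks[where n = n]) auto
  then show ?thesis using spin_square[OF unip_G[OF C]] by simp
qed

text \<open>An element of the parabolic subgroup is a Levi element times a unipotent one, and the latter is a square.\<close>
lemma spin_Siegel:
  fixes \<beta> :: "'a \<Rightarrow> complex"
  assumes \<beta>: "pm_character \<beta>" "\<exists>x. x \<noteq> 0 \<and> \<beta> x \<noteq> 1"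
    and b: "A \<in> carrier_mat n n" "B \<in> carrier_mat n n" "D \<in> carrier_mat n n"
    and p: "four_block_mat A B (0\<^sub>m n n) D \<in> G"
  shows "spin (four_block_mat A B (0\<^sub>m n n) D) = \<beta> (det A)"
proof -
  have AD: "transpose_mat A * D = 1\<^sub>m n"
    using sim_block_upper[OF p b] sim_1[OF p] by (simp add: smult_one)
  have DA: "transpose_mat D * A = 1\<^sub>m n"
    using transpose_mult[of "transpose_mat A" n n D n] b AD by simp
  have AD': "A * transpose_mat D = 1\<^sub>m n"
    using mat_mult_left_right_inverse[OF _ b(1) DA] b by simp
  let ?S = "transpose_mat D * B"
  have "transpose_mat ?S + ?S = 0\<^sub>m n n"
    using G_blocks(3)[OF p] b by (simp add: transpose_mult[of _ n n _ n])
  then have S: "?S \<in> skews" using skew_iff[of ?S] b by simp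
  have "levi A D * unip ?S = four_block_mat A (A * ?S) (0\<^sub>m n n) D"
    unfolding levi_def unip_def using b by (subst mult_blocks[where n = n]) auto
  also have "A * ?S = B" using b AD' by (simp add: assoc_mult_mat[of _ n n _ n _ n, symmetric])
  finally have eq: "four_block_mat A B (0\<^sub>m n n) D = levi A D * unip ?S" ..
  have "A \<in> elem_gen n" using b DA by (intro invertible_in_elem_gen[of A n "transpose_mat D"]) auto
  then have "spin (levi A D) = \<beta> (det A)" using spin_levi[OF \<beta> _ b(3) AD] by blast
  then show ?thesis
    unfolding eq using spin_mult[OF levi_G(1)[OF b(1,3) AD] unip_G[OF S]] spin_unip[OF S] by simp
qed

text \<open>For even \<open>n\<close> there is an invertible skew \<open>B\<close> with \<open>B\<^sup>2 = -1\<close>, and then \<open>levi B B * Jmat n\<close> is a product of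
  an upper, a lower and an upper unipotent matrix.\<close>
lemma spin_Jmat:
  fixes \<beta> :: "'a \<Rightarrow> complex"
  assumes \<beta>: "pm_character \<beta>" "\<exists>x. x \<noteq> 0 \<and> \<beta> x \<noteq> 1" and n: "n = 2 * m"
  shows "spin (Jmat n) = 1"
proof -
  define B :: "'a mat" where "B = four_block_mat (0\<^sub>m m m) (1\<^sub>m m) (- 1\<^sub>m m) (0\<^sub>m m m)"
  have Bc: "B \<in> carrier_mat n n" unfolding B_def n by (rule four_block_carrier) auto
  have "transpose_mat B = - B"
    unfolding B_def by (subst transpose_blocks[where n = m]) (auto intro!: eq_matI)
  then have Bs: "B \<in> skews" using Bc by (simp add: skews_def)
  have "B * B = four_block_mat (- 1\<^sub>m m) (0\<^sub>m m m) (0\<^sub>m m m) (- 1\<^sub>m m)"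
    unfolding B_def by (subst mult_blocks[where n = m]) auto
  also have "\<dots> = - 1\<^sub>m n" using n by (intro eq_matI) auto
  finally have BB: "B * B = - 1\<^sub>m n" .
  have "det B = det (0\<^sub>m m m * 0\<^sub>m m m - 1\<^sub>m m * (- 1\<^sub>m m))"
    unfolding B_def by (rule det_four_block_mat) auto
  also have "0\<^sub>m m m * 0\<^sub>m m m - 1\<^sub>m m * (- 1\<^sub>m m) = (1\<^sub>m m :: 'a mat)" by (intro eq_matI) auto
  finally have detB: "det B = 1" by simp
  have inv: "transpose_mat B * B = 1\<^sub>m n"
    using BB Bc unfolding \<open>transpose_mat B = - B\<close> by (simp add: uminus_mult_left_mat)
  have "spin (levi B B) = \<beta> (det B)"
    using spin_Siegel[OF \<beta> Bc _ Bc, of "0\<^sub>m n n"] levi_G(1)[OF Bc Bc inv] by (simp add: levi_def)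
  also have "\<beta> (det B) = 1" unfolding detB using pm_character_square[OF \<beta>(1), of 1] by simp
  finally have l: "spin (levi B B) = 1" .
  let ?J = "Jmat n :: 'a mat"
  have low: "?J * unip B * ?J = four_block_mat (1\<^sub>m n) (0\<^sub>m n n) B (1\<^sub>m n)"
    unfolding unip_def using Bc by (subst Jmat_mult_blocks, simp, subst Jmat_mult_blocks, auto)
  have "unip B * (?J * unip B * ?J) = four_block_mat (0\<^sub>m n n) B B (1\<^sub>m n)"
    unfolding low unfolding unip_def using Bc BB by (subst mult_blocks[where n = n]) auto
  then have "unip B * (?J * unip B * ?J) * unip B = four_block_mat (0\<^sub>m n n) B B (1\<^sub>m n) * unip B" by simp
  also have "\<dots> = four_block_mat (0\<^sub>m n n) B B (0\<^sub>m n n)"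
    unfolding unip_def using Bc BB by (subst mult_blocks[where n = n]) auto
  also have "\<dots> = levi B B * ?J"
    unfolding levi_def using Bc by (subst Jmat_mult_blocks) auto
  finally have "spin (levi B B * ?J) = spin (unip B * (?J * unip B * ?J) * unip B)" by simp
  also have "\<dots> = spin ?J * spin ?J"
    using Bs unip_G[OF Bs] Jmat_G by (simp add: spin_mult mult_G spin_unip)
  also have "\<dots> = 1" using spin_pm[OF Jmat_G] by auto
  finally show ?thesis using l levi_G(1)[OF Bc Bc inv] Jmat_G by (simp add: spin_mult)
qed

end

section \<open>Eigenvalues and diagonalizability from eigenvectors\<close>

text \<open>A maximal independent set of eigenvectors spans all eigenvectors, hence all their sums.\<close>
lemma diagonalizable_onI:
  fixes T :: "('b \<Rightarrow> complex) \<Rightarrow> 'b \<Rightarrow> complex"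
  assumes T: "Vector_Spaces.linear fscale fscale T" and V: "cfun.subspace V"
    and split: "\<And>f. f \<in> V \<Longrightarrow> \<exists>h. (\<forall>k<m::nat. h k \<in> V \<and> T (h k) = fscale (c k) (h k)) \<and> f = (\<Sum>k<m. h k)"
  shows "diagonalizable_on T V"
proof -
  interpret T: Vector_Spaces.linear fscale fscale T by (rule T)
  define S where "S = {f \<in> V. \<exists>c. T f = fscale c f}"
  obtain B where B: "B \<subseteq> S" "cfun.independent B" "S \<subseteq> cfun.span B"
    using cfun.maximal_independent_subset[of S] by blast
  have "cfun.span B \<subseteq> V" using B(1) by (intro cfun.span_minimal V) (auto simp: S_def)
  moreover have "f \<in> cfun.span B" if f: "f \<in> V" for f
  proof -
    obtain h where h: "\<And>k. k < m \<Longrightarrow> h k \<in> V \<and> T (h k) = fscale (c k) (h k)" and eq: "f = (\<Sum>k<m. h k)"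
      using split[OF f] by blast
    have "h k \<in> cfun.span B" if "k < m" for k using h[OF that] B(3) by (auto simp: S_def)
    then show ?thesis unfolding eq by (intro cfun.span_sum) auto
  qed
  moreover have "T f \<in> V" if f: "f \<in> V" for f
  proof -
    obtain h where h: "\<And>k. k < m \<Longrightarrow> h k \<in> V \<and> T (h k) = fscale (c k) (h k)" and eq: "f = (\<Sum>k<m. h k)"
      using split[OF f] by blast
    have "T f = (\<Sum>k<m. fscale (c k) (h k))" unfolding eq T.sum using h by (intro sum.cong) auto
    also have "\<dots> \<in> V" using h by (intro cfun.subspace_sum[OF V] cfun.subspace_scale[OF V]) auto
    finally show ?thesis .
  qed
  ultimately show ?thesis
    unfolding diagonalizable_on_def using B by (intro conjI exI[of _ B]) (auto simp: S_def)
qed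

text \<open>In an eigenbasis the eigenspace of \<open>d\<close> is spanned by the basis vectors with eigenvalue \<open>d\<close>.\<close>
lemma has_eigenvalue_mset_onI:
  fixes T :: "('b \<Rightarrow> complex) \<Rightarrow> 'b \<Rightarrow> complex"
  assumes T: "Vector_Spaces.linear fscale fscale T" and V: "cfun.subspace V"
    and h: "\<And>k. k < m \<Longrightarrow> h k \<in> V" "\<And>k. k < m \<Longrightarrow> T (h k) = fscale (c k) (h k)"
    and span: "\<And>f. f \<in> V \<Longrightarrow> \<exists>a. f = (\<Sum>k<m::nat. fscale (a k) (h k))"
    and indep: "\<And>a k. (\<Sum>k<m. fscale (a k) (h k)) = 0 \<Longrightarrow> k < m \<Longrightarrow> a k = 0"
  shows "has_eigenvalue_mset_on T V (image_mset c (mset_set {..<m}))"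
  unfolding has_eigenvalue_mset_on_def
proof (intro conjI allI)
  interpret T: Vector_Spaces.linear fscale fscale T by (rule T)
  have T_comb: "T (\<Sum>k<m. fscale (a k) (h k)) = (\<Sum>k<m. fscale (a k * c k) (h k))" for a
    unfolding T.sum by (intro sum.cong) (auto simp: T.scale h)
  show "T ` V \<subseteq> V"
  proof
    fix y assume "y \<in> T ` V"
    then obtain f where f: "f \<in> V" "y = T f" by blast
    obtain a where a: "f = (\<Sum>k<m. fscale (a k) (h k))" using span[OF f(1)] by blast
    show "y \<in> V" unfolding f(2) a T_comb
      using h by (intro cfun.subspace_sum[OF V] cfun.subspace_scale[OF V]) auto
  qed
  fix d
  let ?E = "{f \<in> V. T f = fscale d f}"
  define I where "I = {k. k < m \<and> c k = d}"
  have I: "finite I" "I \<subseteq> {..<m}" by (auto simp: I_def)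
  have extend: "(\<Sum>k\<in>I. fscale (a k) (h k)) = (\<Sum>k<m. fscale (if k \<in> I then a k else 0) (h k))" for a
    using I by (intro sum.mono_neutral_cong_left) auto
  have inj: "inj_on h {..<m}"
  proof (rule inj_onI, rule ccontr)
    fix i j assume ij: "i \<in> {..<m}" "j \<in> {..<m}" "h i = h j" "i \<noteq> j"
    have "(\<Sum>k<m. fscale ((if k = i then 1 else 0) - (if k = j then 1 else 0)) (h k))
        = (\<Sum>k<m. if k = i then h k else 0) - (\<Sum>k<m. if k = j then h k else 0)"
      unfolding sum_subtractf[symmetric]
      by (intro sum.cong) (auto simp: fscale_def fun_eq_iff)
    also have "\<dots> = 0" using ij by (simp add: sum.delta)
    finally show False using indep[of "\<lambda>k. (if k = i then 1 else 0) - (if k = j then 1 else 0)" i] ij by auto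
  qed
  have injI: "inj_on h I" using inj I(2) by (rule inj_on_subset)
  have ind: "cfun.independent (h ` I)"
  proof
    assume "cfun.dependent (h ` I)"
    then obtain u k where u: "k \<in> I" "u (h k) \<noteq> 0" "(\<Sum>v\<in>h ` I. fscale (u v) v) = 0"
      using cfun.dependent_finite[of "h ` I"] I(1) by auto
    have "(\<Sum>k\<in>I. fscale (u (h k)) (h k)) = 0" using u(3) by (simp add: sum.reindex[OF injI])
    then have "(if k \<in> I then u (h k) else 0) = 0"
      unfolding extend by (rule indep) (use u(1) I(2) in auto)
    then show False using u by simp
  qed
  have E: "cfun.subspace ?E"
    by (rule cfun.subspaceI)
       (auto simp: T.zero T.add T.scale cfun.scale_right_distrib mult.commute
         intro: cfun.subspace_0[OF V] cfun.subspace_add[OF V] cfun.subspace_scale[OF V])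
  have "?E \<subseteq> cfun.span (h ` I)"
  proof
    fix f assume f: "f \<in> ?E"
    then obtain a where a: "f = (\<Sum>k<m. fscale (a k) (h k))" using span by blast
    have "(\<Sum>k<m. fscale (a k * c k - d * a k) (h k)) = T f - fscale d f"
      unfolding a T_comb cfun.scale_sum_right sum_subtractf[symmetric]
      by (intro sum.cong) (auto simp: fscale_def fun_eq_iff algebra_simps)
    also have "\<dots> = 0" using f by simp
    finally have z: "(\<Sum>k<m. fscale (a k * c k - d * a k) (h k)) = 0" .
    have "a k * c k - d * a k = 0" if "k < m" for k by (rule indep[OF z that])
    then have "a k = 0" if "k < m" "k \<notin> I" for k using that by (auto simp: I_def algebra_simps)
    then have "f = (\<Sum>k<m. fscale (if k \<in> I then a k else 0) (h k))"
      unfolding a by (intro sum.cong) auto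
    also have "\<dots> = (\<Sum>k\<in>I. fscale (a k) (h k))" by (rule extend[symmetric])
    also have "\<dots> \<in> cfun.span (h ` I)"
      by (intro cfun.span_sum cfun.span_scale cfun.span_base) auto
    finally show "f \<in> cfun.span (h ` I)" .
  qed
  moreover have "h ` I \<subseteq> ?E" using h by (auto simp: I_def)
  ultimately have "cfun.dim ?E = card (h ` I)" using cfun.dim_unique[OF _ _ ind refl, of ?E] by blast
  also have "\<dots> = card I" by (rule card_image[OF injI])
  also have "\<dots> = count (image_mset c (mset_set {..<m})) d"
  proof -
    have "c -` {d} \<inter> {..<m} = I" by (auto simp: I_def)
    moreover have "(\<Sum>k\<in>I. count (mset_set {..<m}) k) = (\<Sum>k\<in>I. 1)"
      by (intro sum.cong) (auto simp: I_def)
    ultimately show ?thesis by (simp add: count_image_mset)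
  qed
  finally show "cfun.dim ?E = count (image_mset c (mset_set {..<m})) d" .
qed

section \<open>Twisting by a character of the group\<close>

context siegel
begin

definition extension :: "('a mat \<Rightarrow> complex) \<Rightarrow> ('a mat \<Rightarrow> complex) \<Rightarrow> bool" where
  "extension \<chi> \<theta> \<longleftrightarrow> (\<forall>g\<in>G. \<theta> g \<noteq> 0) \<and> (\<forall>g\<in>G. \<forall>h\<in>G. \<theta> (g * h) = \<theta> g * \<theta> h) \<and>
     (\<forall>p\<in>P. \<theta> p = \<chi> p) \<and> (\<forall>B\<in>skews. \<theta> (unip B) = 1)"

lemma extensionD:
  assumes "extension \<chi> \<theta>"
  shows "g \<in> G \<Longrightarrow> \<theta> g \<noteq> 0" "g \<in> G \<Longrightarrow> h \<in> G \<Longrightarrow> \<theta> (g * h) = \<theta> g * \<theta> h"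
    "p \<in> P \<Longrightarrow> \<theta> p = \<chi> p" "B \<in> skews \<Longrightarrow> \<theta> (unip B) = 1"
  using assms by (auto simp: extension_def)

end

context siegel_spectrum
begin

interpretation T: Vector_Spaces.linear fscale fscale T by (rule T_linear)

text \<open>A character \<open>\<theta>\<close> of \<open>G\<close> that extends \<open>\<chi>\<close> identifies the induced representation of the trivial
  character with that of \<open>\<chi>\<close>, and this changes the operator only by the factor \<open>\<theta> (Jmat n)\<close>.\<close>
lemma twisted_spectrum:
  assumes "extension \<chi> \<theta>"
  shows "diagonalizable_on T (Ind G n \<chi>)"
    and "eigenvalues_on T (Ind G n \<chi>) = (\<lambda>k. \<theta> (Jmat n) * mu k) ` {..n}"
    and "has_eigenvalue_mset_on T (Ind_eqv G n \<chi>) (image_mset (\<lambda>k. \<theta> (Jmat n) * mu k) (mset_set {..<Suc n}))"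
proof -
  note nz = extensionD(1)[OF assms] and hom = extensionD(2)[OF assms] and restr = extensionD(3)[OF assms]
    and triv = extensionD(4)[OF assms]
  let ?\<epsilon> = "\<theta> (Jmat n)"
  define tw where "tw = (\<lambda>f g. \<theta> g * f g)"
  define untw where "untw = (\<lambda>f g. f g / \<theta> g)"
  have T_tw: "T (tw f) = fscale ?\<epsilon> (tw (T f))" for f
  proof
    fix g
    have "\<theta> (Jmat n * unip B * g) = ?\<epsilon> * \<theta> g" if "B \<in> skews" "g \<in> G" for B
      using that by (simp add: hom Jmat_G unip_G mult_G triv)
    then show "T (tw f) g = fscale ?\<epsilon> (tw (T f)) g"
      by (simp add: T_eq tw_def fscale_apply sum_distrib_left ac_simps)
  qed
  have Ind_tw: "tw f \<in> Ind G n \<chi>" if "f \<in> Inv" for f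
    using that hom[OF P_G] restr by (auto simp: Ind_def Inv_iff tw_def)
  have Ind_untw: "untw f \<in> Inv" if "f \<in> Ind G n \<chi>" for f
    using that hom[OF P_G] restr nz[OF P_G] by (auto simp: Ind_def Inv_iff untw_def)
  have Eqv_tw: "tw f \<in> Ind_eqv G n \<chi>" if "f \<in> Eqv" for f
    using that Ind_tw hom[OF _ P_G] restr by (auto simp: Ind_eqv_def Eqv_iff tw_def)
  have Eqv_untw: "untw f \<in> Eqv" if "f \<in> Ind_eqv G n \<chi>" for f
    using that Ind_untw hom[OF _ P_G] restr nz[OF P_G] by (auto simp: Ind_eqv_def Eqv_iff untw_def)
  have tw_untw: "tw (untw f) = f" if "f \<in> Ind G n \<chi>" for f
    using that nz by (auto simp: Ind_def tw_def untw_def fun_eq_iff)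
  have tw_sum: "tw (\<Sum>k\<in>A. h k) = (\<Sum>k\<in>A. tw (h k))" for h :: "nat \<Rightarrow> _" and A
    by (rule ext) (simp add: tw_def sum_fun_apply sum_distrib_left)
  have tw_scale: "tw (fscale c f) = fscale c (tw f)" for c f
    by (auto simp: tw_def fscale_def fun_eq_iff)
  have tw_0: "f = 0" if "tw f = 0" "f \<in> Inv" for f
  proof
    fix g show "f g = 0 g"
      using fun_cong[OF that(1), of g] nz[of g] that(2) by (cases "g \<in> G") (auto simp: tw_def Inv_iff)
  qed
  have sub: "cfun.subspace (Ind G n \<chi>)" "cfun.subspace (Ind_eqv G n \<chi>)"
    by (rule cfun.subspaceI; auto simp: Ind_eqv_def Ind_def fscale_def algebra_simps)+
  show "diagonalizable_on T (Ind G n \<chi>)"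
  proof (rule diagonalizable_onI[OF T_linear sub(1), where m = "Suc n" and c = "\<lambda>k. ?\<epsilon> * mu k"])
    fix f assume f: "f \<in> Ind G n \<chi>"
    obtain h where h: "\<And>k. k < Suc n \<Longrightarrow> h k \<in> Inv \<and> T (h k) = fscale (mu k) (h k)" and eq: "untw f = (\<Sum>k<Suc n. h k)"
      using Inv_splits[OF Ind_untw[OF f]] by blast
    have "f = (\<Sum>k<Suc n. tw (h k))" using tw_untw[OF f] unfolding eq tw_sum by simp
    moreover have "tw (h k) \<in> Ind G n \<chi> \<and> T (tw (h k)) = fscale (?\<epsilon> * mu k) (tw (h k))" if "k < Suc n" for k
      using h[OF that] Ind_tw by (simp add: T_tw tw_scale)
    ultimately show "\<exists>h. (\<forall>k<Suc n. h k \<in> Ind G n \<chi> \<and> T (h k) = fscale (?\<epsilon> * mu k) (h k)) \<and> f = (\<Sum>k<Suc n. h k)"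
      by (intro exI[of _ "\<lambda>k. tw (h k)"] conjI allI impI) auto
  qed
  obtain h where h: "\<And>k. k < Suc n \<Longrightarrow> h k \<in> Eqv \<and> T (h k) = fscale (mu k) (h k)"
    and span: "\<And>f. f \<in> Eqv \<Longrightarrow> \<exists>a. f = (\<Sum>k<Suc n. fscale (a k) (h k))"
    and indep: "\<And>a k. (\<Sum>k<Suc n. fscale (a k) (h k)) = 0 \<Longrightarrow> k < Suc n \<Longrightarrow> a k = 0"
    using Eqv_eigenbasis by blast
  have tw_h: "T (tw (h k)) = fscale (?\<epsilon> * mu k) (tw (h k))" if "k < Suc n" for k
    using h[OF that] by (simp add: T_tw tw_scale)
  show "has_eigenvalue_mset_on T (Ind_eqv G n \<chi>) (image_mset (\<lambda>k. ?\<epsilon> * mu k) (mset_set {..<Suc n}))"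
  proof (rule has_eigenvalue_mset_onI[OF T_linear sub(2), where h = "\<lambda>k. tw (h k)"])
    show "tw (h k) \<in> Ind_eqv G n \<chi>" if "k < Suc n" for k using h[OF that] Eqv_tw by blast
    show "T (tw (h k)) = fscale (?\<epsilon> * mu k) (tw (h k))" if "k < Suc n" for k by (rule tw_h[OF that])
    fix f assume f: "f \<in> Ind_eqv G n \<chi>"
    obtain a where a: "untw f = (\<Sum>k<Suc n. fscale (a k) (h k))" using span[OF Eqv_untw[OF f]] by blast
    have "f = tw (untw f)" using f by (intro tw_untw[symmetric]) (simp add: Ind_eqv_def)
    also have "\<dots> = (\<Sum>k<Suc n. fscale (a k) (tw (h k)))" unfolding a tw_sum tw_scale ..
    finally show "\<exists>a. f = (\<Sum>k<Suc n. fscale (a k) (tw (h k)))" by blast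
  next
    fix a k assume z: "(\<Sum>k<Suc n. fscale (a k) (tw (h k))) = 0" and k: "k < Suc n"
    have "tw (\<Sum>k<Suc n. fscale (a k) (h k)) = 0" unfolding tw_sum tw_scale by (rule z)
    moreover have "(\<Sum>k<Suc n. fscale (a k) (h k)) \<in> Inv"
      using h Eqv_subset_Inv by (intro cfun.subspace_sum[OF subspace_Inv] cfun.subspace_scale[OF subspace_Inv]) auto
    ultimately have "(\<Sum>k<Suc n. fscale (a k) (h k)) = 0" by (rule tw_0)
    then show "a k = 0" using indep k by blast
  qed
  show "eigenvalues_on T (Ind G n \<chi>) = (\<lambda>k. ?\<epsilon> * mu k) ` {..n}"
  proof (intro equalityI subsetI)
    fix c assume "c \<in> eigenvalues_on T (Ind G n \<chi>)"
    then obtain f where f: "f \<in> Ind G n \<chi>" "f \<noteq> 0" "T f = fscale c f" by (auto simp: eigenvalues_on_def)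
    let ?f = "untw f"
    have e0: "?\<epsilon> \<noteq> 0" by (rule nz[OF Jmat_G])
    have eq: "fscale ?\<epsilon> (tw (T ?f)) = fscale c (tw ?f)"
      using T_tw[of ?f] f by (simp add: tw_untw)
    have "T ?f g = fscale (c / ?\<epsilon>) ?f g" for g
    proof (cases "g \<in> G")
      case True
      then show ?thesis using fun_cong[OF eq, of g] nz[OF True] e0 by (simp add: fscale_def tw_def field_simps)
    next
      case False
      then show ?thesis using T_Inv[OF Ind_untw[OF f(1)]] Ind_untw[OF f(1)] by (simp add: Inv_iff fscale_def)
    qed
    then have "T ?f = fscale (c / ?\<epsilon>) ?f" by blast
    moreover have "?f \<noteq> 0"
    proof
      assume "?f = 0"
      then have "f = tw 0" using tw_untw[OF f(1)] by simp
      then show False using f(2) by (simp add: tw_def fun_eq_iff)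
    qed
    ultimately obtain k where "k \<le> n" "c / ?\<epsilon> = mu k" using eigenvalue_cases[OF Ind_untw[OF f(1)]] by blast
    then show "c \<in> (\<lambda>k. ?\<epsilon> * mu k) ` {..n}" using e0 by (auto simp: field_simps)
  next
    fix c assume "c \<in> (\<lambda>k. ?\<epsilon> * mu k) ` {..n}"
    then obtain k where "k \<in> {..n}" "c = ?\<epsilon> * mu k" by (rule imageE)
    then have k: "k < Suc n" "c = ?\<epsilon> * mu k" by simp_all
    have hk: "h k \<noteq> 0"
    proof
      assume h0: "h k = 0"
      have "(\<Sum>j<Suc n. fscale (if j = k then 1 else 0) (h j)) = 0"
        using h0 by (intro sum.neutral) (auto simp: fscale_def fun_eq_iff)
      then have "(if k = k then 1 else 0 :: complex) = 0" using indep[of "\<lambda>j. if j = k then 1 else 0" k] k(1) by blast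
      then show False by simp
    qed
    have "h k \<in> Inv" using h[OF k(1)] Eqv_subset_Inv by blast
    then have "tw (h k) \<noteq> 0" "tw (h k) \<in> Ind G n \<chi>" using tw_0 hk Ind_tw by auto
    then show "c \<in> eigenvalues_on T (Ind G n \<chi>)"
      unfolding eigenvalues_on_def using tw_h[OF k(1)] k(2) by blast
  qed
qed

lemma two_choose_sum: "2 * (k choose 2) + k = k * k" for k :: nat
  by (induction k) (auto simp: numeral_2_eq_2)

lemma choose_sum_even: "j \<le> m \<Longrightarrow> ((m + j) choose 2) + ((m - j) choose 2) = m * (m - 1) + j\<^sup>2" for m :: nat
proof -
  assume j: "j \<le> m"
  then obtain d where d: "m = j + d" by (metis le_add_diff_inverse)
  have "m * (m - 1) + m = m * m" by (cases m) auto
  moreover have "2 * ((m + j) choose 2) + (m + j) = (m + j) * (m + j)" "2 * (d choose 2) + d = d * d"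
    by (rule two_choose_sum)+
  ultimately show ?thesis unfolding d by (simp add: power2_eq_square algebra_simps)
qed

lemma choose_sum_odd: "i \<le> m \<Longrightarrow> ((m - i) choose 2) + ((m + 1 + i) choose 2) = m\<^sup>2 + i * (i + 1)" for m :: nat
proof -
  assume i: "i \<le> m"
  then obtain d where d: "m = i + d" by (metis le_add_diff_inverse)
  have "2 * ((m + 1 + i) choose 2) + (m + 1 + i) = (m + 1 + i) * (m + 1 + i)" "2 * (d choose 2) + d = d * d"
    by (rule two_choose_sum)+
  then show ?thesis unfolding d by (simp add: power2_eq_square algebra_simps)
qed

lemma minus_one_power_parity: "j \<le> m \<Longrightarrow> (- 1 :: complex) ^ (m + j) = (- 1) ^ (m - j)"
proof -
  assume "j \<le> m"
  then have "m + j = (m - j) + 2 * j" by simp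
  then show ?thesis by (metis (no_types) mult.right_neutral power_add power_mult power_one power2_minus one_power2)
qed

text \<open>The index \<open>i\<close> corresponds to \<open>k = m - i div 2\<close> or \<open>k = m + i div 2\<close>; these two values of \<open>k\<close> have the same parity and
  are exchanged by \<open>k \<mapsto> n - k\<close>, which preserves the exponent.\<close>
lemma mu_mset_even:
  assumes n: "n = 2 * m"
  shows "image_mset mu (mset_set {..<Suc n})
    = image_mset (\<lambda>i. (- 1) ^ (m - i div 2) * q ^ (m * (m - 1) + (i div 2)\<^sup>2)) (mset_set {1..n + 1})"
proof -
  define \<sigma> where "\<sigma> = (\<lambda>i :: nat. if even i then m - i div 2 else m + i div 2)"
  have "bij_betw \<sigma> {1..n + 1} {..<Suc n}"
  proof (rule bij_betw_byWitness[where f' = "\<lambda>k. if k < m then 2 * (m - k) else 2 * (k - m) + 1"])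
    show "\<forall>i\<in>{1..n + 1}. (if \<sigma> i < m then 2 * (m - \<sigma> i) else 2 * (\<sigma> i - m) + 1) = i"
      using n by (auto simp: \<sigma>_def elim!: evenE oddE)
    show "\<forall>k\<in>{..<Suc n}. \<sigma> (if k < m then 2 * (m - k) else 2 * (k - m) + 1) = k"
      by (auto simp: \<sigma>_def)
    show "\<sigma> ` {1..n + 1} \<subseteq> {..<Suc n}" using n by (auto simp: \<sigma>_def)
    show "(\<lambda>k. if k < m then 2 * (m - k) else 2 * (k - m) + 1) ` {..<Suc n} \<subseteq> {1..n + 1}" using n by auto
  qed
  then have "mset_set {..<Suc n} = image_mset \<sigma> (mset_set {1..n + 1})"
    by (metis bij_betw_def image_mset_mset_set)
  then have "image_mset mu (mset_set {..<Suc n}) = image_mset (mu \<circ> \<sigma>) (mset_set {1..n + 1})"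
    by (simp only: multiset.map_comp)
  note 1 = this
  have e: "mu (\<sigma> i) = (- 1) ^ (m - i div 2) * q ^ (m * (m - 1) + (i div 2)\<^sup>2)" if "i \<in> {1..n + 1}" for i
  proof -
    have le: "i div 2 \<le> m" using that n by auto
    have "n - (m - i div 2) = m + i div 2" "n - (m + i div 2) = m - i div 2" using n le by auto
    then show ?thesis
      using choose_sum_even[OF le] minus_one_power_parity[OF le] by (auto simp: \<sigma>_def mu_def add.commute)
  qed
  have "image_mset (mu \<circ> \<sigma>) (mset_set {1..n + 1})
      = image_mset (\<lambda>i. (- 1) ^ (m - i div 2) * q ^ (m * (m - 1) + (i div 2)\<^sup>2)) (mset_set {1..n + 1})"
  proof (rule image_mset_cong)
    fix i assume "i \<in># mset_set {1..n + 1}"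
    then have "i \<in> {1..n + 1}" by simp
    from e[OF this] show "(mu \<circ> \<sigma>) i = (- 1) ^ (m - i div 2) * q ^ (m * (m - 1) + (i div 2)\<^sup>2)"
      by (simp only: o_apply)
  qed
  with 1 show ?thesis by (rule trans)
qed

text \<open>For odd \<open>n\<close> the involution \<open>k \<mapsto> n - k\<close> preserves the exponent and reverses the sign, so that the set of
  eigenvalues is symmetric and a global sign \<open>\<epsilon>\<close> is harmless.\<close>
lemma mu_set_odd:
  assumes n: "n = 2 * m + 1" and \<epsilon>: "\<epsilon> = 1 \<or> \<epsilon> = - 1"
  shows "(\<lambda>k. \<epsilon> * mu k) ` {..n} = (\<Union>i\<in>{0..m}. {q ^ (m\<^sup>2 + i * (i + 1)), - (q ^ (m\<^sup>2 + i * (i + 1)))})"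
proof -
  have "{..n} = (\<Union>i\<in>{0..m}. {m - i, m + 1 + i})"
  proof (intro equalityI subsetI)
    fix k assume k: "k \<in> {..n}"
    show "k \<in> (\<Union>i\<in>{0..m}. {m - i, m + 1 + i})"
    proof (cases "k \<le> m")
      case True
      then show ?thesis by (intro UN_I[of "m - k"]) auto
    next
      case False
      then show ?thesis using k n by (intro UN_I[of "k - (m + 1)"]) auto
    qed
  qed (use n in auto)
  then have "(\<lambda>k. \<epsilon> * mu k) ` {..n} = (\<Union>i\<in>{0..m}. {\<epsilon> * mu (m - i), \<epsilon> * mu (m + 1 + i)})"
    by (simp add: image_UN)
  also have "\<dots> = (\<Union>i\<in>{0..m}. {q ^ (m\<^sup>2 + i * (i + 1)), - (q ^ (m\<^sup>2 + i * (i + 1)))})"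
  proof (intro SUP_cong refl)
    fix i assume "i \<in> {0..m}"
    then have i: "i \<le> m" by simp
    have d: "n - (m - i) = m + 1 + i" "n - (m + 1 + i) = m - i" using n i by auto
    have "(- 1 :: complex) ^ (m + 1 + i) = - ((- 1) ^ (m - i))"
      using minus_one_power_parity[OF i] by simp
    then have "mu (m - i) = (- 1) ^ (m - i) * q ^ (m\<^sup>2 + i * (i + 1))"
      "mu (m + 1 + i) = - ((- 1) ^ (m - i) * q ^ (m\<^sup>2 + i * (i + 1)))"
      using choose_sum_odd[OF i] d by (simp_all only: mu_def add.commute[of "(m + 1 + i) choose 2"]) simp_all
    moreover have "(- 1 :: complex) ^ (m - i) = 1 \<or> (- 1 :: complex) ^ (m - i) = - 1"
      by (cases "even (m - i)") auto
    ultimately show "{\<epsilon> * mu (m - i), \<epsilon> * mu (m + 1 + i)} = {q ^ (m\<^sup>2 + i * (i + 1)), - (q ^ (m\<^sup>2 + i * (i + 1)))}"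
      using \<epsilon> by auto
  qed
  finally show ?thesis .
qed

end

context siegel
begin

lemma multiplier_P:
  assumes p: "p \<in> P"
  shows "multiplier n p = sim p"
proof -
  obtain A B D where b: "A \<in> carrier_mat n n" "B \<in> carrier_mat n n" "D \<in> carrier_mat n n"
    and pe: "p = four_block_mat A B (0\<^sub>m n n) D" using p unfolding Siegel_def by auto
  let ?l = "sim p"
  have l0: "?l \<noteq> 0" by (rule gram_G(3)[OF P_G[OF p]])
  have AD: "transpose_mat A * D = ?l \<cdot>\<^sub>m 1\<^sub>m n"
    using sim_block_upper[of A B D] P_G[OF p] b unfolding pe by blast
  have "transpose_mat D * A = transpose_mat (transpose_mat A * D)"
    using b by (simp add: transpose_mult[of _ n n _ n])
  also have "\<dots> = ?l \<cdot>\<^sub>m 1\<^sub>m n" unfolding AD by (intro eq_matI) auto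
  finally have DA: "transpose_mat D * A = ?l \<cdot>\<^sub>m 1\<^sub>m n" .
  define A0 where "A0 = inverse ?l \<cdot>\<^sub>m A"
  have A0c: "A0 \<in> carrier_mat n n" using b by (simp add: A0_def)
  have A0: "?l \<cdot>\<^sub>m A0 = A" using l0 by (simp add: A0_def smult_smult_times smult_one)
  have DA0: "transpose_mat D * A0 = 1\<^sub>m n"
    using b l0 by (simp add: A0_def mult_smult_distrib[of _ n n _ n] DA smult_smult_times smult_one)
  have A0D: "A0 * transpose_mat D = 1\<^sub>m n"
    using mat_mult_left_right_inverse[OF _ A0c DA0] b by simp
  show ?thesis
    unfolding multiplier_def
  proof (rule the_equality)
    show "?l \<noteq> 0 \<and> (\<exists>A A' B. A \<in> carrier_mat n n \<and> A' \<in> carrier_mat n n \<and> B \<in> carrier_mat n n \<and>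
        A * A' = 1\<^sub>m n \<and> A' * A = 1\<^sub>m n \<and> p = four_block_mat (?l \<cdot>\<^sub>m A) B (0\<^sub>m n n) (transpose_mat A'))"
      by (rule conjI[OF l0], rule exI[of _ A0], rule exI[of _ "transpose_mat D"], rule exI[of _ B])
         (use A0c b A0D DA0 in \<open>auto simp: A0 pe[symmetric]\<close>)
  next
    fix k
    assume "k \<noteq> 0 \<and> (\<exists>A A' B. A \<in> carrier_mat n n \<and> A' \<in> carrier_mat n n \<and> B \<in> carrier_mat n n \<and>
        A * A' = 1\<^sub>m n \<and> A' * A = 1\<^sub>m n \<and> p = four_block_mat (k \<cdot>\<^sub>m A) B (0\<^sub>m n n) (transpose_mat A'))"
    then obtain A1 A1' B1 where k: "A1 \<in> carrier_mat n n" "A1' \<in> carrier_mat n n" "B1 \<in> carrier_mat n n"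
      "A1' * A1 = 1\<^sub>m n" "p = four_block_mat (k \<cdot>\<^sub>m A1) B1 (0\<^sub>m n n) (transpose_mat A1')" by blast
    have bl: "blocks n A B (0\<^sub>m n n) D" "blocks n (k \<cdot>\<^sub>m A1) B1 (0\<^sub>m n n) (transpose_mat A1')"
      using b k by auto
    have "A = k \<cdot>\<^sub>m A1" "D = transpose_mat A1'"
      using four_block_eqD[OF bl] k(5) pe by auto
    then have "transpose_mat D * A = k \<cdot>\<^sub>m 1\<^sub>m n"
      using k by (simp add: mult_smult_distrib[of _ n n _ n])
    then have "(k \<cdot>\<^sub>m 1\<^sub>m n) $$ (0, 0) = (?l \<cdot>\<^sub>m (1\<^sub>m n :: 'a mat)) $$ (0, 0)" unfolding DA by simp
    then show "k = ?l" using n_pos by simp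
  qed
qed

lemma chi_det_block:
  assumes "A \<in> carrier_mat n n" "B \<in> carrier_mat n n" "D \<in> carrier_mat n n"
  shows "chi_det n (four_block_mat A B (0\<^sub>m n n) D) = inverse (det D)"
  using split_block_four_block[of A n B "0\<^sub>m n n" D] assms by (simp add: chi_det_def)

lemma Jmat_conj_levi:
  assumes "A \<in> carrier_mat n n" "D \<in> carrier_mat n n"
  shows "Jmat n * levi A D * Jmat n = levi D A"
  unfolding levi_def using assms by (subst Jmat_mult_blocks, simp, subst Jmat_mult_blocks, auto)

text \<open>Dropping the unipotent part changes neither factor of \<open>\<chi>\<close>, and conjugation by \<open>Jmat n\<close> does not
  change \<open>\<theta>\<close>.\<close>
lemma char_J_eq:
  assumes ext: "extension \<chi> \<theta>" and \<chi>: "\<And>p. p \<in> P \<Longrightarrow> \<chi> p = \<alpha> (multiplier n p) * \<beta> (chi_det n p)"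
    and p: "p \<in> P"
  shows "char_J n \<chi> p = \<chi> p"
proof -
  note nz = extensionD(1)[OF ext] and hom = extensionD(2)[OF ext] and restr = extensionD(3)[OF ext]
  obtain A B D where b: "A \<in> carrier_mat n n" "B \<in> carrier_mat n n" "D \<in> carrier_mat n n"
    and pe: "p = four_block_mat A B (0\<^sub>m n n) D" using p unfolding Siegel_def by auto
  have l: "transpose_mat A * D = sim p \<cdot>\<^sub>m 1\<^sub>m n"
    using sim_block_upper[of A B D] P_G[OF p] b unfolding pe by blast
  have LG: "levi A D \<in> G"
    unfolding levi_def by (rule block_G[OF _ gram_G(2)[OF P_G[OF p]]]) (use b l in simp_all)
  have LP: "levi A D \<in> P"
    unfolding Siegel_def using LG b by (simp add: levi_def) (intro exI[of _ A] exI[of _ "0\<^sub>m n n"] exI[of _ D] conjI, simp_all)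
  have "sim (levi A D) \<cdot>\<^sub>m 1\<^sub>m n = sim p \<cdot>\<^sub>m (1\<^sub>m n :: 'a mat)"
    using sim_block_upper[of A "0\<^sub>m n n" D] LG b l by (simp add: levi_def)
  then have "(sim (levi A D) \<cdot>\<^sub>m 1\<^sub>m n) $$ (0, 0) = (sim p \<cdot>\<^sub>m (1\<^sub>m n :: 'a mat)) $$ (0, 0)" by simp
  then have s: "sim (levi A D) = sim p" using n_pos by simp
  have "\<chi> p = \<chi> (levi A D)"
    unfolding \<chi>[OF p] \<chi>[OF LP] multiplier_P[OF p] multiplier_P[OF LP] s
    using b by (simp add: pe levi_def chi_det_block)
  also have "\<dots> = \<theta> (levi A D)" using restr[OF LP] by simp
  also have "\<dots> = \<theta> (Jmat n * levi A D * Jmat n)"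
  proof -
    have "\<theta> (Jmat n) * \<theta> (Jmat n) * \<theta> (Jmat n) = \<theta> (Jmat n)"
      using hom[OF Jmat_G Jmat_G] hom[OF one_G Jmat_G] by (simp add: Jmat_sq left_mult_one_mat[of _ "2 * n" "2 * n"])
    then have "\<theta> (Jmat n) * \<theta> (Jmat n) = 1" using nz[OF Jmat_G] by simp
    then show ?thesis using LG by (simp add: hom mult_G Jmat_G)
  qed
  also have "\<dots> = \<theta> (levi D A)" using b by (simp add: Jmat_conj_levi)
  also have "\<dots> = \<chi> (levi D A)"
  proof (rule restr)
    have "levi D A \<in> G" using mult_G[OF mult_G[OF Jmat_G LG] Jmat_G] b by (simp add: Jmat_conj_levi)
    then show "levi D A \<in> P"
      unfolding Siegel_def using b by (simp add: levi_def) (intro exI[of _ D] exI[of _ "0\<^sub>m n n"] exI[of _ A] conjI, simp_all)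
  qed
  also have "\<dots> = char_J n \<chi> p"
    using b split_block_four_block[of A n B "0\<^sub>m n n" D] by (simp add: char_J_def pe levi_def)
  finally show ?thesis ..
qed

end

section \<open>Spectrum of the intertwining operator\<close>

lemma (in siegel) sim_unip: "B \<in> skews \<Longrightarrow> sim (unip B) = 1"
proof -
  assume B: "B \<in> skews"
  have "sim (unip B) \<cdot>\<^sub>m 1\<^sub>m n = (1\<^sub>m n :: 'a mat)"
    using sim_block_upper[of "1\<^sub>m n" B "1\<^sub>m n"] unip_G[OF B] skews_carrier[OF B] by (simp add: unip_def)
  then have "(sim (unip B) \<cdot>\<^sub>m (1\<^sub>m n :: 'a mat)) $$ (0, 0) = (1\<^sub>m n :: 'a mat) $$ (0, 0)" by simp
  then show ?thesis using n_pos by simp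
qed

text \<open>With \<open>\<beta>\<close> trivial, \<open>\<chi>\<close> depends only on the multiplier, which is the restriction of the similitude factor.\<close>
lemma (in siegel) extension_similitude:
  assumes \<alpha>: "mult_char (UNIV - {0}) \<alpha>" and \<beta>: "\<forall>x. x \<noteq> 0 \<longrightarrow> \<beta> x = 1"
    and \<chi>: "\<And>p. p \<in> P \<Longrightarrow> \<chi> p = \<alpha> (multiplier n p) * \<beta> (chi_det n p)"
  shows "extension \<chi> (\<lambda>g. \<alpha> (sim g)) \<and> \<alpha> (sim (Jmat n)) = 1"
proof -
  have a: "\<alpha> x \<noteq> 0" "y \<noteq> 0 \<Longrightarrow> \<alpha> (x * y) = \<alpha> x * \<alpha> y" if "x \<noteq> 0" for x y
    using \<alpha> that by (auto simp: mult_char_def)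
  have a1: "\<alpha> 1 = 1" using a(1)[of 1] a(2)[of 1 1] by simp
  have "\<alpha> (sim p) = \<chi> p" if p: "p \<in> P" for p
  proof -
    obtain A B D where b: "A \<in> carrier_mat n n" "B \<in> carrier_mat n n" "D \<in> carrier_mat n n"
      and pe: "p = four_block_mat A B (0\<^sub>m n n) D" using p unfolding Siegel_def by auto
    have "det (transpose_mat A * D) = det (sim p \<cdot>\<^sub>m (1\<^sub>m n :: 'a mat))"
      using sim_block_upper[of A B D] P_G[OF p] b by (simp add: pe)
    then have "det (transpose_mat A) * det D \<noteq> 0"
      using det_mult[of "transpose_mat A" n D] b gram_G(3)[OF P_G[OF p]] by (simp add: det_smult)
    then have "det D \<noteq> 0" by auto
    moreover have "chi_det n p = inverse (det D)" using b by (simp add: pe chi_det_block)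
    ultimately show ?thesis unfolding \<chi>[OF p] multiplier_P[OF p] using \<beta> by simp
  qed
  moreover have "sim (Jmat n) = 1"
    by (rule sim_eqI) (simp add: Jmat_sq smult_one left_mult_one_mat[of _ "2 * n" "2 * n"])
  ultimately show ?thesis
    using a gram_G(3) a1 by (auto simp: extension_def sim_mult sim_unip)
qed

text \<open>With \<open>\<beta>\<close> quadratic, \<open>\<chi>\<close> is the restriction of the spinor norm. Its value at \<open>Jmat n\<close> matters only for
  even \<open>n\<close>, by \<open>mu_set_odd\<close>.\<close>
lemma (in orth) extension_spin:
  assumes \<alpha>: "mult_char (UNIV - {0}) \<alpha>" and \<beta>: "pm_character \<beta>" "\<exists>x. x \<noteq> 0 \<and> \<beta> x \<noteq> 1"
    and \<chi>: "\<And>p. p \<in> P \<Longrightarrow> \<chi> p = \<alpha> (multiplier n p) * \<beta> (chi_det n p)"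
  shows "extension \<chi> spin \<and> (spin (Jmat n) = 1 \<or> odd n \<and> spin (Jmat n) = - 1)"
proof -
  have a: "\<alpha> x \<noteq> 0" "y \<noteq> 0 \<Longrightarrow> \<alpha> (x * y) = \<alpha> x * \<alpha> y" if "x \<noteq> 0" for x y
    using \<alpha> that by (auto simp: mult_char_def)
  have a1: "\<alpha> 1 = 1" using a(1)[of 1] a(2)[of 1 1] by simp
  have "spin p = \<chi> p" if p: "p \<in> P" for p
  proof -
    have pG: "p \<in> G" by (rule P_G[OF p])
    obtain A B D where b: "A \<in> carrier_mat n n" "B \<in> carrier_mat n n" "D \<in> carrier_mat n n"
      and pe: "p = four_block_mat A B (0\<^sub>m n n) D" using p unfolding Siegel_def by auto
    have sp: "sim p = 1" by (rule sim_1[OF pG])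
    have "transpose_mat A * D = 1\<^sub>m n"
      using sim_block_upper[of A B D] pG b sp by (simp add: pe smult_one)
    then have "det A * det D = 1"
      using det_mult[of "transpose_mat A" n D] b det_transpose[OF b(1)] by simp
    then have "inverse (det D) = det A" by (metis inverse_unique mult.commute)
    then have "chi_det n p = det A" using b by (simp add: pe chi_det_block)
    then have "\<chi> p = \<beta> (det A)"
      unfolding \<chi>[OF p] multiplier_P[OF p] sp a1 by simp
    then show ?thesis using spin_Siegel[OF \<beta> b] pG by (simp add: pe)
  qed
  moreover have "spin g \<noteq> 0" if "g \<in> G" for g using spin_pm[OF that] by auto
  moreover have "spin (Jmat n) = 1 \<or> odd n \<and> spin (Jmat n) = - 1"
    using spin_Jmat[OF \<beta>] spin_pm[OF Jmat_G] by (auto elim: evenE)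
  ultimately show ?thesis by (auto simp: extension_def spin_mult spin_unip)
qed

theorem theorem4p4p1:
  fixes n :: nat
    and G :: "'a::{finite,field} mat set"
    and \<chi> :: "'a mat \<Rightarrow> complex"
    and \<alpha> \<beta> :: "'a \<Rightarrow> complex"
  assumes q_odd: "odd CARD('a)"
    and q_not3: "\<not> 3 dvd CARD('a)"
    and n_pos: "n \<ge> 1"
    and G: "G = GO n \<or> G = Orth n"
    and \<chi>: "mult_char (Siegel G n) \<chi>"
    and \<alpha>: "mult_char (UNIV - {0}) \<alpha>"
    and \<beta>: "mult_char (UNIV - {0}) \<beta>"
    and \<chi>_eq: "\<forall>p \<in> Siegel G n. \<chi> p = \<alpha> (multiplier n p) * \<beta> (chi_det n p)"
    and \<beta>_cond: "(\<forall>x. x \<noteq> 0 \<longrightarrow> \<beta> x = 1) \<or> ((\<forall>x. x \<noteq> 0 \<longrightarrow> (\<beta> x)\<^sup>2 = 1) \<and> G = Orth n)"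
  shows "(\<forall>p \<in> Siegel G n. char_J n \<chi> p = \<chi> p) \<and>
    (\<forall>m. n = 2 * m \<longrightarrow>
      (let M = image_mset
                 (\<lambda>i. (- 1) ^ (m - i div 2) * of_nat CARD('a) ^ (m * (m - 1) + (i div 2)\<^sup>2))
                 (mset_set {1..n + 1})
       in diagonalizable_on (intertwiner G n) (Ind G n \<chi>) \<and>
          has_eigenvalue_mset_on (intertwiner G n) (Ind_eqv G n \<chi>) M \<and>
          eigenvalues_on (intertwiner G n) (Ind G n \<chi>) = set_mset M)) \<and>
    (\<forall>m. n = 2 * m + 1 \<longrightarrow>
      diagonalizable_on (intertwiner G n) (Ind G n \<chi>) \<and>
      eigenvalues_on (intertwiner G n) (Ind G n \<chi>) =
        (\<Union>i\<in>{0..m}. {of_nat CARD('a) ^ (m\<^sup>2 + i * (i + 1)), - (of_nat CARD('a) ^ (m\<^sup>2 + i * (i + 1)))}))"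
proof -
  obtain M :: "'a set" where s: "siegel n M" and GM: "G = siegel.G n M"
    and \<beta>M: "(\<forall>x. x \<noteq> 0 \<longrightarrow> \<beta> x = 1) \<or> ((\<forall>x. x \<noteq> 0 \<longrightarrow> (\<beta> x)\<^sup>2 = 1) \<and> M = {1})"
  proof (cases "G = Orth n")
    case True
    then show ?thesis
      using that[of "{1}"] Orth_eq[OF n_pos q_odd] \<beta>_cond n_pos q_odd by (auto simp: siegel_def)
  next
    case False
    then show ?thesis
      using that[of "UNIV - {0}"] GO_eq[OF n_pos q_odd] G \<beta>_cond n_pos q_odd by (auto simp: siegel_def)
  qed
  let ?q = "of_nat CARD('a) :: complex"
  interpret sp: siegel_spectrum n M ?q
    using s by (auto simp: siegel_spectrum_def siegel_spectrum_axioms_def)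
  have \<chi>': "\<chi> p = \<alpha> (multiplier n p) * \<beta> (chi_det n p)" if "p \<in> Siegel sp.G n" for p
    using \<chi>_eq that GM by simp
  obtain \<theta> where th: "sp.extension \<chi> \<theta>" and J: "\<theta> (Jmat n) = 1 \<or> odd n \<and> \<theta> (Jmat n) = - 1"
  proof (cases "\<forall>x. x \<noteq> 0 \<longrightarrow> \<beta> x = 1")
    case True
    then show ?thesis using that sp.extension_similitude[OF \<alpha> True \<chi>'] by blast
  next
    case False
    then have M1: "M = {1}" and pm: "pm_character \<beta>" and ex: "\<exists>x. x \<noteq> 0 \<and> \<beta> x \<noteq> 1"
      using \<beta>M \<beta> by (auto simp: pm_character_def mult_char_def power2_eq_1_iff)
    have o: "orth TYPE('a) n" using s unfolding M1 orth_def .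
    show ?thesis using that orth.extension_spin[OF o \<alpha> pm ex \<chi>'[unfolded M1]] unfolding M1 by blast
  qed
  note spectrum = sp.twisted_spectrum[OF th, folded GM]
  show ?thesis
  proof (intro conjI allI impI ballI)
    fix p assume "p \<in> Siegel G n"
    then have "p \<in> Siegel sp.G n" by (simp only: GM)
    then show "char_J n \<chi> p = \<chi> p" using sp.char_J_eq[OF th \<chi>'] by blast
  next
    fix m assume n: "n = 2 * m"
    then have "\<theta> (Jmat n) = 1" using J by simp
    then have "(\<lambda>k. \<theta> (Jmat n) * sp.mu k) = sp.mu" by simp
    note sp' = spectrum[unfolded this]
    define S where "S = image_mset (\<lambda>i. (- 1) ^ (m - i div 2) * ?q ^ (m * (m - 1) + (i div 2)\<^sup>2)) (mset_set {1..n + 1})"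
    have S: "image_mset sp.mu (mset_set {..<Suc n}) = S" unfolding S_def by (rule sp.mu_mset_even[OF n])
    have "set_mset S = sp.mu ` {..n}" unfolding S[symmetric] by (simp add: lessThan_Suc_atMost)
    then show "let M = image_mset (\<lambda>i. (- 1) ^ (m - i div 2) * ?q ^ (m * (m - 1) + (i div 2)\<^sup>2)) (mset_set {1..n + 1})
      in diagonalizable_on (intertwiner G n) (Ind G n \<chi>) \<and>
         has_eigenvalue_mset_on (intertwiner G n) (Ind_eqv G n \<chi>) M \<and>
         eigenvalues_on (intertwiner G n) (Ind G n \<chi>) = set_mset M"
      unfolding Let_def S_def[symmetric] using sp'(1) sp'(2) sp'(3)[unfolded S] by simp
  next
    fix m assume n: "n = 2 * m + 1"
    show "diagonalizable_on (intertwiner G n) (Ind G n \<chi>)" by (rule spectrum(1))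
    show "eigenvalues_on (intertwiner G n) (Ind G n \<chi>) =
        (\<Union>i\<in>{0..m}. {?q ^ (m\<^sup>2 + i * (i + 1)), - (?q ^ (m\<^sup>2 + i * (i + 1)))})"
      unfolding spectrum(2) by (rule sp.mu_set_odd[OF n]) (use J in auto)
  qed
qed

end
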